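(* Let $G$ be a finite group and $V$ a complex irreducible representation of $G$, with $n=\dim V$, Schur index $m=m_{\mathbb{Q}}(V)$, fields $K\subseteq L$, and elements $u_s^1\in L[G]\,e_V$ and $k_s=\sum_{\tau\in\operatorname{Gal}(L/K)}\tau(u_s^1)\in K[G]$, $1\le s\le\frac nm$, as in the context. Let $\mathcal{W}$ be the rational irreducible representation associated to $V$. For each $s\in\{1,\ldots,\frac nm\}$ set $$f_s=\sum_{\varphi\in\operatorname{Gal}(K/\mathbb{Q})}\varphi(k_s)=\sum_{\sigma\in\operatorname{Gal}(L/\mathbb{Q})}\sigma(u_s^1).$$ Then the $f_s$ are primitive orthogonal idempotents in $\mathbb{Q}[G]\,e_{\mathcal{W}}$ and they satisfy $$e_{\mathcal{W}}=f_1+f_2+\cdots+f_{n/m}.$$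
   Context: $K$ is the field obtained by adjoining to $\mathbb{Q}$ the values of the character $\chi_V$ of $V$. $L\supseteq K$ is a field of definition of $V$ (i.e. $V$ can be realized by matrices over $L$) with $[L:K]=m=m_{\mathbb{Q}}(V)$, the Schur index, and such that $L/\mathbb{Q}$ is Galois; $\operatorname{Gal}(L/K)=\{\tau_1=1,\ldots,\tau_m\}$, and Galois groups act on group algebras coefficientwise. $e_V=\frac{\dim V}{|G|}\sum_{g\in G}\chi_V(g^{-1})\,g\in K[G]$. The rational irreducible representation $\mathcal{W}$ associated to $V$ is the irreducible $\mathbb{Q}$-representation of $G$ with $L\otimes_{\mathbb{Q}}\mathcal{W}\simeq\bigoplus_{\sigma\in\operatorname{Gal}(L/\mathbb{Q})}V^{\sigma}$, where $V^\sigma$ is the Galois conjugate representation. The corresponding central idempotent of $\mathbb{Q}[G]$ is $e_{\mathcal{W}}=\frac{\dim V}{|G|}\sum_{g\in G}\operatorname{Trace}_{K/\mathbb{Q}}(\chi_V(g^{-1}))\,g$. The elements $u_s^1$: let $\ell_1,\ldots,\ell_n$ be primitive orthogonal idempotents of $L[G]\,e_V$ with sum $e_V$. The $\{u_s^1\}_{s=1}^{n/m}$ are primitive orthogonal idempotents lying in different left ideals $J_s=L[G]\,\ell_{j_s}$ such that, with $u_s^h=\tau_h(u_s^1)$: (1) $u_s^h$ is a primitive idempotent generating the left ideal $\tau_h(J_s)=L[G]\,\tau_h(\ell_{j_s})$ for all $h,s$; (2) $u_s^hu_t^l=u_s^h$ if $(s,h)=(t,l)$ and $0$ otherwise; (3)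 $L[G]\,e_V$ is the direct sum of the left ideals generated by the $u_s^h$, and $e_V=\sum_{s=1}^{n/m}\sum_{h=1}^m u_s^h$. (Such elements exist for every choice of the $\ell_j$.) *)

theory Defs
  imports
    "HOL-Algebra.Algebra"
    "HOL-Algebra.Algebraic_Closure_Type"
    "Jordan_Normal_Form.Matrix"
begin

abbreviation complex_ring :: "complex ring" where
  "complex_ring \<equiv> ring_of_type_algebra"

text \<open>Automorphisms of \<open>E\<close> over \<open>F\<close> are \<open>undefined\<close> outside \<open>E\<close> (part of \<^const>\<open>Bij\<close>), so that
  distinct members of \<open>Gal E F\<close> are distinct automorphisms.\<close>

definition Gal :: "complex set \<Rightarrow> complex set \<Rightarrow> (complex \<Rightarrow> complex) set" where
  "Gal E F = {\<sigma> \<in> Bij E.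
     \<sigma> \<in> Ring.ring_hom (complex_ring\<lparr>carrier := E\<rparr>) (complex_ring\<lparr>carrier := E\<rparr>) \<and>
     (\<forall>x\<in>F. \<sigma> x = x)}"

definition galois_extension :: "complex set \<Rightarrow> complex set \<Rightarrow> bool" where
  "galois_extension E F \<longleftrightarrow>
     subfield F complex_ring \<and> subfield E complex_ring \<and> F \<subseteq> E \<and>
     ring.finite_dimension complex_ring F E \<and>
     {x \<in> E. \<forall>\<sigma>\<in>Gal E F. \<sigma> x = x} = F"

text \<open>The trace of multiplication by \<open>x\<close> on the \<open>F\<close>-vector space \<open>E\<close>: \<open>A\<close> is the matrix of
  this map in the basis \<open>bs\<close>. The value does not depend on \<open>bs\<close>.\<close>

definition field_trace :: "complex set \<Rightarrow> complex set \<Rightarrow> complex \<Rightarrow> complex" where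
  "field_trace E F x = (THE t. \<exists>bs A.
     ring.independent complex_ring F bs \<and> ring.Span complex_ring F bs = E \<and>
     A \<in> carrier_mat (length bs) (length bs) \<and> elements_mat A \<subseteq> F \<and>
     (\<forall>j<length bs. x * bs ! j = (\<Sum>i<length bs. A $$ (i, j) * bs ! i)) \<and>
     t = (\<Sum>i<length bs. A $$ (i, i)))"

definition matrix_rep ::
  "('g, 'b) monoid_scheme \<Rightarrow> complex set \<Rightarrow> nat \<Rightarrow> ('g \<Rightarrow> complex mat) \<Rightarrow> bool" where
  "matrix_rep G F n \<rho> \<longleftrightarrow>
     (\<forall>g\<in>carrier G. \<rho> g \<in> carrier_mat n n \<and> elements_mat (\<rho> g) \<subseteq> F) \<and>
     \<rho> \<one>\<^bsub>G\<^esub> = 1\<^sub>m n \<and>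
     (\<forall>g\<in>carrier G. \<forall>h\<in>carrier G. \<rho> (g \<otimes>\<^bsub>G\<^esub> h) = \<rho> g * \<rho> h)"

definition equivalent_reps ::
  "('g, 'b) monoid_scheme \<Rightarrow> complex set \<Rightarrow> ('g \<Rightarrow> complex mat) \<Rightarrow> ('g \<Rightarrow> complex mat) \<Rightarrow> bool" where
  "equivalent_reps G F \<rho> \<rho>' \<longleftrightarrow>
     (\<exists>P Q. elements_mat P \<subseteq> F \<and> elements_mat Q \<subseteq> F \<and>
        (\<forall>g\<in>carrier G. similar_mat_wit (\<rho> g) (\<rho>' g) P Q))"

definition vec_space_over :: "complex set \<Rightarrow> nat \<Rightarrow> complex vec set" where
  "vec_space_over F n = {v \<in> carrier_vec n. \<forall>i<n. v $ i \<in> F}"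

definition invariant_subspace ::
  "('g, 'b) monoid_scheme \<Rightarrow> complex set \<Rightarrow> nat \<Rightarrow> ('g \<Rightarrow> complex mat) \<Rightarrow> complex vec set \<Rightarrow> bool" where
  "invariant_subspace G F n \<rho> U \<longleftrightarrow>
     U \<subseteq> vec_space_over F n \<and> 0\<^sub>v n \<in> U \<and>
     (\<forall>v\<in>U. \<forall>w\<in>U. v + w \<in> U) \<and>
     (\<forall>c\<in>F. \<forall>v\<in>U. c \<cdot>\<^sub>v v \<in> U) \<and>
     (\<forall>g\<in>carrier G. \<forall>v\<in>U. \<rho> g *\<^sub>v v \<in> U)"

definition irreducible_rep ::
  "('g, 'b) monoid_scheme \<Rightarrow> complex set \<Rightarrow> nat \<Rightarrow> ('g \<Rightarrow> complex mat) \<Rightarrow> bool" where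
  "irreducible_rep G F n \<rho> \<longleftrightarrow>
     matrix_rep G F n \<rho> \<and> n > 0 \<and>
     (\<forall>U. invariant_subspace G F n \<rho> U \<longrightarrow> U = {0\<^sub>v n} \<or> U = vec_space_over F n)"

definition rep_character :: "('g \<Rightarrow> complex mat) \<Rightarrow> 'g \<Rightarrow> complex" where
  "rep_character \<rho> g = sum_list (diag_mat (\<rho> g))"

definition character_field :: "('g, 'b) monoid_scheme \<Rightarrow> ('g \<Rightarrow> complex mat) \<Rightarrow> complex set" where
  "character_field G \<rho> = generate_field complex_ring (\<rat> \<union> rep_character \<rho> ` carrier G)"

definition field_of_definition ::
  "('g, 'b) monoid_scheme \<Rightarrow> nat \<Rightarrow> ('g \<Rightarrow> complex mat) \<Rightarrow> complex set \<Rightarrow> bool" where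
  "field_of_definition G n \<rho> L \<longleftrightarrow>
     subfield L complex_ring \<and>
     (\<exists>\<rho>'. matrix_rep G L n \<rho>' \<and> equivalent_reps G UNIV \<rho> \<rho>')"

text \<open>The Schur index over \<open>\<rat>\<close> of an irreducible complex representation: the least degree
  \<open>[L : K]\<close> of a field of definition \<open>L\<close> over the field \<open>K\<close> of character values.\<close>

definition schur_index :: "('g, 'b) monoid_scheme \<Rightarrow> nat \<Rightarrow> ('g \<Rightarrow> complex mat) \<Rightarrow> nat" where
  "schur_index G n \<rho> = (LEAST d. \<exists>L. field_of_definition G n \<rho> L \<and>
     character_field G \<rho> \<subseteq> L \<and> ring.dimension complex_ring d (character_field G \<rho>) L)"

text \<open>\<open>L \<otimes>\<^sub>\<rat> W\<close> is given by the matrices of \<open>W\<close>, read over \<open>L\<close>. It is isomorphic over \<open>L\<close> to the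
  direct sum of the Galois conjugates of a realization \<open>\<rho>'\<close> of \<open>\<rho>\<close> over \<open>L\<close>; the list \<open>\<sigma>s\<close>
  enumerates \<open>Gal L \<rat>\<close>.\<close>

definition associated_rational_rep ::
  "('g, 'b) monoid_scheme \<Rightarrow> complex set \<Rightarrow> nat \<Rightarrow> ('g \<Rightarrow> complex mat) \<Rightarrow>
     nat \<Rightarrow> ('g \<Rightarrow> complex mat) \<Rightarrow> bool" where
  "associated_rational_rep G L n \<rho> d W \<longleftrightarrow>
     irreducible_rep G \<rat> d W \<and>
     (\<exists>\<rho>' \<sigma>s. matrix_rep G L n \<rho>' \<and> equivalent_reps G UNIV \<rho> \<rho>' \<and>
        distinct \<sigma>s \<and> set \<sigma>s = Gal L \<rat> \<and>
        equivalent_reps G L W (\<lambda>g. diag_block_mat (map (\<lambda>\<sigma>. map_mat \<sigma> (\<rho>' g)) \<sigma>s)))"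

text \<open>Elements of \<open>F[G]\<close> are coefficient functions that vanish outside \<open>G\<close>. A field
  automorphism \<open>\<sigma>\<close> acts coefficientwise, that is, it takes \<open>a\<close> to \<open>\<sigma> \<circ> a\<close>.\<close>

definition group_algebra ::
  "('g, 'b) monoid_scheme \<Rightarrow> complex set \<Rightarrow> ('g \<Rightarrow> complex) ring" where
  "group_algebra G F = \<lparr>
     carrier = {a. (\<forall>g\<in>carrier G. a g \<in> F) \<and> (\<forall>g. g \<notin> carrier G \<longrightarrow> a g = 0)},
     monoid.mult = (\<lambda>a b g. if g \<in> carrier G
               then (\<Sum>h\<in>carrier G. a h * b (inv\<^bsub>G\<^esub> h \<otimes>\<^bsub>G\<^esub> g)) else 0),
     one = (\<lambda>g. if g = \<one>\<^bsub>G\<^esub> then 1 else 0),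
     ring.zero = (\<lambda>g. 0),
     add = (\<lambda>a b g. a g + b g)\<rparr>"

definition character_idempotent ::
  "('g, 'b) monoid_scheme \<Rightarrow> nat \<Rightarrow> ('g \<Rightarrow> complex mat) \<Rightarrow> 'g \<Rightarrow> complex" where
  "character_idempotent G n \<rho> = (\<lambda>g. if g \<in> carrier G
     then of_nat n / of_nat (card (carrier G)) * rep_character \<rho> (inv\<^bsub>G\<^esub> g) else 0)"

definition rational_idempotent ::
  "('g, 'b) monoid_scheme \<Rightarrow> nat \<Rightarrow> ('g \<Rightarrow> complex mat) \<Rightarrow> 'g \<Rightarrow> complex" where
  "rational_idempotent G n \<rho> = (\<lambda>g. if g \<in> carrier G
     then of_nat n / of_nat (card (carrier G)) *
       field_trace (character_field G \<rho>) \<rat> (rep_character \<rho> (inv\<^bsub>G\<^esub> g)) else 0)"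

text \<open>\<open>PIdl\<^bsub>R\<^esub> x\<close> is the set of the \<open>r \<otimes> x\<close>, which for a noncommutative ring \<open>R\<close> is the left ideal
  generated by \<open>x\<close>. For a central idempotent \<open>e\<close> of \<open>R\<close> it is also the underlying set of the ring
  \<open>R e\<close> with unit \<open>e\<close>.\<close>

definition block_ring :: "('a, 'b) ring_scheme \<Rightarrow> 'a \<Rightarrow> ('a, 'b) ring_scheme" where
  "block_ring R e = R\<lparr>carrier := PIdl\<^bsub>R\<^esub> e, one := e\<rparr>"

definition idempotent_elem :: "('a, 'b) ring_scheme \<Rightarrow> 'a \<Rightarrow> bool" where
  "idempotent_elem R e \<longleftrightarrow> e \<in> carrier R \<and> e \<otimes>\<^bsub>R\<^esub> e = e"

definition primitive_idempotent :: "('a, 'b) ring_scheme \<Rightarrow> 'a \<Rightarrow> bool" where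
  "primitive_idempotent R e \<longleftrightarrow>
     idempotent_elem R e \<and> e \<noteq> \<zero>\<^bsub>R\<^esub> \<and>
     (\<forall>a b. idempotent_elem R a \<and> idempotent_elem R b \<and>
        a \<otimes>\<^bsub>R\<^esub> b = \<zero>\<^bsub>R\<^esub> \<and> b \<otimes>\<^bsub>R\<^esub> a = \<zero>\<^bsub>R\<^esub> \<and> e = a \<oplus>\<^bsub>R\<^esub> b \<longrightarrow>
        a = \<zero>\<^bsub>R\<^esub> \<or> b = \<zero>\<^bsub>R\<^esub>)"

definition primitive_orthogonal_idempotents ::
  "('a, 'b) ring_scheme \<Rightarrow> 'i set \<Rightarrow> ('i \<Rightarrow> 'a) \<Rightarrow> bool" where
  "primitive_orthogonal_idempotents R I e \<longleftrightarrow>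
     (\<forall>i\<in>I. primitive_idempotent R (e i)) \<and>
     (\<forall>i\<in>I. \<forall>j\<in>I. i \<noteq> j \<longrightarrow> e i \<otimes>\<^bsub>R\<^esub> e j = \<zero>\<^bsub>R\<^esub>)"

definition is_direct_sum ::
  "('a, 'b) ring_scheme \<Rightarrow> 'a set \<Rightarrow> 'i set \<Rightarrow> ('i \<Rightarrow> 'a set) \<Rightarrow> bool" where
  "is_direct_sum R A I J \<longleftrightarrow> bij_betw (\<lambda>y. \<Oplus>\<^bsub>R\<^esub>i\<in>I. y i) (\<Pi>\<^sub>E i\<in>I. J i) A"

end

theory Submission
  imports Defs "Jordan_Normal_Form.Schur_Decomposition"
begin

text \<open>For \<open>\<sigma>\<close> in \<open>Gal L \<rat>\<close> outside \<open>Gal L K\<close> the product of \<open>e\<^sub>V\<close> and \<open>\<sigma> e\<^sub>V\<close> vanishes: a central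
  idempotent below \<open>e\<^sub>V\<close> acts on \<open>V\<close> as \<open>0\<close> or \<open>1\<close>, hence is \<open>0\<close> or \<open>e\<^sub>V\<close>. Therefore all conjugates
  \<open>\<sigma> u\<^sub>s\<close> with \<open>\<sigma>\<close> in \<open>Gal L \<rat>\<close> are orthogonal, and the \<open>f\<^sub>s\<close> are orthogonal idempotents with
  sum \<open>e\<^sub>W\<close>. For primitivity, the left ideal generated by an idempotent \<open>a\<close> has dimension
  \<open>|G| a(1)\<close>, because this is the trace of right multiplication by \<open>a\<close>. The \<open>n\<close> idempotents
  \<open>\<ell>\<^sub>j\<close> act on \<open>V\<close> with traces that are positive integers of sum \<open>n\<close>, so each trace is \<open>1\<close>; this
  gives \<open>|G| u\<^sub>s(1) = n\<close> and \<open>|G| f\<^sub>s(1) = n [L : \<rat>] = dim W\<close>. A nonzero summand of \<open>f\<^sub>s\<close> generates a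
  left ideal that maps onto the irreducible \<open>W\<close>, so two of them do not fit. The field \<open>K\<close> is normal
  over \<open>\<rat>\<close> because an automorphism takes \<open>\<chi>(g)\<close> to a value \<open>\<chi>(g\<^sup>j)\<close>.\<close>

text \<open>Two obstacles shape the development. A member of \<open>Gal L F\<close> acts on
  \<open>L\<close> only, so it can be applied neither to the complex matrices of \<open>V\<close>
  nor to roots of unity outside \<open>L\<close>; conjugation is therefore carried out on
  coefficients and traces. And the dimension of a left ideal is never formed: its substitute
  \<open>card (carrier G) * a \<one>\<close> is additive in \<open>a\<close> and commutes with
  automorphisms, which turns a count made over \<complex> for \<open>u s\<close> into a count over
  \<rat> for \<open>f s\<close>. The rational idempotent must also be recognised as a multiple of
  the character of \<open>W\<close>, for then a nonzero element below it cannot act on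
  \<open>W\<close> as zero. The character of \<open>W\<close> is a sum over
  \<open>Gal L \<rat>\<close>, the idempotent is given by a trace from \<open>K\<close>, and
  comparing the two requires that every automorphism of \<open>K\<close> extends to
  \<open>L\<close>. This is obtained from linear independence of automorphisms, not by extending
  embeddings of fields.\<close>

no_notation fps_nth (infixl \<open>$\<close> 75)

section \<open>Subfields of the complex numbers and their automorphisms\<close>

lemma complex_ring_sel [simp]:
  "carrier complex_ring = UNIV" "x \<otimes>\<^bsub>complex_ring\<^esub> y = x * y" "x \<oplus>\<^bsub>complex_ring\<^esub> y = x + y"
  "\<one>\<^bsub>complex_ring\<^esub> = 1" "\<zero>\<^bsub>complex_ring\<^esub> = 0"
  by (simp_all add: ring_of_type_algebra_def)

interpretation complex_ring: ring complex_ring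
  by (rule ring_from_type_algebra)

lemma complex_ring_a_inv [simp]: "\<ominus>\<^bsub>complex_ring\<^esub> x = - x"
  using complex_ring.minus_equality[of "- x" x] by simp

lemma complex_ring_m_inv [simp]: "x \<noteq> 0 \<Longrightarrow> inv\<^bsub>complex_ring\<^esub> x = inverse x"
  using complex_ring.inv_unique'[of x "inverse x"] by simp

lemma complex_ring_subfieldI:
  assumes "1 \<in> F" "\<And>x y. x \<in> F \<Longrightarrow> y \<in> F \<Longrightarrow> x + y \<in> F" "\<And>x. x \<in> F \<Longrightarrow> - x \<in> F"
    "\<And>x y. x \<in> F \<Longrightarrow> y \<in> F \<Longrightarrow> x * y \<in> F" "\<And>x. x \<in> F \<Longrightarrow> inverse x \<in> F"
  shows "subfield F complex_ring"
  using assms by (intro field.subfieldI'[OF field_from_type_algebra] complex_ring.subringI) auto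

context
  fixes F :: "complex set"
  assumes F: "subfield F complex_ring"
begin

lemma subfield_one: "1 \<in> F" and subfield_zero: "0 \<in> F"
  and subfield_uminus: "x \<in> F \<Longrightarrow> - x \<in> F"
  and subfield_add: "x \<in> F \<Longrightarrow> y \<in> F \<Longrightarrow> x + y \<in> F"
  and subfield_mult: "x \<in> F \<Longrightarrow> y \<in> F \<Longrightarrow> x * y \<in> F"
  using subringE[OF subfieldE(1)[OF F]] by simp_all

lemma subfield_diff: "x \<in> F \<Longrightarrow> y \<in> F \<Longrightarrow> x - y \<in> F"
  using subfield_add[OF _ subfield_uminus, of x y] by simp

lemma subfield_inverse: "x \<in> F \<Longrightarrow> inverse x \<in> F"
  using complex_ring.subfield_m_inv(1)[OF F, of x] by (cases "x = 0") auto

lemma subfield_divide: "x \<in> F \<Longrightarrow> y \<in> F \<Longrightarrow> x / y \<in> F"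
  by (simp add: divide_inverse subfield_mult subfield_inverse)

lemma subfield_sum: "(\<And>i. i \<in> I \<Longrightarrow> f i \<in> F) \<Longrightarrow> (\<Sum>i\<in>I. f i) \<in> F"
  by (induction I rule: infinite_finite_induct) (auto intro: subfield_zero subfield_add)

lemma subfield_sum_list: "(\<And>x. x \<in> set xs \<Longrightarrow> f x \<in> F) \<Longrightarrow> (\<Sum>x\<leftarrow>xs. f x) \<in> F"
  by (induction xs) (auto intro: subfield_zero subfield_add)

lemma subfield_of_nat: "of_nat k \<in> F"
  by (induction k) (auto intro: subfield_zero subfield_one subfield_add)

lemma subfield_Rats: "\<rat> \<subseteq> F"
proof
  fix x :: complex assume "x \<in> \<rat>"
  then obtain a b where "x = of_int a / of_int b" by (auto elim: Rats_cases')
  moreover have "of_int i \<in> F" for i :: int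
    by (cases i rule: int_cases2) (auto intro: subfield_of_nat subfield_uminus)
  ultimately show "x \<in> F" by (auto intro: subfield_divide)
qed

end

lemma subfield_Rats_complex: "subfield \<rat> complex_ring"
  by (rule complex_ring_subfieldI) auto

lemma combine_complex_ring:
  "length ks = length us \<Longrightarrow> complex_ring.combine ks us = (\<Sum>i<length us. ks ! i * us ! i)"
  by (induction ks us rule: list_induct2) (simp_all add: sum.lessThan_Suc_shift del: sum.lessThan_Suc)

section \<open>Automorphism groups of subfields of \<complex>\<close>

lemma GalI:
  assumes "\<sigma> \<in> extensional E" "bij_betw \<sigma> E E"
    "\<And>x y. x \<in> E \<Longrightarrow> y \<in> E \<Longrightarrow> \<sigma> (x + y) = \<sigma> x + \<sigma> y"
    "\<And>x y. x \<in> E \<Longrightarrow> y \<in> E \<Longrightarrow> \<sigma> (x * y) = \<sigma> x * \<sigma> y" "\<sigma> 1 = 1"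
    "\<And>x. x \<in> F \<Longrightarrow> \<sigma> x = x"
  shows "\<sigma> \<in> Gal E F"
  using assms by (auto simp: Gal_def Bij_def Ring.ring_hom_def bij_betw_def)

lemma
  assumes "\<sigma> \<in> Gal E F"
  shows Gal_extensional: "\<sigma> \<in> extensional E" and Gal_bij: "bij_betw \<sigma> E E"
    and Gal_closed: "x \<in> E \<Longrightarrow> \<sigma> x \<in> E"
    and Gal_add: "x \<in> E \<Longrightarrow> y \<in> E \<Longrightarrow> \<sigma> (x + y) = \<sigma> x + \<sigma> y"
    and Gal_mult: "x \<in> E \<Longrightarrow> y \<in> E \<Longrightarrow> \<sigma> (x * y) = \<sigma> x * \<sigma> y"
    and Gal_one: "\<sigma> 1 = 1" and Gal_fixed: "x \<in> F \<Longrightarrow> \<sigma> x = x"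
  using assms by (auto simp: Gal_def Bij_def Ring.ring_hom_def)

lemma Gal_mono: "F \<subseteq> F' \<Longrightarrow> \<sigma> \<in> Gal E F' \<Longrightarrow> \<sigma> \<in> Gal E F"
  by (auto simp: Gal_def)

lemma Gal_restrict_id: "(\<lambda>x\<in>E. x) \<in> Gal E F" if "subfield E complex_ring" "F \<subseteq> E"
  using that(2) by (intro GalI) (auto simp: bij_betw_def inj_on_def subfield_add[OF that(1)]
    subfield_mult[OF that(1)] subfield_one[OF that(1)])

context
  fixes E :: "complex set"
  assumes E: "subfield E complex_ring"
begin

lemma Gal_zero: "\<sigma> \<in> Gal E F \<Longrightarrow> \<sigma> 0 = 0"
  using Gal_add[of \<sigma> E F 0 0] subfield_zero[OF E] by simp

lemma Gal_sum:
  assumes \<sigma>: "\<sigma> \<in> Gal E F"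
  shows "(\<And>i. i \<in> I \<Longrightarrow> f i \<in> E) \<Longrightarrow> \<sigma> (\<Sum>i\<in>I. f i) = (\<Sum>i\<in>I. \<sigma> (f i))"
  by (induction I rule: infinite_finite_induct)
    (simp_all add: Gal_zero[OF \<sigma>] Gal_add[OF \<sigma>] subfield_sum[OF E])

lemma Gal_uminus: "\<sigma> \<in> Gal E F \<Longrightarrow> x \<in> E \<Longrightarrow> \<sigma> (- x) = - \<sigma> x"
  using Gal_add[of \<sigma> E F x "- x"] Gal_zero[of \<sigma> F] subfield_uminus[OF E]
  by (simp add: add_eq_0_iff)

lemma Gal_diff: "\<sigma> \<in> Gal E F \<Longrightarrow> x \<in> E \<Longrightarrow> y \<in> E \<Longrightarrow> \<sigma> (x - y) = \<sigma> x - \<sigma> y"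
  using Gal_add[of \<sigma> E F x "- y"] Gal_uminus[of \<sigma> F y] subfield_uminus[OF E] by simp

lemma Gal_inverse_elem: "\<sigma> \<in> Gal E F \<Longrightarrow> x \<in> E \<Longrightarrow> \<sigma> (inverse x) = inverse (\<sigma> x)"
proof (cases "x = 0")
  case False
  assume "\<sigma> \<in> Gal E F" "x \<in> E"
  then have "\<sigma> x * \<sigma> (inverse x) = 1"
    using False Gal_mult[of \<sigma> E F x "inverse x"] Gal_one[of \<sigma> E F] subfield_inverse[OF E] by simp
  then show ?thesis by (metis inverse_unique)
qed (simp add: Gal_zero)

lemma Gal_compose:
  assumes \<sigma>: "\<sigma> \<in> Gal E F" and \<tau>: "\<tau> \<in> Gal E F" and "F \<subseteq> E"
  shows "compose E \<sigma> \<tau> \<in> Gal E F"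
proof (rule GalI)
  show "bij_betw (compose E \<sigma> \<tau>) E E"
    using Gal_bij[OF \<tau>] Gal_bij[OF \<sigma>] by (rule bij_betw_compose)
qed (use \<open>F \<subseteq> E\<close> in \<open>auto simp: compose_eq Gal_add[OF \<sigma>] Gal_mult[OF \<sigma>] Gal_add[OF \<tau>] Gal_mult[OF \<tau>]
    Gal_closed[OF \<tau>] subfield_add[OF E] subfield_mult[OF E] subfield_one[OF E] Gal_one[OF \<sigma>]
    Gal_one[OF \<tau>] Gal_fixed[OF \<sigma>] Gal_fixed[OF \<tau>] subset_iff\<close>)

lemma Gal_inverse:
  assumes \<sigma>: "\<sigma> \<in> Gal E F" and "F \<subseteq> E"
  obtains \<tau> where "\<tau> \<in> Gal E F" "\<And>x. x \<in> E \<Longrightarrow> \<tau> (\<sigma> x) = x" "\<And>x. x \<in> E \<Longrightarrow> \<sigma> (\<tau> x) = x"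
proof
  define \<tau> where "\<tau> = restrict (inv_into E \<sigma>) E"
  have bij: "bij_betw \<sigma> E E" and inj: "inj_on \<sigma> E"
    using Gal_bij[OF \<sigma>] by (auto simp: bij_betw_def)
  show l: "\<tau> (\<sigma> x) = x" if "x \<in> E" for x
    using that bij Gal_closed[OF \<sigma>] by (simp add: \<tau>_def bij_betw_inv_into_left)
  show r: "\<sigma> (\<tau> x) = x" if "x \<in> E" for x
    using that bij by (simp add: \<tau>_def bij_betw_inv_into_right)
  have bij': "bij_betw \<tau> E E"
    using bij_betw_inv_into[OF bij] unfolding \<tau>_def by (simp only: bij_betw_restrict_eq)
  then have cl: "\<tau> x \<in> E" if "x \<in> E" for x
    using that by (auto simp: bij_betw_def)
  note closed = cl subfield_add[OF E] subfield_mult[OF E] subfield_one[OF E]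
  show "\<tau> \<in> Gal E F"
  proof (rule GalI)
    fix x y assume xy: "x \<in> E" "y \<in> E"
    show "\<tau> (x + y) = \<tau> x + \<tau> y"
      by (rule inj_onD[OF inj]) (simp_all add: xy r closed Gal_add[OF \<sigma>])
    show "\<tau> (x * y) = \<tau> x * \<tau> y"
      by (rule inj_onD[OF inj]) (simp_all add: xy r closed Gal_mult[OF \<sigma>])
  next
    show "\<tau> 1 = 1"
      using l[OF subfield_one[OF E]] by (simp add: Gal_one[OF \<sigma>])
    show "\<tau> x = x" if "x \<in> F" for x
      using l[of x] that \<open>F \<subseteq> E\<close> Gal_fixed[OF \<sigma> that] by auto
  qed (use bij' in \<open>simp_all add: \<tau>_def\<close>)
qed

lemma sum_Gal_closed:
  assumes "H \<subseteq> Gal E F" "x \<in> E"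
  shows "(\<Sum>h\<in>H. h x) \<in> E"
  using assms by (intro subfield_sum[OF E]) (meson Gal_closed subsetD)

lemma Gal_sum_compose:
  assumes \<sigma>: "\<sigma> \<in> Gal E F" and "H \<subseteq> Gal E F'" "x \<in> E"
  shows "\<sigma> (\<Sum>h\<in>H. h x) = (\<Sum>h\<in>H. compose E \<sigma> h x)"
proof -
  have "\<sigma> (\<Sum>h\<in>H. h x) = (\<Sum>h\<in>H. \<sigma> (h x))"
    using assms(2,3) by (intro Gal_sum[OF \<sigma>]) (meson Gal_closed subsetD)
  then show ?thesis by (simp add: compose_eq assms(3))
qed

lemma Gal_compose_bij:
  assumes \<sigma>: "\<sigma> \<in> Gal E F" and "F \<subseteq> E"
  shows "bij_betw (compose E \<sigma>) (Gal E F) (Gal E F)"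
proof -
  obtain \<tau> where \<tau>: "\<tau> \<in> Gal E F" and l: "\<And>x. x \<in> E \<Longrightarrow> \<tau> (\<sigma> x) = x" and r: "\<And>x. x \<in> E \<Longrightarrow> \<sigma> (\<tau> x) = x"
    using Gal_inverse[OF assms] by metis
  show ?thesis
  proof (rule bij_betw_byWitness[where f' = "compose E \<tau>"])
    show "\<forall>a\<in>Gal E F. compose E \<tau> (compose E \<sigma> a) = a"
    proof
      fix a assume a: "a \<in> Gal E F"
      show "compose E \<tau> (compose E \<sigma> a) = a"
        by (rule extensionalityI[of _ E]) (simp_all add: Gal_extensional[OF a] compose_eq l Gal_closed[OF a])
    qed
    show "\<forall>a\<in>Gal E F. compose E \<sigma> (compose E \<tau> a) = a"
    proof
      fix a assume a: "a \<in> Gal E F"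
      show "compose E \<sigma> (compose E \<tau> a) = a"
        by (rule extensionalityI[of _ E]) (simp_all add: Gal_extensional[OF a] compose_eq r Gal_closed[OF a])
    qed
  qed (use assms \<tau> in \<open>auto intro: Gal_compose\<close>)
qed

end

text \<open>Induction on \<open>T\<close>: the new family represents the function
  \<open>h \<mapsto> (h c - t c) / (c - t c)\<close> times the old one, where \<open>c\<close> is moved by \<open>t\<close>.\<close>

lemma automorphisms_separating_family:
  assumes K: "subfield K complex_ring" and "finite T" "T \<subseteq> Gal K F" "(\<lambda>x\<in>K. x) \<notin> T"
  shows "\<exists>ps. set ps \<subseteq> K \<times> K \<and> (\<forall>h\<in>T. (\<Sum>(a, b)\<leftarrow>ps. b * h a) = 0) \<and> (\<Sum>(a, b)\<leftarrow>ps. b * a) = 1"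
  using assms(2-4)
proof (induction T rule: finite_induct)
  case empty
  show ?case using subfield_one[OF K] by (intro exI[of _ "[(1, 1)]"]) auto
next
  case (insert t T)
  then obtain ps where ps: "set ps \<subseteq> K \<times> K" "\<And>h. h \<in> T \<Longrightarrow> (\<Sum>(a, b)\<leftarrow>ps. b * h a) = 0"
    "(\<Sum>(a, b)\<leftarrow>ps. b * a) = 1" by auto
  have t: "t \<in> Gal K F" using insert.prems by auto
  obtain c where c: "c \<in> K" "t c \<noteq> c"
  proof -
    have "t \<noteq> (\<lambda>x\<in>K. x)" using insert.prems by auto
    then show ?thesis
      using that extensionalityI[OF Gal_extensional[OF t], of "\<lambda>x\<in>K. x"] by auto
  qed
  define e where "e = inverse (c - t c)"
  define qs where "qs = map (\<lambda>(a, b). (c * a, b * e)) ps @ map (\<lambda>(a, b). (a, - t c * b * e)) ps"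
  have e: "e \<in> K" using c Gal_closed[OF t] by (simp add: e_def subfield_inverse[OF K] subfield_diff[OF K])
  have "set qs \<subseteq> K \<times> K"
    using ps(1) c e Gal_closed[OF t]
    by (auto simp: qs_def intro!: subfield_mult[OF K] subfield_uminus[OF K])
  \<comment> \<open>Stated for any \<open>h\<close> that is multiplicative on \<open>K\<close>, so
    that it applies to the plain identity function as well as to members of
    \<open>Gal K F\<close>.\<close>
  moreover have eq: "(\<Sum>(a, b)\<leftarrow>qs. b * h a) = (h c - t c) * e * (\<Sum>(a, b)\<leftarrow>ps. b * h a)"
    if h: "\<And>x y. x \<in> K \<Longrightarrow> y \<in> K \<Longrightarrow> h (x * y) = h x * h y" for h
    using ps(1) unfolding qs_def
  proof (induction ps)
    case (Cons p ps)
    obtain a b where p: "p = (a, b)" by (cases p)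
    have "h (c * a) = h c * h a" using Cons.prems c p by (intro h) auto
    then show ?case using Cons by (simp add: p algebra_simps)
  qed simp
  moreover have "(\<Sum>(a, b)\<leftarrow>qs. b * h a) = 0" if "h \<in> insert t T" for h
  proof -
    have "h \<in> Gal K F" using that insert.prems by auto
    then show ?thesis using that ps(2)[of h] by (subst eq) (auto simp: Gal_mult[of h K F])
  qed
  moreover have "(\<Sum>(a, b)\<leftarrow>qs. b * a) = 1"
    using eq[of "\<lambda>x. x"] ps(3) c by (simp add: e_def)
  ultimately show ?case by blast
qed

text \<open>\<open>stable\<close> expresses normality of \<open>K\<close> over \<open>F\<close>.
  Finiteness of \<open>Gal L F\<close> is taken as an axiom because in the theorem it comes from the
  list of automorphisms inside \<open>associated_rational_rep\<close>. The degenerate towers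
  \<open>F K K\<close> and \<open>K K L\<close> are again instances, so each fact about sums over a
  Galois group is proved once.\<close>

locale galois_tower =
  fixes F K L :: "complex set"
  assumes F: "subfield F complex_ring" and K: "subfield K complex_ring" and L: "subfield L complex_ring"
    and FK: "F \<subseteq> K" and KL: "K \<subseteq> L" and finite_Gal: "finite (Gal L F)"
    and fixed_field: "\<And>x. x \<in> L \<Longrightarrow> (\<And>\<sigma>. \<sigma> \<in> Gal L F \<Longrightarrow> \<sigma> x = x) \<Longrightarrow> x \<in> F"
    and stable: "\<And>\<sigma> x. \<sigma> \<in> Gal L F \<Longrightarrow> x \<in> K \<Longrightarrow> \<sigma> x \<in> K"
begin

lemma FL: "F \<subseteq> L" using FK KL by simp

lemma restrict_Gal:
  assumes \<sigma>: "\<sigma> \<in> Gal L F"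
  shows "restrict \<sigma> K \<in> Gal K F"
proof (rule GalI)
  obtain \<tau> where \<tau>: "\<tau> \<in> Gal L F" and r: "\<And>x. x \<in> L \<Longrightarrow> \<sigma> (\<tau> x) = x"
    using Gal_inverse[OF L \<sigma> FL] by metis
  have "inj_on \<sigma> K"
    using Gal_bij[OF \<sigma>] KL by (auto simp: bij_betw_def intro: inj_on_subset)
  \<comment> \<open>Stability gives one inclusion; applied to the inverse \<tau> it gives the
    other.\<close>
  moreover have "\<sigma> ` K = K"
  proof (intro equalityI subsetI)
    fix x assume "x \<in> K"
    then show "x \<in> \<sigma> ` K" using r[of x] stable[OF \<tau>] KL by (intro image_eqI[of _ _ "\<tau> x"]) auto
  qed (use stable[OF \<sigma>] in auto)
  ultimately show "bij_betw (restrict \<sigma> K) K K"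
    by (simp add: bij_betw_def)
qed (use KL FK in \<open>auto simp: subfield_add[OF K] subfield_mult[OF K] subfield_one[OF K]
    Gal_add[OF \<sigma>] Gal_mult[OF \<sigma>] Gal_one[OF \<sigma>] Gal_fixed[OF \<sigma>] subset_iff\<close>)

lemma restrict_eq_id_iff:
  assumes \<sigma>: "\<sigma> \<in> Gal L F"
  shows "restrict \<sigma> K = (\<lambda>x\<in>K. x) \<longleftrightarrow> \<sigma> \<in> Gal L K"
proof
  assume eq: "restrict \<sigma> K = (\<lambda>x\<in>K. x)"
  have "\<sigma> x = x" if "x \<in> K" for x using fun_cong[OF eq, of x] that by simp
  then show "\<sigma> \<in> Gal L K" using \<sigma> by (simp add: Gal_def)
next
  assume \<sigma>': "\<sigma> \<in> Gal L K"
  show "restrict \<sigma> K = (\<lambda>x\<in>K. x)" by (auto simp: restrict_def Gal_fixed[OF \<sigma>'])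
qed

lemma sum_Gal_fixed:
  assumes "x \<in> L"
  shows "(\<Sum>\<sigma>\<in>Gal L F. \<sigma> x) \<in> F"
proof (rule fixed_field)
  show "(\<Sum>\<sigma>\<in>Gal L F. \<sigma> x) \<in> L"
    by (rule sum_Gal_closed[OF L order_refl assms])
  fix \<tau> assume \<tau>: "\<tau> \<in> Gal L F"
  have "\<tau> (\<Sum>\<sigma>\<in>Gal L F. \<sigma> x) = (\<Sum>\<sigma>\<in>Gal L F. compose L \<tau> \<sigma> x)"
    by (rule Gal_sum_compose[OF L \<tau> order_refl assms])
  also have "\<dots> = (\<Sum>\<sigma>\<in>Gal L F. \<sigma> x)"
    using sum.reindex_bij_betw[OF Gal_compose_bij[OF L \<tau> FL], of "\<lambda>\<sigma>. \<sigma> x"] by simp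
  finally show "\<tau> (\<Sum>\<sigma>\<in>Gal L F. \<sigma> x) = (\<Sum>\<sigma>\<in>Gal L F. \<sigma> x)" .
qed

lemma finite_Gal_sub: "finite (Gal L K)"
  using finite_Gal by (rule rev_finite_subset) (use Gal_mono[OF FK] in auto)

lemma id_in_Gal: "(\<lambda>x\<in>L. x) \<in> Gal L F" "(\<lambda>x\<in>L. x) \<in> Gal L K"
  using Gal_restrict_id[OF L] FL KL by auto

lemma card_Gal_sub_pos: "card (Gal L K) > 0"
  using finite_Gal_sub id_in_Gal by (auto simp: card_gt_0_iff)

text \<open>Two automorphisms agree on \<open>K\<close> exactly when they differ by a right factor
  in \<open>Gal L K\<close>, so the fibres of restriction are left cosets. Sums over
  \<open>Gal L F\<close> are later split along them.\<close>

lemma restrict_fibre: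
  assumes \<sigma>: "\<sigma> \<in> Gal L F"
  shows "bij_betw (compose L \<sigma>) (Gal L K) {\<rho> \<in> Gal L F. restrict \<rho> K = restrict \<sigma> K}"
proof -
  obtain \<tau> where \<tau>: "\<tau> \<in> Gal L F" and l: "\<And>x. x \<in> L \<Longrightarrow> \<tau> (\<sigma> x) = x" and r: "\<And>x. x \<in> L \<Longrightarrow> \<sigma> (\<tau> x) = x"
    using Gal_inverse[OF L \<sigma> FL] by metis
  have "compose L \<sigma> ` Gal L K = {\<rho> \<in> Gal L F. restrict \<rho> K = restrict \<sigma> K}"
  proof (intro equalityI subsetI)
    fix \<rho> assume "\<rho> \<in> compose L \<sigma> ` Gal L K"
    then obtain \<alpha> where \<alpha>: "\<alpha> \<in> Gal L K" "\<rho> = compose L \<sigma> \<alpha>" by auto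
    have "\<rho> x = \<sigma> x" if "x \<in> K" for x
      using that KL by (auto simp: \<alpha>(2) compose_eq Gal_fixed[OF \<alpha>(1)])
    then show "\<rho> \<in> {\<rho> \<in> Gal L F. restrict \<rho> K = restrict \<sigma> K}"
      using \<alpha> Gal_compose[OF L \<sigma> Gal_mono[OF FK \<alpha>(1)] FL] by (auto simp: restrict_def)
  next
    fix \<rho> assume "\<rho> \<in> {\<rho> \<in> Gal L F. restrict \<rho> K = restrict \<sigma> K}"
    then have \<rho>: "\<rho> \<in> Gal L F" and "restrict \<rho> K = restrict \<sigma> K" by auto
    then have eq: "\<rho> x = \<sigma> x" if "x \<in> K" for x
      using that fun_cong[of _ _ x] by (metis restrict_apply')
    have "compose L \<tau> \<rho> x = x" if "x \<in> K" for x
      using that KL eq by (auto simp: compose_eq l)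
    then have "compose L \<tau> \<rho> \<in> Gal L K"
      using Gal_compose[OF L \<tau> \<rho> FL] by (simp add: Gal_def)
    moreover have "\<rho> = compose L \<sigma> (compose L \<tau> \<rho>)"
      by (rule extensionalityI[of _ L]) (simp_all add: Gal_extensional[OF \<rho>] compose_eq r Gal_closed[OF \<rho>])
    ultimately show "\<rho> \<in> compose L \<sigma> ` Gal L K" by blast
  qed
  moreover have "inj_on (compose L \<sigma>) (Gal L K)"
    using Gal_compose_bij[OF L \<sigma> FL] Gal_mono[OF FK]
    by (auto simp: bij_betw_def intro: inj_on_subset)
  ultimately show ?thesis by (simp add: bij_betw_def)
qed

text \<open>For an automorphism outside the image \<open>H\<close> of restriction, a family separating the identity from
  the rest of \<open>H \<union> \<phi> H\<close> would distinguish the equal sums \<open>\<Sum>h\<in>H. h x\<close> and \<open>\<Sum>h\<in>H. \<phi> (h x)\<close>.\<close>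

lemma restrict_Gal_surj: "(\<lambda>\<sigma>. restrict \<sigma> K) ` Gal L F = Gal K F"
proof (intro equalityI subsetI)
  define H where "H = (\<lambda>\<sigma>. restrict \<sigma> K) ` Gal L F"
  let ?id = "\<lambda>x\<in>K. x"
  fix \<phi> assume \<phi>: "\<phi> \<in> Gal K F"
  show "\<phi> \<in> (\<lambda>\<sigma>. restrict \<sigma> K) ` Gal L F"
  proof (rule ccontr)
    assume "\<phi> \<notin> (\<lambda>\<sigma>. restrict \<sigma> K) ` Gal L F"
    then have nH: "\<phi> \<notin> H" by (simp add: H_def)
    have finH: "finite H" using finite_Gal by (simp add: H_def)
    have HK: "H \<subseteq> Gal K F" using restrict_Gal by (auto simp: H_def)
    have idH: "?id \<in> H"
      unfolding H_def by (rule image_eqI[OF _ id_in_Gal(1)]) (use KL in \<open>auto simp: restrict_def fun_eq_iff\<close>)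
    \<comment> \<open>Otherwise \<phi> would be inverse to the restriction of some \<sigma>, hence
      the restriction of the inverse of \<sigma>, and would belong to \<open>H\<close>.\<close>
    have nid: "?id \<notin> compose K \<phi> ` H"
    proof
      assume "?id \<in> compose K \<phi> ` H"
      then obtain \<sigma> where \<sigma>: "\<sigma> \<in> Gal L F" and eq: "?id = compose K \<phi> (restrict \<sigma> K)"
        by (auto simp: H_def)
      obtain \<tau> where \<tau>: "\<tau> \<in> Gal L F" and r: "\<And>x. x \<in> L \<Longrightarrow> \<sigma> (\<tau> x) = x"
        using Gal_inverse[OF L \<sigma> FL] by metis
      have "\<phi> y = \<tau> y" if y: "y \<in> K" for y
        using fun_cong[OF eq, of "\<tau> y"] r[of y] stable[OF \<tau> y] y KL by (auto simp: compose_eq)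
      then have "\<phi> = restrict \<tau> K"
        by (intro extensionalityI[of _ K] Gal_extensional[OF \<phi>]) auto
      then show False using nH \<tau> by (auto simp: H_def)
    qed
    define T where "T = (H - {?id}) \<union> compose K \<phi> ` H"
    have "T \<subseteq> Gal K F"
      using HK Gal_compose[OF K \<phi> _ FK] by (auto simp: T_def)
    moreover have "finite T" "?id \<notin> T" using finH nid by (auto simp: T_def)
    ultimately obtain ps where ps: "set ps \<subseteq> K \<times> K"
      "\<And>h. h \<in> T \<Longrightarrow> (\<Sum>(a, b)\<leftarrow>ps. b * h a) = 0" "(\<Sum>(a, b)\<leftarrow>ps. b * a) = 1"
      using automorphisms_separating_family[OF K, of T F] by metis
    \<comment> \<open>The sum over \<open>H\<close> is invariant under every member of
      \<open>H\<close>, hence lies in \<open>F\<close>, and \<phi> fixes \<open>F\<close>.\<close>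
    have tr: "(\<Sum>h\<in>H. compose K \<phi> h x) = (\<Sum>h\<in>H. h x)" if x: "x \<in> K" for x
    proof -
      have "y \<in> F" if y: "y \<in> K" "\<And>h. h \<in> H \<Longrightarrow> h y = y" for y
      proof (rule fixed_field)
        fix \<sigma> assume "\<sigma> \<in> Gal L F"
        then have "restrict \<sigma> K \<in> H" by (simp add: H_def)
        from y(2)[OF this] show "\<sigma> y = y" using y(1) by simp
      qed (use y KL in auto)
      moreover have "(\<Sum>h\<in>H. h x) \<in> K"
        by (rule sum_Gal_closed[OF K HK x])
      moreover have "h (\<Sum>h\<in>H. h x) = (\<Sum>h\<in>H. h x)" if h: "h \<in> H" for h
      proof -
        obtain \<sigma> where \<sigma>: "\<sigma> \<in> Gal L F" "h = restrict \<sigma> K" using h by (auto simp: H_def)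
        have h': "h \<in> Gal K F" using h HK by auto
        have comp: "compose K h ` H \<subseteq> H"
        proof
          fix g assume "g \<in> compose K h ` H"
          then obtain \<tau> where \<tau>: "\<tau> \<in> Gal L F" "g = compose K h (restrict \<tau> K)"
            by (auto simp: H_def)
          have "g = restrict (compose L \<sigma> \<tau>) K"
            using \<sigma>(2) \<tau>(2) KL stable[OF \<tau>(1)] by (auto simp: compose_def restrict_def fun_eq_iff)
          then show "g \<in> H" using Gal_compose[OF L \<sigma>(1) \<tau>(1) FL] by (auto simp: H_def)
        qed
        moreover have inj: "inj_on (compose K h) H"
          using Gal_compose_bij[OF K h' FK] HK by (auto simp: bij_betw_def intro: inj_on_subset)
        ultimately have bij: "bij_betw (compose K h) H H"
          using finH by (simp add: bij_betw_def endo_inj_surj)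
        have "h (\<Sum>g\<in>H. g x) = (\<Sum>g\<in>H. compose K h g x)"
          by (rule Gal_sum_compose[OF K h' HK x])
        also have "\<dots> = (\<Sum>h\<in>H. h x)"
          using sum.reindex_bij_betw[OF bij, of "\<lambda>h. h x"] by simp
        finally show ?thesis .
      qed
      ultimately have "(\<Sum>h\<in>H. h x) \<in> F" by blast
      then have "(\<Sum>h\<in>H. h x) = \<phi> (\<Sum>h\<in>H. h x)" using Gal_fixed[OF \<phi>] by simp
      also have "\<dots> = (\<Sum>h\<in>H. compose K \<phi> h x)"
        by (rule Gal_sum_compose[OF K \<phi> HK x])
      finally show ?thesis by simp
    qed
    have swap: "(\<Sum>(a, b)\<leftarrow>ps. b * (\<Sum>h\<in>H. q h a)) = (\<Sum>h\<in>H. \<Sum>(a, b)\<leftarrow>ps. b * q h a)"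
      for q :: "(complex \<Rightarrow> complex) \<Rightarrow> complex \<Rightarrow> complex"
      by (induction ps) (auto simp: sum.distrib sum_distrib_left)
    have "(\<Sum>h\<in>H. \<Sum>(a, b)\<leftarrow>ps. b * h a) = (\<Sum>h\<in>H. if h = ?id then 1 else 0)"
    proof (rule sum.cong[OF refl])
      fix h assume "h \<in> H"
      have "(\<Sum>(a, b)\<leftarrow>ps. b * ?id a) = (\<Sum>(a, b)\<leftarrow>ps. b * a)"
        using ps(1) by (intro arg_cong[of _ _ sum_list] map_cong) auto
      then show "(\<Sum>(a, b)\<leftarrow>ps. b * h a) = (if h = ?id then 1 else 0)"
        using ps(2)[of h] ps(3) \<open>h \<in> H\<close> by (auto simp: T_def)
    qed
    also have "\<dots> = 1" using finH idH by (simp add: sum.delta)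
    finally have "(\<Sum>(a, b)\<leftarrow>ps. b * (\<Sum>h\<in>H. h a)) = 1" by (simp add: swap)
    moreover have "(\<Sum>(a, b)\<leftarrow>ps. b * (\<Sum>h\<in>H. h a)) = (\<Sum>(a, b)\<leftarrow>ps. b * (\<Sum>h\<in>H. compose K \<phi> h a))"
      using ps(1) tr by (intro arg_cong[of _ _ sum_list] map_cong) auto
    moreover have "(\<Sum>(a, b)\<leftarrow>ps. b * (\<Sum>h\<in>H. compose K \<phi> h a)) = 0"
      unfolding swap by (intro sum.neutral ballI ps(2)) (simp add: T_def)
    ultimately show False by simp
  qed
qed (use restrict_Gal in auto)

lemma sum_Gal_fibres:
  fixes c :: "(complex \<Rightarrow> complex) \<Rightarrow> complex"
  shows "(\<Sum>\<sigma>\<in>Gal L F. c \<sigma>) = (\<Sum>\<phi>\<in>Gal K F. \<Sum>\<sigma>\<in>{\<sigma> \<in> Gal L F. restrict \<sigma> K = \<phi>}. c \<sigma>)"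
  using finite_Gal by (subst restrict_Gal_surj[symmetric]) (rule sum.image_gen)

text \<open>The coset of \<sigma> contributes \<sigma> applied to the sum over
  \<open>Gal L K\<close>. That this inner sum lies in \<open>K\<close> is a premise because \<phi>
  is specified on \<open>K\<close> only.\<close>

lemma sum_Gal_tower:
  assumes x: "x \<in> L" "(\<Sum>\<tau>\<in>Gal L K. \<tau> x) \<in> K"
  shows "(\<Sum>\<sigma>\<in>Gal L F. \<sigma> x) = (\<Sum>\<phi>\<in>Gal K F. \<phi> (\<Sum>\<tau>\<in>Gal L K. \<tau> x))"
proof -
  have "(\<Sum>\<sigma>\<in>{\<sigma> \<in> Gal L F. restrict \<sigma> K = \<phi>}. \<sigma> x) = \<phi> (\<Sum>\<tau>\<in>Gal L K. \<tau> x)" if "\<phi> \<in> Gal K F" for \<phi>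
  proof -
    have "\<phi> \<in> (\<lambda>\<sigma>. restrict \<sigma> K) ` Gal L F" using that by (simp only: restrict_Gal_surj)
    then obtain \<sigma> where \<sigma>: "\<sigma> \<in> Gal L F" "\<phi> = restrict \<sigma> K" by auto
    have "(\<Sum>\<sigma>\<in>{\<sigma> \<in> Gal L F. restrict \<sigma> K = \<phi>}. \<sigma> x) = (\<Sum>\<tau>\<in>Gal L K. compose L \<sigma> \<tau> x)"
      unfolding \<sigma>(2) using sum.reindex_bij_betw[OF restrict_fibre[OF \<sigma>(1)], of "\<lambda>\<rho>. \<rho> x"] by simp
    also have "\<dots> = \<sigma> (\<Sum>\<tau>\<in>Gal L K. \<tau> x)"
      by (rule Gal_sum_compose[OF L \<sigma>(1) order_refl x(1), symmetric])
    finally show ?thesis using x \<sigma>(2) by simp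
  qed
  then show ?thesis unfolding sum_Gal_fibres by (rule sum.cong[OF refl])
qed

text \<open>A form of Dedekind independence that detects the identity among all automorphisms of
  \<open>K\<close>. Its use is to recover an element from traces of its multiples, as in
  \<open>y = (\<Sum>(a, b)\<leftarrow>ps. b * t (y * a))\<close>.\<close>

lemma separating_family:
  obtains ps where "set ps \<subseteq> K \<times> K"
    "\<And>h. h \<in> Gal K F \<Longrightarrow> (\<Sum>(a, b)\<leftarrow>ps. b * h a) = (if h = (\<lambda>x\<in>K. x) then 1 else 0)"
proof -
  have "finite (Gal K F)" using restrict_Gal_surj finite_Gal by (metis finite_imageI)
  then have "\<exists>ps. set ps \<subseteq> K \<times> K \<and> (\<forall>h\<in>Gal K F - {\<lambda>x\<in>K. x}. (\<Sum>(a, b)\<leftarrow>ps. b * h a) = 0)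
      \<and> (\<Sum>(a, b)\<leftarrow>ps. b * a) = 1"
    by (intro automorphisms_separating_family[OF K]) auto
  then obtain ps where ps: "set ps \<subseteq> K \<times> K"
      "\<And>h. h \<in> Gal K F - {\<lambda>x\<in>K. x} \<Longrightarrow> (\<Sum>(a, b)\<leftarrow>ps. b * h a) = 0" "(\<Sum>(a, b)\<leftarrow>ps. b * a) = 1"
    by blast
  have "(\<Sum>(a, b)\<leftarrow>ps. b * (\<lambda>x\<in>K. x) a) = (\<Sum>(a, b)\<leftarrow>ps. b * a)"
    using ps(1) by (intro arg_cong[of _ _ sum_list] map_cong) auto
  then show ?thesis using that[OF ps(1)] ps(2,3) by auto
qed

text \<open>Expanding the sum of \<open>b * \<sigma> (x * a)\<close> over the family and over
  \<open>Gal L F\<close> leaves only those \<sigma> that are trivial on \<open>K\<close>, and these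
  fix \<open>x\<close>. So \<open>x\<close>, multiplied by the order of \<open>Gal L K\<close>, is a
  combination of traces in \<open>F\<close> with coefficients in \<open>K\<close>, and
  characteristic 0 permits the division.\<close>

lemma fixed_field_sub:
  assumes x: "x \<in> L" "\<And>\<tau>. \<tau> \<in> Gal L K \<Longrightarrow> \<tau> x = x"
  shows "x \<in> K"
proof -
  obtain ps where ps: "set ps \<subseteq> K \<times> K"
    "\<And>h. h \<in> Gal K F \<Longrightarrow> (\<Sum>(a, b)\<leftarrow>ps. b * h a) = (if h = (\<lambda>x\<in>K. x) then 1 else 0)"
    using separating_family by blast
  have "(\<Sum>(a, b)\<leftarrow>ps. b * (\<Sum>\<sigma>\<in>Gal L F. \<sigma> (x * a))) = (\<Sum>\<sigma>\<in>Gal L F. \<Sum>(a, b)\<leftarrow>ps. b * \<sigma> (x * a))"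
    by (induction ps) (auto simp: sum.distrib sum_distrib_left)
  also have "\<dots> = (\<Sum>\<sigma>\<in>Gal L F. if \<sigma> \<in> Gal L K then x else 0)"
  proof (rule sum.cong[OF refl])
    fix \<sigma> assume \<sigma>: "\<sigma> \<in> Gal L F"
    have "(\<Sum>(a, b)\<leftarrow>ps. b * \<sigma> (x * a)) = \<sigma> x * (\<Sum>(a, b)\<leftarrow>ps. b * restrict \<sigma> K a)"
      using ps(1)
    proof (induction ps)
      case (Cons p ps)
      obtain a b where p: "p = (a, b)" by (cases p)
      have "a \<in> K" using Cons.prems p by simp
      then have "\<sigma> (x * a) = \<sigma> x * \<sigma> a" using KL by (intro Gal_mult[OF \<sigma>] x(1)) auto
      then show ?case using Cons \<open>a \<in> K\<close> by (simp add: p algebra_simps)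
    qed simp
    then show "(\<Sum>(a, b)\<leftarrow>ps. b * \<sigma> (x * a)) = (if \<sigma> \<in> Gal L K then x else 0)"
      using ps(2)[OF restrict_Gal[OF \<sigma>]] x(2)[of \<sigma>] restrict_eq_id_iff[OF \<sigma>] by simp
  qed
  also have "\<dots> = of_nat (card (Gal L K)) * x"
    using finite_Gal Gal_mono[OF FK, of _ L] by (simp add: sum.If_cases Int_absorb1 subset_iff)
  finally have x_eq: "x = (\<Sum>(a, b)\<leftarrow>ps. b * (\<Sum>\<sigma>\<in>Gal L F. \<sigma> (x * a))) / of_nat (card (Gal L K))"
    using card_Gal_sub_pos by simp
  have "(\<Sum>(a, b)\<leftarrow>ps. b * (\<Sum>\<sigma>\<in>Gal L F. \<sigma> (x * a))) \<in> K"
  proof (rule subfield_sum_list[OF K])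
    fix p assume "p \<in> set ps"
    then obtain a b where "p = (a, b)" "a \<in> K" "b \<in> K" using ps(1) by (cases p) auto
    then show "(case p of (a, b) \<Rightarrow> b * (\<Sum>\<sigma>\<in>Gal L F. \<sigma> (x * a))) \<in> K"
      using sum_Gal_fixed[of "x * a"] x(1) KL FK by (auto intro!: subfield_mult[OF K] subfield_mult[OF L])
  qed
  from subfield_divide[OF K this subfield_of_nat[OF K]] show ?thesis by (subst x_eq)
qed

end

section \<open>The field trace as a sum over automorphisms\<close>

lemma (in galois_tower) galois_tower_self: "galois_tower F K K"
proof (rule galois_tower.intro)
  show "finite (Gal K F)" using finite_Gal by (simp flip: restrict_Gal_surj)
  show "x \<in> F" if "x \<in> K" "\<And>\<phi>. \<phi> \<in> Gal K F \<Longrightarrow> \<phi> x = x" for x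
  proof (rule fixed_field)
    fix \<sigma> assume "\<sigma> \<in> Gal L F"
    from that(2)[OF restrict_Gal[OF this]] show "\<sigma> x = x" using that(1) by simp
  qed (use that KL in auto)
  show "\<phi> x \<in> K" if "\<phi> \<in> Gal K F" "x \<in> K" for \<phi> x using Gal_closed[OF that] .
qed (rule F K FK order_refl)+

text \<open>A separating family yields, for every basis \<open>bs\<close>, a basis \<open>ds\<close>
  dual to it under the trace form. Then \<open>A $$ (i, j) = t (x * bs ! j * ds i)\<close>, and
  because the products \<open>bs ! i * ds i\<close> add up to 1, the diagonal of \<open>A\<close>
  adds up to \<open>t x\<close> whatever the basis.\<close>

lemma (in galois_tower) field_trace_eq:
  assumes fin: "complex_ring.finite_dimension F L" and x: "x \<in> K"
  shows "field_trace K F x = (\<Sum>\<phi>\<in>Gal K F. \<phi> x)"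
proof -
  interpret KK: galois_tower F K K by (rule galois_tower_self)
  define t where "t y = (\<Sum>\<phi>\<in>Gal K F. \<phi> y)" for y
  have t_F: "t y \<in> F" if "y \<in> K" for y
    unfolding t_def by (rule KK.sum_Gal_fixed[OF that])
  have t_add: "t (y + z) = t y + t z" if "y \<in> K" "z \<in> K" for y z
    unfolding t_def sum.distrib[symmetric] by (rule sum.cong[OF refl]) (rule Gal_add[OF _ that])
  have t_scale: "t (c * y) = c * t y" if "c \<in> F" "y \<in> K" for c y
    unfolding t_def sum_distrib_left
  proof (rule sum.cong[OF refl])
    fix \<phi> assume \<phi>: "\<phi> \<in> Gal K F"
    show "\<phi> (c * y) = c * \<phi> y" using that FK by (subst Gal_mult[OF \<phi>]) (auto simp: Gal_fixed[OF \<phi>])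
  qed
  have t_0: "t 0 = 0" using t_scale[of 0 0] subfield_zero[OF F] subfield_zero[OF K] by simp
  have t_sum: "t (\<Sum>i\<in>I. q i) = (\<Sum>i\<in>I. t (q i))" if "\<And>i. i \<in> I \<Longrightarrow> q i \<in> K" for I :: "nat set" and q
    using that by (induction I rule: infinite_finite_induct) (auto simp: t_0 t_add subfield_sum[OF K])
  have t_sum_list: "t (\<Sum>p\<leftarrow>ps. q p) = (\<Sum>p\<leftarrow>ps. t (q p))" if "\<And>p. p \<in> set ps \<Longrightarrow> q p \<in> K"
    for ps :: "(complex \<times> complex) list" and q
    using that by (induction ps) (auto simp: t_0 t_add subfield_sum_list[OF K])
  obtain ps where ps: "set ps \<subseteq> K \<times> K"
    "\<And>h. h \<in> Gal K F \<Longrightarrow> (\<Sum>(a, b)\<leftarrow>ps. b * h a) = (if h = (\<lambda>x\<in>K. x) then 1 else 0)"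
    using separating_family by blast
  have fin_K: "finite (Gal K F)" by (rule KK.finite_Gal)
  have expand: "y = (\<Sum>(a, b)\<leftarrow>ps. b * t (y * a))" if y: "y \<in> K" for y
  proof -
    have "(\<Sum>(a, b)\<leftarrow>ps. b * t (y * a)) = (\<Sum>\<phi>\<in>Gal K F. \<Sum>(a, b)\<leftarrow>ps. b * \<phi> (y * a))"
      unfolding t_def by (induction ps) (auto simp: sum.distrib sum_distrib_left)
    also have "\<dots> = (\<Sum>\<phi>\<in>Gal K F. if \<phi> = (\<lambda>x\<in>K. x) then y else 0)"
    proof (rule sum.cong[OF refl])
      fix \<phi> assume \<phi>: "\<phi> \<in> Gal K F"
      have "(\<Sum>(a, b)\<leftarrow>ps. b * \<phi> (y * a)) = \<phi> y * (\<Sum>(a, b)\<leftarrow>ps. b * \<phi> a)"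
        using ps(1)
      proof (induction ps)
        case (Cons p ps)
        obtain a b where p: "p = (a, b)" by (cases p)
        have "\<phi> (y * a) = \<phi> y * \<phi> a" using Cons.prems p by (intro Gal_mult[OF \<phi>] y) auto
        then show ?case using Cons by (simp add: p algebra_simps)
      qed simp
      then show "(\<Sum>(a, b)\<leftarrow>ps. b * \<phi> (y * a)) = (if \<phi> = (\<lambda>x\<in>K. x) then y else 0)"
        using ps(2)[OF \<phi>] y by simp
    qed
    also have "\<dots> = y" using fin_K KK.id_in_Gal(1) by simp
    finally show ?thesis by simp
  qed
  have ps_id: "(\<Sum>(a, b)\<leftarrow>ps. b * a) = 1"
  proof -
    have "(\<Sum>(a, b)\<leftarrow>ps. b * a) = (\<Sum>(a, b)\<leftarrow>ps. b * (\<lambda>x\<in>K. x) a)"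
      using ps(1) by (intro arg_cong[of _ _ sum_list] map_cong) auto
    then show ?thesis using ps(2)[OF KK.id_in_Gal(1)] by simp
  qed
  have coords: "\<exists>cs. set cs \<subseteq> F \<and> length cs = length bs \<and> y = (\<Sum>i<length bs. cs ! i * bs ! i)"
    if "complex_ring.independent F bs" "complex_ring.Span F bs = K" "y \<in> K" for bs y
    using complex_ring.Span_mem_iff_length_version[OF F, of bs y] that
    by (force simp: combine_complex_ring)
  have tr: "(\<Sum>i<length bs. A $$ (i, i)) = t x"
    if bs: "complex_ring.independent F bs" "complex_ring.Span F bs = K"
      and A: "A \<in> carrier_mat (length bs) (length bs)" "elements_mat A \<subseteq> F"
        "\<And>j. j < length bs \<Longrightarrow> x * bs ! j = (\<Sum>i<length bs. A $$ (i, j) * bs ! i)" for bs A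
  proof -
    let ?N = "length bs"
    have bsK: "bs ! i \<in> K" if "i < ?N" for i
      using complex_ring.Span_base_incl[OF F, of bs] bs(2) that nth_mem[OF that] by auto
    have "\<forall>y\<in>K. \<exists>cs. set cs \<subseteq> F \<and> length cs = ?N \<and> y = (\<Sum>i<?N. cs ! i * bs ! i)"
      using coords[OF bs] by blast
    then obtain C where C: "\<And>y. y \<in> K \<Longrightarrow> set (C y) \<subseteq> F \<and> length (C y) = ?N \<and> y = (\<Sum>i<?N. C y ! i * bs ! i)"
      by (auto dest!: bchoice)
    have CF: "C y ! i \<in> F" if "y \<in> K" "i < ?N" for y i
      using C[OF that(1)] that(2) by (metis nth_mem subsetD)
    have CK: "C y ! i \<in> K" if "y \<in> K" "i < ?N" for y i
      using CF[OF that] FK by auto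
    \<comment> \<open>Expand each \<open>b\<close> of the family in the basis and collect the
      factors \<open>a\<close> that belong to \<open>bs ! i\<close>.\<close>
    define ds where "ds i = (\<Sum>(a, b)\<leftarrow>ps. C b ! i * a)" for i
    have dsK: "ds i \<in> K" if "i < ?N" for i
      unfolding ds_def using ps(1) that CK by (intro subfield_sum_list[OF K]) (auto intro!: subfield_mult[OF K])
    have dual: "y = (\<Sum>i<?N. t (y * ds i) * bs ! i)" if y: "y \<in> K" for y
    proof -
      have "y = (\<Sum>(a, b)\<leftarrow>ps. b * t (y * a))" by (rule expand[OF y])
      also have "\<dots> = (\<Sum>(a, b)\<leftarrow>ps. (\<Sum>i<?N. C b ! i * bs ! i) * t (y * a))"
        using ps(1) C by (intro arg_cong[of _ _ sum_list] map_cong) auto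
      also have "\<dots> = (\<Sum>i<?N. (\<Sum>(a, b)\<leftarrow>ps. C b ! i * t (y * a)) * bs ! i)"
        by (induction ps) (auto simp: sum.distrib sum_distrib_left sum_distrib_right algebra_simps)
      also have "\<dots> = (\<Sum>i<?N. t (y * ds i) * bs ! i)"
      proof (rule sum.cong[OF refl])
        fix i assume "i \<in> {..<?N}"
        then have i: "i < ?N" by simp
        have "y * ds i = (\<Sum>(a, b)\<leftarrow>ps. C b ! i * (y * a))"
          unfolding ds_def by (induction ps) (auto simp: algebra_simps)
        also have "t \<dots> = (\<Sum>p\<leftarrow>ps. t (case p of (a, b) \<Rightarrow> C b ! i * (y * a)))"
          using ps(1) i y CK by (intro t_sum_list) (auto intro!: subfield_mult[OF K])
        also have "\<dots> = (\<Sum>(a, b)\<leftarrow>ps. C b ! i * t (y * a))"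
          using ps(1) i y CF
          by (intro arg_cong[of _ _ sum_list] map_cong) (auto intro!: t_scale subfield_mult[OF K])
        finally show "(\<Sum>(a, b)\<leftarrow>ps. C b ! i * t (y * a)) * bs ! i = t (y * ds i) * bs ! i" by simp
      qed
      finally show ?thesis .
    qed
    have "A $$ (i, j) = t (x * bs ! j * ds i)" if ij: "i < ?N" "j < ?N" for i j
    proof -
      define ks where "ks = map (\<lambda>i. A $$ (i, j)) [0..<?N]"
      define ks' where "ks' = map (\<lambda>i. t (x * bs ! j * ds i)) [0..<?N]"
      have xb: "x * bs ! j \<in> K" using x bsK ij by (intro subfield_mult[OF K])
      have "A $$ (i', j) \<in> elements_mat A" if "i' < ?N" for i'
        using A(1) ij(2) that by (intro elements_matI[of A ?N ?N i' j]) auto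
      then have "set ks \<subseteq> F" using A(2) by (auto simp: ks_def)
      moreover have "set ks' \<subseteq> F" using dsK xb by (auto simp: ks'_def intro!: t_F subfield_mult[OF K])
      moreover have "x * bs ! j = complex_ring.combine ks bs"
        using A(3)[OF ij(2)] by (simp add: combine_complex_ring ks_def)
      moreover have "x * bs ! j = complex_ring.combine ks' bs"
        using dual[OF xb] by (simp add: combine_complex_ring ks'_def)
      ultimately have "ks = ks'"
        using complex_ring.unique_decomposition[OF F bs(1), of "x * bs ! j"] xb bs(2)
        by (metis (no_types, lifting) ks_def ks'_def length_map length_upt diff_zero)
      then have "ks ! i = ks' ! i" by simp
      then show ?thesis using ij by (simp add: ks_def ks'_def)
    qed
    then have "(\<Sum>i<?N. A $$ (i, i)) = (\<Sum>i<?N. t (x * bs ! i * ds i))" by simp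
    also have "\<dots> = t (\<Sum>i<?N. x * bs ! i * ds i)"
      using x bsK dsK by (intro t_sum[symmetric]) (auto intro!: subfield_mult[OF K])
    also have "(\<Sum>i<?N. x * bs ! i * ds i) = x * (\<Sum>(a, b)\<leftarrow>ps. (\<Sum>i<?N. C b ! i * bs ! i) * a)"
      unfolding ds_def
      by (induction ps) (auto simp: sum.distrib sum_distrib_left sum_distrib_right algebra_simps)
    also have "(\<Sum>(a, b)\<leftarrow>ps. (\<Sum>i<?N. C b ! i * bs ! i) * a) = (\<Sum>(a, b)\<leftarrow>ps. b * a)"
      using ps(1) C by (intro arg_cong[of _ _ sum_list] map_cong) auto
    finally show ?thesis by (simp add: ps_id)
  qed
  \<comment> \<open>The \<open>THE\<close> needs a witness, that is, an actual basis of
    \<open>K\<close> over \<open>F\<close>; finite dimension is inherited from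
    \<open>L\<close>.\<close>
  have "subalgebra F K complex_ring"
    using subring.axioms(1)[OF subfieldE(1)[OF K]] FK
    by (auto simp: subalgebra_def subalgebra_axioms_def intro: subfield_mult[OF K])
  from complex_ring.subalbegra_incl_imp_finite_dimension[OF F fin this KL]
  obtain N where "complex_ring.dimension N F K" by (rule complex_ring.finite_dimensionE')
  from complex_ring.exists_base[OF F this]
  obtain bs where bs: "complex_ring.independent F bs" "complex_ring.Span F bs = K" by blast
  have bsK: "bs ! i \<in> K" if "i < length bs" for i
    using complex_ring.Span_base_incl[OF F, of bs] bs(2) that nth_mem[OF that] by auto
  have "\<forall>j<length bs. \<exists>cs. set cs \<subseteq> F \<and> length cs = length bs \<and> x * bs ! j = (\<Sum>i<length bs. cs ! i * bs ! i)"
    using coords[OF bs] x bsK by (auto intro!: subfield_mult[OF K])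
  then obtain C where C: "\<And>j. j < length bs \<Longrightarrow> set (C j) \<subseteq> F \<and> length (C j) = length bs
      \<and> x * bs ! j = (\<Sum>i<length bs. C j ! i * bs ! i)" by metis
  define A where "A = mat (length bs) (length bs) (\<lambda>(i, j). C j ! i)"
  have A: "A \<in> carrier_mat (length bs) (length bs)" by (simp add: A_def)
  have "C j ! i \<in> F" if "i < length bs" "j < length bs" for i j
    using C[OF that(2)] nth_mem[of i "C j"] that(1) by auto
  then have AF: "elements_mat A \<subseteq> F" by (auto simp: A_def elements_mat_def)
  have A': "\<forall>j<length bs. x * bs ! j = (\<Sum>i<length bs. A $$ (i, j) * bs ! i)"
    using C by (auto simp: A_def)
  show ?thesis
    unfolding field_trace_def t_def[symmetric]
  proof (rule the_equality)
    show "\<exists>bs A. complex_ring.independent F bs \<and> complex_ring.Span F bs = K \<and>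
     A \<in> carrier_mat (length bs) (length bs) \<and> elements_mat A \<subseteq> F \<and>
     (\<forall>j<length bs. x * bs ! j = (\<Sum>i<length bs. A $$ (i, j) * bs ! i)) \<and>
     t x = (\<Sum>i<length bs. A $$ (i, i))"
      by (intro exI[of _ bs] exI[of _ A] conjI bs A AF A' tr[OF bs A AF, symmetric]) (use A' in blast)
    fix u
    assume "\<exists>bs A. complex_ring.independent F bs \<and> complex_ring.Span F bs = K \<and>
     A \<in> carrier_mat (length bs) (length bs) \<and> elements_mat A \<subseteq> F \<and>
     (\<forall>j<length bs. x * bs ! j = (\<Sum>i<length bs. A $$ (i, j) * bs ! i)) \<and>
     u = (\<Sum>i<length bs. A $$ (i, i))"
    then obtain bs A where "complex_ring.independent F bs" "complex_ring.Span F bs = K"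
      "A \<in> carrier_mat (length bs) (length bs)" "elements_mat A \<subseteq> F"
      "\<And>j. j < length bs \<Longrightarrow> x * bs ! j = (\<Sum>i<length bs. A $$ (i, j) * bs ! i)"
      and u: "u = (\<Sum>i<length bs. A $$ (i, i))" by auto
    then show "u = t x" unfolding u by (intro tr)
  qed
qed

section \<open>Traces of matrices and roots of unity\<close>

definition mat_trace :: "complex mat \<Rightarrow> complex" where
  "mat_trace A = (\<Sum>i<dim_row A. A $$ (i, i))"

lemma rep_character_trace: "rep_character \<rho> g = mat_trace (\<rho> g)"
  by (simp add: rep_character_def diag_mat_def mat_trace_def sum_list_sum_nth atLeast0LessThan)

lemma mat_trace_comm:
  assumes "A \<in> carrier_mat n k" "B \<in> carrier_mat k n"
  shows "mat_trace (A * B) = mat_trace (B * A)"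
proof -
  have "mat_trace (A * B) = (\<Sum>i<n. \<Sum>j<k. A $$ (i, j) * B $$ (j, i))"
    using assms by (auto simp: mat_trace_def scalar_prod_def atLeast0LessThan)
  also have "\<dots> = (\<Sum>j<k. \<Sum>i<n. A $$ (i, j) * B $$ (j, i))"
    by (rule sum.swap)
  also have "\<dots> = mat_trace (B * A)"
    using assms by (auto simp: mat_trace_def scalar_prod_def atLeast0LessThan mult.commute intro!: sum.cong)
  finally show ?thesis .
qed

lemma mat_trace_similar:
  assumes "similar_mat_wit A B P Q"
  shows "mat_trace A = mat_trace B"
proof -
  note D = similar_mat_witD[OF refl assms]
  have "mat_trace A = mat_trace (Q * (P * B))"
    using D by (metis mat_trace_comm mult_carrier_mat)
  also have "Q * (P * B) = B"
    using D by (metis assoc_mult_mat left_mult_one_mat)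
  finally show ?thesis .
qed

lemma mat_trace_four_block_diag:
  assumes "A \<in> carrier_mat n n" "B \<in> carrier_mat k k"
  shows "mat_trace (four_block_mat A (0\<^sub>m n k) (0\<^sub>m k n) B) = mat_trace A + mat_trace B"
proof -
  have "mat_trace (four_block_mat A (0\<^sub>m n k) (0\<^sub>m k n) B)
      = (\<Sum>i<n + k. if i < n then A $$ (i, i) else B $$ (i - n, i - n))"
    using assms by (auto simp: mat_trace_def intro!: sum.cong)
  also have "\<dots> = (\<Sum>i<n. A $$ (i, i)) + (\<Sum>i<k. B $$ (i, i))"
    by (induction k) (auto simp: algebra_simps)
  finally show ?thesis using assms by (simp add: mat_trace_def)
qed

lemma mat_trace_diag_block_mat:
  "Ball (set As) square_mat \<Longrightarrow> mat_trace (diag_block_mat As) = (\<Sum>A\<leftarrow>As. mat_trace A)"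
proof (induction As)
  case (Cons A As)
  have "square_mat (diag_block_mat As)" using Cons.prems by (intro diag_block_mat_square) auto
  then have "mat_trace (diag_block_mat (A # As)) = mat_trace A + mat_trace (diag_block_mat As)"
    using Cons.prems unfolding diag_block_mat.simps Let_def
    by (subst mat_trace_four_block_diag[symmetric, of A "dim_row A" _ "dim_row (diag_block_mat As)"]) auto
  then show ?case using Cons by simp
qed (simp add: mat_trace_def)

lemma upper_triangular_mult:
  assumes AB: "A \<in> carrier_mat n n" "B \<in> carrier_mat n n"
    and ut: "upper_triangular A" "upper_triangular (B :: 'a :: semiring_0 mat)"
  shows "upper_triangular (A * B)" "i < n \<Longrightarrow> (A * B) $$ (i, i) = A $$ (i, i) * B $$ (i, i)"
proof -
  have z: "A $$ (i, k) * B $$ (k, j) = 0" if "i < n" "k < n" "k < i \<or> j < k" for i j k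
    using that upper_triangularD[OF ut(1), of k i] upper_triangularD[OF ut(2), of j k] AB by auto
  show "upper_triangular (A * B)"
  proof (rule upper_triangularI)
    fix i j assume "j < i" "i < dim_row (A * B)"
    then have ij: "j < i" "i < n" using AB by auto
    then have "(A * B) $$ (i, j) = (\<Sum>k<n. A $$ (i, k) * B $$ (k, j))"
      using AB by (auto simp: scalar_prod_def atLeast0LessThan)
    also have "\<dots> = 0" using ij by (intro sum.neutral ballI z) auto
    finally show "(A * B) $$ (i, j) = 0" .
  qed
  assume i: "i < n"
  then have "(A * B) $$ (i, i) = (\<Sum>k<n. A $$ (i, k) * B $$ (k, i))"
    using AB by (auto simp: scalar_prod_def atLeast0LessThan)
  also have "\<dots> = (\<Sum>k<n. if k = i then A $$ (i, i) * B $$ (i, i) else 0)"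
    using i by (intro sum.cong refl) (auto intro!: z)
  finally show "(A * B) $$ (i, i) = A $$ (i, i) * B $$ (i, i)" using i by simp
qed

lemma upper_triangular_pow_mat:
  assumes A: "A \<in> carrier_mat n n" and ut: "upper_triangular (A :: 'a :: comm_semiring_1 mat)"
  shows "upper_triangular (A ^\<^sub>m k) \<and> (\<forall>i<n. (A ^\<^sub>m k) $$ (i, i) = A $$ (i, i) ^ k)"
proof (induction k)
  case (Suc k)
  then show ?case
    using upper_triangular_mult[OF pow_carrier_mat[OF A] A _ ut, of k] by (simp add: mult.commute)
qed (use A in auto)

lemma complex_mat_triangularizable:
  fixes A :: "complex mat"
  assumes A: "A \<in> carrier_mat n n"
  obtains B P Q where "similar_mat_wit A B P Q" "upper_triangular B" "B \<in> carrier_mat n n"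
proof -
  obtain es where "char_poly A = (\<Prod>e\<leftarrow>es. [:- e, 1:])" using char_poly_factorized[OF A] by blast
  moreover obtain B P Q where "schur_decomposition A es = (B, P, Q)" by (metis prod_cases3)
  ultimately have *: "similar_mat_wit A B P Q \<and> upper_triangular B \<and> diag_mat B = es"
    by (rule schur_decomposition[OF A])
  then show ?thesis using that similar_mat_witD2(5)[OF A] by metis
qed

text \<open>In triangular form the diagonal entries of an idempotent are 0 or 1, and the trace
  counts the ones.\<close>

lemma mat_trace_idempotent:
  assumes A: "A \<in> carrier_mat n n" and idem: "A * A = A"
  shows "\<exists>k. mat_trace A = of_nat k"
proof -
  obtain B P Q where sim: "similar_mat_wit A B P Q" and ut: "upper_triangular B" and B: "B \<in> carrier_mat n n"
    using complex_mat_triangularizable[OF A] by metis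
  have "B * B = B"
  proof -
    note D = similar_mat_witD2[OF A sim] 
    note S = similar_mat_witD2[OF B similar_mat_wit_sym[OF sim]]
    have "B * B = Q * A * P * (Q * A * P)" using S(3) by simp
    also have "\<dots> = Q * (A * (P * Q) * A) * P" using D(4-7)
      by (simp add: assoc_mult_mat[of _ n n _ n _ n])
    also have "\<dots> = B" using D(1,4) S(3) idem by simp
    finally show ?thesis .
  qed
  then have d: "B $$ (i, i) * B $$ (i, i) = B $$ (i, i)" if "i < n" for i
    using upper_triangular_mult(2)[OF B B ut ut that] by simp
  have "mat_trace A = (\<Sum>i<n. B $$ (i, i))"
    using mat_trace_similar[OF sim] B by (simp add: mat_trace_def)
  also have "\<dots> = (\<Sum>i<n. if B $$ (i, i) = 1 then 1 else 0)"
    by (rule sum.cong[OF refl]) (use d in \<open>auto simp: algebra_simps\<close>)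
  also have "\<dots> = of_nat (card {i \<in> {..<n}. B $$ (i, i) = 1})"
    by (simp add: sum.If_cases Int_def)
  finally show ?thesis by blast
qed

text \<open>One triangularization serves all powers of \<open>A\<close>, so the same \<mu> works for
  every exponent \<open>k\<close>.\<close>

lemma mat_trace_power_roots_of_unity:
  assumes A: "A \<in> carrier_mat n n" and N: "A ^\<^sub>m N = 1\<^sub>m n"
  obtains \<mu> where "\<And>i. i < n \<Longrightarrow> \<mu> i ^ N = 1" "\<And>k. mat_trace (A ^\<^sub>m k) = (\<Sum>i<n. \<mu> i ^ k)"
proof -
  obtain B P Q where sim: "similar_mat_wit A B P Q" and ut: "upper_triangular B" and B: "B \<in> carrier_mat n n"
    using complex_mat_triangularizable[OF A] by metis
  have "mat_trace (A ^\<^sub>m k) = (\<Sum>i<n. B $$ (i, i) ^ k)" for k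
    using mat_trace_similar[OF similar_mat_wit_pow[OF sim, of k]] upper_triangular_pow_mat[OF B ut, of k] B
    by (simp add: mat_trace_def)
  moreover have "B ^\<^sub>m N = 1\<^sub>m n"
    using similar_mat_wit_pow_id[OF similar_mat_wit_sym[OF sim], of N] N similar_mat_witD2[OF A sim] by simp
  then have "B $$ (i, i) ^ N = 1" if "i < n" for i
    using upper_triangular_pow_mat[OF B ut, of N] that by simp
  ultimately show ?thesis using that[of "\<lambda>i. B $$ (i, i)"] by simp
qed

lemma mat_trace_minus:
  "A \<in> carrier_mat n n \<Longrightarrow> B \<in> carrier_mat n n \<Longrightarrow> mat_trace (A - B) = mat_trace A - mat_trace B"
  by (simp add: mat_trace_def sum_subtractf)

text \<open>\<open>T * S\<close> is an idempotent of trace \<open>d\<close> and \<open>P - T * S\<close> is again idempotent.\<close>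

lemma mat_trace_idempotent_ge:
  assumes P: "P \<in> carrier_mat N N" and T: "T \<in> carrier_mat N d" and S: "S \<in> carrier_mat d N"
    and PP: "P * P = P" and PT: "P * T = T" and SP: "S * P = S" and ST: "S * T = 1\<^sub>m d"
  shows "\<exists>k. mat_trace P = of_nat (d + k)"
proof -
  have TS: "T * S \<in> carrier_mat N N" using T S by simp
  have "P * (T * S) = T * S" using assoc_mult_mat[OF P T S] PT by simp
  moreover have "T * S * P = T * S" using assoc_mult_mat[OF T S P] SP by simp
  moreover have "T * S * (T * S) = T * S"
    using assoc_mult_mat[OF T S TS] assoc_mult_mat[OF S T S] ST S by simp
  ultimately have "(P - T * S) * (P - T * S) = P - T * S - (T * S - T * S)"
    using minus_mult_distrib_mat[OF P TS P] minus_mult_distrib_mat[OF P TS TS]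
      mult_minus_distrib_mat[OF minus_carrier_mat[OF TS, of P] P TS] PP by argo
  also have "\<dots> = P - T * S"
  proof -
    have "A - (B - B) = A" if "A \<in> carrier_mat N N" "B \<in> carrier_mat N N" for A B :: "complex mat"
      using that by (intro eq_matI) auto
    then show ?thesis using P TS by (metis minus_carrier_mat)
  qed
  finally obtain k where "mat_trace (P - T * S) = of_nat k"
    using mat_trace_idempotent[OF minus_carrier_mat[OF TS, of P]] by blast
  moreover have "mat_trace (T * S) = of_nat d"
    using mat_trace_comm[OF T S] ST by (simp add: mat_trace_def)
  ultimately have "mat_trace P = of_nat (d + k)"
    using mat_trace_minus[OF P TS] by (simp add: algebra_simps)
  then show ?thesis ..
qed

text \<open>\<open>S\<close> is a linear map onto a space of dimension \<open>d\<close>, with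
  section \<open>T\<close>, and both are compatible with the projection \<open>P\<close>. Indexing
  by an arbitrary finite set lets the group itself label rows and columns.\<close>

lemma trace_idempotent_ge:
  fixes P :: "'x \<Rightarrow> 'x \<Rightarrow> complex" and T :: "'x \<Rightarrow> nat \<Rightarrow> complex" and S :: "nat \<Rightarrow> 'x \<Rightarrow> complex"
  assumes A: "finite A"
    and PP: "\<And>x z. x \<in> A \<Longrightarrow> z \<in> A \<Longrightarrow> (\<Sum>y\<in>A. P x y * P y z) = P x z"
    and PT: "\<And>x i. x \<in> A \<Longrightarrow> i < d \<Longrightarrow> (\<Sum>y\<in>A. P x y * T y i) = T x i"
    and SP: "\<And>i y. i < d \<Longrightarrow> y \<in> A \<Longrightarrow> (\<Sum>x\<in>A. S i x * P x y) = S i y"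
    and ST: "\<And>i j. i < d \<Longrightarrow> j < d \<Longrightarrow> (\<Sum>x\<in>A. S i x * T x j) = (if i = j then 1 else 0)"
  shows "\<exists>k. (\<Sum>x\<in>A. P x x) = of_nat (d + k)"
proof -
  obtain h where h: "bij_betw h {0..<card A} A" using ex_bij_betw_nat_finite[OF A] by blast
  let ?N = "card A"
  have re: "(\<Sum>a = 0..<?N. q (h a)) = (\<Sum>x\<in>A. q x)" for q :: "'x \<Rightarrow> complex"
    by (rule sum.reindex_bij_betw[OF h])
  have hX: "h a \<in> A" if "a < ?N" for a using h that by (auto simp: bij_betw_def)
  define PM where "PM = mat ?N ?N (\<lambda>(a, b). P (h a) (h b))"
  define TM where "TM = mat ?N d (\<lambda>(a, i). T (h a) i)"
  define SM where "SM = mat d ?N (\<lambda>(i, a). S i (h a))"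
  have "\<exists>k. mat_trace PM = of_nat (d + k)"
  proof (rule mat_trace_idempotent_ge)
    show "PM \<in> carrier_mat ?N ?N" "TM \<in> carrier_mat ?N d" "SM \<in> carrier_mat d ?N"
      by (simp_all add: PM_def TM_def SM_def)
    show "PM * PM = PM"
      by (rule eq_matI) (auto simp: PM_def scalar_prod_def PP[OF hX hX] re[of "\<lambda>y. P _ y * P y _"])
    show "PM * TM = TM"
      by (rule eq_matI) (auto simp: PM_def TM_def scalar_prod_def PT[OF hX] re[of "\<lambda>y. P _ y * T y _"])
    show "SM * PM = SM"
      by (rule eq_matI) (auto simp: PM_def SM_def scalar_prod_def SP[OF _ hX] re[of "\<lambda>x. S _ x * P x _"])
    show "SM * TM = 1\<^sub>m d"
      by (rule eq_matI) (auto simp: SM_def TM_def scalar_prod_def ST re[of "\<lambda>x. S _ x * T x _"])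
  qed
  moreover have "mat_trace PM = (\<Sum>x\<in>A. P x x)"
    using re[of "\<lambda>x. P x x"] by (simp add: mat_trace_def PM_def atLeast0LessThan)
  ultimately show ?thesis by simp
qed

section \<open>Automorphisms, roots of unity and traces of matrices of finite order\<close>

lemma root_of_unity_eq_cis_power:
  assumes "N > 0" "w ^ N = 1"
  obtains j where "w = cis (2 * pi / real N) ^ j"
proof -
  have "w \<in> (\<lambda>k. cis (2 * pi * real k / real N)) ` {..<N}"
    using assms by (simp add: bij_betw_imp_surj_on[OF bij_betw_roots_unity])
  then show ?thesis using that by (auto simp: DeMoivre mult_ac)
qed

definition poly_over :: "complex set \<Rightarrow> complex poly set" where
  "poly_over L = {p. \<forall>i. coeff p i \<in> L}"

context
  fixes L :: "complex set"
  assumes L: "subfield L complex_ring"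
begin

lemma poly_over_diff: "p \<in> poly_over L \<Longrightarrow> q \<in> poly_over L \<Longrightarrow> p - q \<in> poly_over L"
  by (simp add: poly_over_def subfield_diff[OF L])

lemma poly_over_add: "p \<in> poly_over L \<Longrightarrow> q \<in> poly_over L \<Longrightarrow> p + q \<in> poly_over L"
  by (simp add: poly_over_def subfield_add[OF L])

lemma poly_over_monom: "c \<in> L \<Longrightarrow> monom c k \<in> poly_over L"
  by (auto simp: poly_over_def subfield_zero[OF L])

lemma poly_over_mult: "p \<in> poly_over L \<Longrightarrow> q \<in> poly_over L \<Longrightarrow> p * q \<in> poly_over L"
  by (auto simp: poly_over_def coeff_mult intro!: subfield_sum[OF L] subfield_mult[OF L])

text \<open>Division by the minimal polynomial, with leading terms removed one at a time to keep the
  quotient over \<open>L\<close>: the automorphism applied to it later is defined only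
  there.\<close>

lemma poly_over_minimal_dvd:
  assumes M: "M \<in> poly_over L" "M \<noteq> 0" "poly M z = 0"
    and min: "\<And>q. q \<in> poly_over L \<Longrightarrow> q \<noteq> 0 \<Longrightarrow> poly q z = 0 \<Longrightarrow> degree M \<le> degree q"
    and p: "p \<in> poly_over L" "poly p z = 0"
  shows "\<exists>q\<in>poly_over L. p = M * q"
  using p
proof (induction "degree p" arbitrary: p rule: less_induct)
  case less
  show ?case
  proof (cases "p = 0")
    case True
    then show ?thesis using subfield_zero[OF L] by (intro bexI[of _ 0]) (auto simp: poly_over_def)
  next
    case False
    then have deg: "degree M \<le> degree p" using min less.prems by blast
    define c where "c = monom (lead_coeff p / lead_coeff M) (degree p - degree M)"
    have c: "c \<in> poly_over L"
      using less.prems(1) M(1) unfolding c_def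
      by (intro poly_over_monom subfield_divide[OF L]) (auto simp: poly_over_def)
    have "coeff (c * M) (degree p) = lead_coeff p"
      using deg M(2) by (simp add: c_def coeff_monom_mult)
    moreover have "degree (c * M) \<le> degree p"
      using degree_mult_le[of c M] degree_monom_le[of "lead_coeff p / lead_coeff M" "degree p - degree M"] deg
      unfolding c_def by linarith
    ultimately have lt: "p - c * M = 0 \<or> degree (p - c * M) < degree p"
      by (intro eq_zero_or_degree_less) (auto intro: degree_diff_le)
    have r: "p - c * M \<in> poly_over L" "poly (p - c * M) z = 0"
      using less.prems c M by (auto intro: poly_over_diff poly_over_mult)
    have "\<exists>q\<in>poly_over L. p - c * M = M * q"
    proof (cases "p - c * M = 0")
      case True
      then show ?thesis using subfield_zero[OF L] by (intro bexI[of _ 0]) (auto simp: poly_over_def)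
    next
      case False
      then show ?thesis using less.hyps[OF _ r] lt by blast
    qed
    then obtain q where "q \<in> poly_over L" "p - c * M = M * q" by blast
    then show ?thesis by (intro bexI[of _ "q + c"]) (auto simp: algebra_simps intro: poly_over_add c)
  qed
qed

context
  fixes F :: "complex set" and \<sigma> :: "complex \<Rightarrow> complex"
  assumes \<sigma>: "\<sigma> \<in> Gal L F"
begin

lemma map_poly_Gal_mult:
  assumes "p \<in> poly_over L" "q \<in> poly_over L"
  shows "map_poly \<sigma> (p * q) = map_poly \<sigma> p * map_poly \<sigma> q"
proof (rule poly_eqI)
  fix i
  have pq: "coeff p j \<in> L" "coeff q j \<in> L" for j using assms by (auto simp: poly_over_def)
  show "coeff (map_poly \<sigma> (p * q)) i = coeff (map_poly \<sigma> p * map_poly \<sigma> q) i"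
    by (simp add: coeff_map_poly coeff_mult Gal_zero[OF L \<sigma>] Gal_sum[OF L \<sigma>] Gal_mult[OF \<sigma>] pq
      subfield_mult[OF L])
qed

text \<open>Let \<open>M\<close> be the minimal polynomial of the root of unity \<open>z\<close>
  over \<open>L\<close>. It divides \<open>U\<close>, that is X^N - 1, which \<sigma> fixes; hence
  every root of \<open>map_poly \<sigma> M\<close> is some power \<open>z ^ j\<close>. A polynomial
  over \<open>L\<close> that vanishes at \<open>z\<close> is a multiple of \<open>M\<close>, so this
  single \<open>j\<close> serves all of them. It stands in for an extension of \<sigma> that sends
  \<open>z\<close> to \<open>z ^ j\<close>.\<close>

lemma Gal_root_of_unity:
  assumes N: "N > 0"
  obtains j where "\<And>p. p \<in> poly_over L \<Longrightarrow> poly p (cis (2 * pi / real N)) = 0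
    \<Longrightarrow> poly (map_poly \<sigma> p) (cis (2 * pi / real N) ^ j) = 0"
proof -
  define z where "z = cis (2 * pi / real N)"
  define U :: "complex poly" where "U = monom 1 N - 1"
  have one: "(1 :: complex poly) \<in> poly_over L"
    using poly_over_monom[OF subfield_one[OF L], of 0] by (simp add: monom_0 one_pCons)
  have U: "U \<in> poly_over L" unfolding U_def
    by (intro poly_over_diff one poly_over_monom subfield_one[OF L])
  have zN: "z ^ N = 1" using N by (simp add: z_def DeMoivre)
  have Uz: "poly U z = 0" by (simp add: U_def poly_monom zN)
  have "coeff U N = 1" using N by (simp add: U_def)
  then have U0: "U \<noteq> 0" by auto
  define S where "S = {q. q \<in> poly_over L \<and> q \<noteq> 0 \<and> poly q z = 0}"
  have "U \<in> S" using U Uz U0 by (simp add: S_def)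
  then obtain M where "M \<in> S" and min: "\<And>q. q \<in> S \<Longrightarrow> degree M \<le> degree q"
    using arg_min_nat_lemma[of "\<lambda>q. q \<in> S" U degree] by metis
  then have M: "M \<in> poly_over L" "M \<noteq> 0" "poly M z = 0" by (auto simp: S_def)
  have dvd: "\<exists>q\<in>poly_over L. p = M * q" if "p \<in> poly_over L" "poly p z = 0" for p
    using min by (intro poly_over_minimal_dvd[OF M _ that]) (auto simp: S_def)
  have "degree M \<noteq> 0"
  proof
    assume "degree M = 0"
    then obtain a where "M = [:a:]" by (rule degree_eq_zeroE)
    then show False using M by simp
  qed
  \<comment> \<open>The leading coefficient survives, so \<open>map_poly \<sigma> M\<close> is still
    nonconstant and has a complex root.\<close>
  moreover have "\<sigma> (lead_coeff M) \<noteq> 0"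
  proof
    assume "\<sigma> (lead_coeff M) = 0"
    then have "lead_coeff M = 0"
      using Gal_bij[OF \<sigma>] Gal_zero[OF L \<sigma>] M(1) subfield_zero[OF L]
      by (auto simp: bij_betw_def inj_on_def poly_over_def simp del: leading_coeff_0_iff)
    then show False using M(2) by simp
  qed
  then have "degree (map_poly \<sigma> M) = degree M"
    by (simp add: map_poly_degree_eq)
  ultimately obtain w where w: "poly (map_poly \<sigma> M) w = 0"
    using alg_closed_imp_poly_has_root[of "map_poly \<sigma> M"] by auto
  obtain q where q: "q \<in> poly_over L" "U = M * q" using dvd[OF U Uz] by blast
  have "map_poly \<sigma> U = U"
    by (rule poly_eqI) (auto simp: U_def coeff_map_poly Gal_zero[OF L \<sigma>] Gal_one[OF \<sigma>] Gal_diff[OF L \<sigma>]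
      Gal_uminus[OF L \<sigma>] subfield_one[OF L] subfield_zero[OF L] coeff_1 split: if_splits)
  then have "U = map_poly \<sigma> M * map_poly \<sigma> q" using map_poly_Gal_mult[OF M(1) q(1)] q(2) by simp
  then have "poly U w = 0" using w by simp
  then have "w ^ N = 1" by (simp add: U_def poly_monom)
  then obtain j where wj: "w = z ^ j" unfolding z_def by (rule root_of_unity_eq_cis_power[OF N])
  show ?thesis
  proof (rule that[of j, folded z_def])
    fix p assume p: "p \<in> poly_over L" "poly p z = 0"
    from dvd[OF this] obtain q where "q \<in> poly_over L" "p = M * q" by blast
    then show "poly (map_poly \<sigma> p) (z ^ j) = 0"
      using map_poly_Gal_mult[OF M(1), of q] w by (simp add: wj)
  qed
qed

text \<open>An automorphism acts on the \<open>N\<close>-th roots of unity as a power map. The argument uses only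
  polynomials over \<open>L\<close>, so the automorphism need not be extended to the roots of unity.\<close>

lemma Gal_mat_trace_finite_order:
  assumes A: "A \<in> carrier_mat n n" and AN: "A ^\<^sub>m N = 1\<^sub>m n" and N: "N > 0" and tr: "mat_trace A \<in> L"
  shows "\<exists>j. \<sigma> (mat_trace A) = mat_trace (A ^\<^sub>m j)"
proof -
  define z where "z = cis (2 * pi / real N)"
  obtain \<mu> where \<mu>: "\<And>i. i < n \<Longrightarrow> \<mu> i ^ N = 1" "\<And>k. mat_trace (A ^\<^sub>m k) = (\<Sum>i<n. \<mu> i ^ k)"
    using mat_trace_power_roots_of_unity[OF A AN] by blast
  have "\<exists>a. \<mu> i = z ^ a" if "i < n" for i
    by (rule root_of_unity_eq_cis_power[OF N \<mu>(1)[OF that]]) (auto simp: z_def)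
  then obtain a where a: "\<And>i. i < n \<Longrightarrow> \<mu> i = z ^ a i" by metis
  \<comment> \<open>\<open>p\<close> vanishes at \<open>z\<close> because the trace is the sum of
    the powers \<open>z ^ a i\<close>. Apart from the subtracted trace its coefficients are natural
    numbers, so \<sigma> changes only the trace.\<close>
  define p where "p = (\<Sum>i<n. monom 1 (a i)) - monom (mat_trace A) 0"
  have p: "p \<in> poly_over L"
    unfolding poly_over_def p_def
    by (auto simp: coeff_sum intro!: subfield_diff[OF L] subfield_sum[OF L] tr
      intro: subfield_one[OF L] subfield_zero[OF L])
  have tr1: "mat_trace A = (\<Sum>i<n. \<mu> i)" using \<mu>(2)[of 1] A by simp
  have "poly p z = 0"
    by (simp add: p_def poly_sum poly_monom tr1 a)
  obtain j where "poly (map_poly \<sigma> p) (z ^ j) = 0"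
    using Gal_root_of_unity[OF N] p \<open>poly p z = 0\<close> unfolding z_def by blast
  moreover have "map_poly \<sigma> p = (\<Sum>i<n. monom 1 (a i)) - monom (\<sigma> (mat_trace A)) 0"
  proof (rule poly_eqI)
    fix k
    have "coeff (\<Sum>i<n. monom (1 :: complex) (a i)) k = of_nat (card {i \<in> {..<n}. a i = k})"
      by (simp add: coeff_sum sum.If_cases Int_def)
    moreover have "\<sigma> (of_nat c) = of_nat c" for c
      by (induction c) (auto simp: Gal_zero[OF L \<sigma>] Gal_one[OF \<sigma>] Gal_add[OF \<sigma>] subfield_one[OF L] subfield_of_nat[OF L])
    ultimately show "coeff (map_poly \<sigma> p) k = coeff ((\<Sum>i<n. monom 1 (a i)) - monom (\<sigma> (mat_trace A)) 0) k"
      using tr by (auto simp: p_def coeff_map_poly Gal_zero[OF L \<sigma>] Gal_diff[OF L \<sigma>] subfield_of_nat[OF L]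
        subfield_zero[OF L])
  qed
  ultimately have "\<sigma> (mat_trace A) = (\<Sum>i<n. (z ^ j) ^ a i)"
    by (simp add: poly_sum poly_monom)
  also have "\<dots> = (\<Sum>i<n. \<mu> i ^ j)" by (simp add: a mult.commute flip: power_mult)
  finally show ?thesis using \<mu>(2) by auto
qed

end

end

section \<open>Convolution and representations of finite groups\<close>

locale finite_group = group G for G :: "('g, 'b) monoid_scheme" (structure) +
  assumes finite_carrier: "finite (carrier G)"
begin

text \<open>The multiplication of \<open>group_algebra G F\<close> does not mention
  \<open>F\<close>; one operation serves the algebras over \<rat>, \<open>K\<close> and
  \<open>L\<close> together, and its identities need no closure conditions.\<close>

definition conv :: "('g \<Rightarrow> complex) \<Rightarrow> ('g \<Rightarrow> complex) \<Rightarrow> 'g \<Rightarrow> complex" (infixl \<open>\<star>\<close> 70) where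
  "a \<star> b = (\<lambda>g. if g \<in> carrier G then (\<Sum>h\<in>carrier G. a h * b (inv h \<otimes> g)) else 0)"

abbreviation GA :: "complex set \<Rightarrow> ('g \<Rightarrow> complex) set" where
  "GA F \<equiv> carrier (group_algebra G F)"

lemma GA_iff: "a \<in> GA F \<longleftrightarrow> (\<forall>g\<in>carrier G. a g \<in> F) \<and> (\<forall>g. g \<notin> carrier G \<longrightarrow> a g = 0)"
  by (simp add: group_algebra_def)

lemma GA_mono: "F \<subseteq> F' \<Longrightarrow> a \<in> GA F \<Longrightarrow> a \<in> GA F'"
  by (auto simp: GA_iff)

lemma group_algebra_mult [simp]: "a \<otimes>\<^bsub>group_algebra G F\<^esub> b = a \<star> b"
  by (simp add: group_algebra_def conv_def)

lemma group_algebra_zero [simp]: "\<zero>\<^bsub>group_algebra G F\<^esub> = (\<lambda>g. 0)"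
  and group_algebra_add [simp]: "a \<oplus>\<^bsub>group_algebra G F\<^esub> b = (\<lambda>g. a g + b g)"
  by (simp_all add: group_algebra_def)

lemma group_algebra_finsum:
  assumes F: "subfield F complex_ring" and a: "\<And>i. i \<in> I \<Longrightarrow> a i \<in> GA F"
  shows "(\<Oplus>\<^bsub>group_algebra G F\<^esub>i\<in>I. a i) = (\<lambda>g. \<Sum>i\<in>I. a i g)"
proof -
  interpret A: abelian_monoid "group_algebra G F"
    by (rule abelian_monoidI)
      (auto simp: GA_iff subfield_add[OF F] subfield_zero[OF F])
  show ?thesis using a
    by (induction I rule: infinite_finite_induct) (auto simp: A.finsum_infinite Pi_def)
qed

lemma sum_translate: "x \<in> carrier G \<Longrightarrow> (\<Sum>h\<in>carrier G. q (x \<otimes> h)) = (\<Sum>h\<in>carrier G. q h)"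
  for q :: "'g \<Rightarrow> complex"
  by (rule sum.reindex_bij_witness[where i = "\<lambda>h. inv x \<otimes> h" and j = "\<lambda>h. x \<otimes> h"])
    (auto simp: m_assoc[symmetric])

lemma sum_invert: "(\<Sum>h\<in>carrier G. q (inv h)) = (\<Sum>h\<in>carrier G. q h)"
  for q :: "'g \<Rightarrow> complex"
  by (rule sum.reindex_bij_witness[where i = "\<lambda>h. inv h" and j = "\<lambda>h. inv h"]) auto

lemma conv_closed: "a \<star> b \<in> GA F" if F: "subfield F complex_ring" and "a \<in> GA F" "b \<in> GA F"
  using that by (auto simp: GA_iff conv_def intro!: subfield_sum[OF F] subfield_mult[OF F])

lemma conv_assoc: "(a \<star> b) \<star> c = a \<star> (b \<star> c)"
proof
  fix g
  show "((a \<star> b) \<star> c) g = (a \<star> (b \<star> c)) g"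
  proof (cases "g \<in> carrier G")
    case g: True
    have shift: "(\<Sum>h\<in>carrier G. b (inv k \<otimes> h) * c (inv h \<otimes> g))
        = (\<Sum>h\<in>carrier G. b h * c (inv h \<otimes> (inv k \<otimes> g)))" if k: "k \<in> carrier G" for k
    proof -
      have "(\<Sum>h\<in>carrier G. b (inv k \<otimes> h) * c (inv h \<otimes> g))
          = (\<Sum>h\<in>carrier G. b (inv k \<otimes> (k \<otimes> h)) * c (inv (k \<otimes> h) \<otimes> g))"
        using sum_translate[OF k, of "\<lambda>h. b (inv k \<otimes> h) * c (inv h \<otimes> g)"] by simp
      also have "\<dots> = (\<Sum>h\<in>carrier G. b h * c (inv h \<otimes> (inv k \<otimes> g)))"
        using k g by (intro sum.cong refl) (simp add: m_assoc[symmetric] inv_mult_group)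
      finally show ?thesis .
    qed
    have "((a \<star> b) \<star> c) g = (\<Sum>h\<in>carrier G. \<Sum>k\<in>carrier G. a k * (b (inv k \<otimes> h) * c (inv h \<otimes> g)))"
      using g by (simp add: conv_def sum_distrib_right mult.assoc)
    also have "\<dots> = (\<Sum>k\<in>carrier G. a k * (\<Sum>h\<in>carrier G. b (inv k \<otimes> h) * c (inv h \<otimes> g)))"
      by (subst sum.swap) (simp add: sum_distrib_left)
    also have "\<dots> = (a \<star> (b \<star> c)) g"
      using g by (simp add: conv_def shift)
    finally show ?thesis .
  qed (simp add: conv_def)
qed

lemma conv_sum_left: "(\<lambda>g. \<Sum>i\<in>I. a i g) \<star> b = (\<lambda>g. \<Sum>i\<in>I. (a i \<star> b) g)"
  unfolding conv_def by (rule ext) (auto simp: sum_distrib_right intro: sum.swap)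

lemma conv_sum_right: "a \<star> (\<lambda>g. \<Sum>i\<in>I. b i g) = (\<lambda>g. \<Sum>i\<in>I. (a \<star> b i) g)"
  unfolding conv_def by (rule ext) (auto simp: sum_distrib_left intro: sum.swap)

lemma conv_zero [simp]: "(\<lambda>g. 0) \<star> b = (\<lambda>g. 0)" "a \<star> (\<lambda>g. 0) = (\<lambda>g. 0)"
  by (auto simp: conv_def)

text \<open>Up to the factor \<open>card (carrier G)\<close>, the coefficient at the identity is the
  trace on the regular representation. Its symmetry later equates the dimensions attached to two
  idempotents that generate the same left ideal.\<close>

lemma conv_at_one: "(a \<star> b) \<one> = (b \<star> a) \<one>"
  using sum_invert[of "\<lambda>h. a h * b (inv h)"] by (simp add: conv_def mult.commute)

definition delta :: "'g \<Rightarrow> 'g \<Rightarrow> complex" where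
  "delta x = (\<lambda>g. if g = x then 1 else 0)"

lemma delta_closed: "x \<in> carrier G \<Longrightarrow> subfield F complex_ring \<Longrightarrow> delta x \<in> GA F"
  by (auto simp: GA_iff delta_def subfield_one subfield_zero)

lemma conv_delta: "x \<in> carrier G \<Longrightarrow> g \<in> carrier G \<Longrightarrow> (delta x \<star> a) g = a (inv x \<otimes> g)"
  using finite_carrier by (simp add: conv_def delta_def if_distrib[of "\<lambda>c. c * _"] cong: if_cong)

lemma Gal_comp_closed:
  assumes L: "subfield L complex_ring" and \<sigma>: "\<sigma> \<in> Gal L F" and a: "a \<in> GA L"
  shows "\<sigma> \<circ> a \<in> GA L"
  using a by (auto simp: GA_iff Gal_closed[OF \<sigma>] Gal_zero[OF L \<sigma>])

lemma Gal_comp_conv: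
  assumes L: "subfield L complex_ring" and \<sigma>: "\<sigma> \<in> Gal L F" and a: "a \<in> GA L" and b: "b \<in> GA L"
  shows "\<sigma> \<circ> (a \<star> b) = (\<sigma> \<circ> a) \<star> (\<sigma> \<circ> b)"
proof
  fix g
  have ab: "a h \<in> L" "b h \<in> L" for h
    using a b subfield_zero[OF L] by (auto simp: GA_iff intro: ccontr)
  show "(\<sigma> \<circ> (a \<star> b)) g = ((\<sigma> \<circ> a) \<star> (\<sigma> \<circ> b)) g"
    by (simp add: conv_def Gal_zero[OF L \<sigma>] Gal_sum[OF L \<sigma>] Gal_mult[OF \<sigma>] ab subfield_mult[OF L])
qed

section \<open>Action of the group algebra on a representation\<close>

definition rep_ext :: "nat \<Rightarrow> ('g \<Rightarrow> complex mat) \<Rightarrow> ('g \<Rightarrow> complex) \<Rightarrow> complex mat" where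
  "rep_ext n \<rho> a = mat n n (\<lambda>(i, j). \<Sum>g\<in>carrier G. a g * \<rho> g $$ (i, j))"

text \<open>The common shape of both central idempotents: e_V comes from the character of
  \<open>V\<close>, and e_W from that of \<open>W\<close> with a different constant
  \<open>c\<close>.\<close>

definition trace_elem :: "('g \<Rightarrow> complex mat) \<Rightarrow> complex \<Rightarrow> 'g \<Rightarrow> complex" where
  "trace_elem \<rho> c = (\<lambda>g. if g \<in> carrier G then c * mat_trace (\<rho> (inv g)) else 0)"

lemma rep_ext_carrier [simp]: "rep_ext n \<rho> a \<in> carrier_mat n n"
  "dim_row (rep_ext n \<rho> a) = n" "dim_col (rep_ext n \<rho> a) = n"
  by (simp_all add: rep_ext_def)

lemma rep_ext_zero: "rep_ext n \<rho> (\<lambda>g. 0) = 0\<^sub>m n n"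
  by (rule eq_matI) (simp_all add: rep_ext_def)

context
  fixes F :: "complex set" and n :: nat and \<rho> :: "'g \<Rightarrow> complex mat"
  assumes rep: "matrix_rep G F n \<rho>"
begin

lemma rep_carrier: "g \<in> carrier G \<Longrightarrow> \<rho> g \<in> carrier_mat n n"
  using rep by (simp add: matrix_rep_def)

lemma rep_one: "\<rho> \<one> = 1\<^sub>m n"
  using rep by (simp add: matrix_rep_def)

lemma rep_mult: "g \<in> carrier G \<Longrightarrow> h \<in> carrier G \<Longrightarrow> \<rho> (g \<otimes> h) = \<rho> g * \<rho> h"
  using rep by (simp add: matrix_rep_def)

lemma rep_entry: "g \<in> carrier G \<Longrightarrow> i < n \<Longrightarrow> j < n \<Longrightarrow> \<rho> g $$ (i, j) \<in> F"
  using rep elements_matI[OF rep_carrier] unfolding matrix_rep_def by blast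

lemma rep_pow: "g \<in> carrier G \<Longrightarrow> \<rho> (g [^] (k :: nat)) = \<rho> g ^\<^sub>m k"
proof (induction k)
  case 0
  then show ?case using rep_carrier[of g] rep_one by auto
qed (simp add: rep_mult)

lemma rep_mult_entry:
  assumes "g \<in> carrier G" "h \<in> carrier G" "i < n" "j < n"
  shows "\<rho> (g \<otimes> h) $$ (i, j) = (\<Sum>k<n. \<rho> g $$ (i, k) * \<rho> h $$ (k, j))"
  using assms rep_carrier[of g] rep_carrier[of h]
  by (simp add: rep_mult scalar_prod_def atLeast0LessThan)

lemma rep_ext_delta: "x \<in> carrier G \<Longrightarrow> rep_ext n \<rho> (delta x) = \<rho> x"
  using rep_carrier[of x] finite_carrier
  by (intro eq_matI) (auto simp: rep_ext_def delta_def if_distrib[of "\<lambda>c. c * _"] cong: if_cong)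

lemma rep_ext_conv: "rep_ext n \<rho> (a \<star> b) = rep_ext n \<rho> a * rep_ext n \<rho> b"
proof (rule eq_matI)
  fix i j assume "i < dim_row (rep_ext n \<rho> a * rep_ext n \<rho> b)" "j < dim_col (rep_ext n \<rho> a * rep_ext n \<rho> b)"
  then have ij: "i < n" "j < n" by simp_all
  have "rep_ext n \<rho> (a \<star> b) $$ (i, j)
      = (\<Sum>g\<in>carrier G. \<Sum>h\<in>carrier G. a h * b (inv h \<otimes> g) * \<rho> g $$ (i, j))"
    using ij by (simp add: rep_ext_def conv_def sum_distrib_right)
  also have "\<dots> = (\<Sum>h\<in>carrier G. \<Sum>g\<in>carrier G. a h * b (inv h \<otimes> g) * \<rho> g $$ (i, j))"
    by (rule sum.swap)
  also have "\<dots> = (\<Sum>h\<in>carrier G. \<Sum>g\<in>carrier G. a h * b g * \<rho> (h \<otimes> g) $$ (i, j))"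
  proof (rule sum.cong[OF refl])
    fix h assume h: "h \<in> carrier G"
    have "(\<Sum>g\<in>carrier G. a h * b (inv h \<otimes> g) * \<rho> g $$ (i, j))
        = (\<Sum>g\<in>carrier G. a h * b (inv h \<otimes> (h \<otimes> g)) * \<rho> (h \<otimes> g) $$ (i, j))"
      using sum_translate[OF h, of "\<lambda>g. a h * b (inv h \<otimes> g) * \<rho> g $$ (i, j)"] by simp
    then show "(\<Sum>g\<in>carrier G. a h * b (inv h \<otimes> g) * \<rho> g $$ (i, j))
        = (\<Sum>g\<in>carrier G. a h * b g * \<rho> (h \<otimes> g) $$ (i, j))"
      using h by (simp add: m_assoc[symmetric])
  qed
  also have "\<dots> = (\<Sum>h\<in>carrier G. \<Sum>g\<in>carrier G. \<Sum>k<n. (a h * \<rho> h $$ (i, k)) * (b g * \<rho> g $$ (k, j)))"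
    using ij by (intro sum.cong refl) (simp add: rep_mult_entry sum_distrib_left mult_ac)
  also have "\<dots> = (\<Sum>h\<in>carrier G. \<Sum>k<n. \<Sum>g\<in>carrier G. (a h * \<rho> h $$ (i, k)) * (b g * \<rho> g $$ (k, j)))"
    by (intro sum.cong refl) (rule sum.swap)
  also have "\<dots> = (\<Sum>k<n. (\<Sum>h\<in>carrier G. a h * \<rho> h $$ (i, k)) * (\<Sum>g\<in>carrier G. b g * \<rho> g $$ (k, j)))"
    by (subst sum.swap) (simp add: sum_product)
  also have "\<dots> = (rep_ext n \<rho> a * rep_ext n \<rho> b) $$ (i, j)"
    using ij by (simp add: rep_ext_def scalar_prod_def atLeast0LessThan)
  finally show "rep_ext n \<rho> (a \<star> b) $$ (i, j) = (rep_ext n \<rho> a * rep_ext n \<rho> b) $$ (i, j)" .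
qed simp_all

lemma trace_rep_mult_comm:
  "g \<in> carrier G \<Longrightarrow> h \<in> carrier G \<Longrightarrow> mat_trace (\<rho> (g \<otimes> h)) = mat_trace (\<rho> (h \<otimes> g))"
  using mat_trace_comm[OF rep_carrier rep_carrier] by (simp add: rep_mult)

text \<open>A form of Fourier inversion: coefficients of the part of \<open>a\<close> in the block
  are read off from the matrix by which \<open>a\<close> acts.\<close>

lemma conv_trace_elem:
  assumes g: "g \<in> carrier G"
  shows "(a \<star> trace_elem \<rho> c) g = c * mat_trace (\<rho> (inv g) * rep_ext n \<rho> a)"
proof -
  have "mat_trace (\<rho> (inv g) * rep_ext n \<rho> a)
      = (\<Sum>i<n. \<Sum>k<n. \<Sum>h\<in>carrier G. \<rho> (inv g) $$ (i, k) * (a h * \<rho> h $$ (k, i)))"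
    using rep_carrier[of "inv g"] g
    by (simp add: mat_trace_def scalar_prod_def rep_ext_def atLeast0LessThan sum_distrib_left)
  also have "\<dots> = (\<Sum>i<n. \<Sum>h\<in>carrier G. \<Sum>k<n. \<rho> (inv g) $$ (i, k) * (a h * \<rho> h $$ (k, i)))"
    by (intro sum.cong refl) (rule sum.swap)
  also have "\<dots> = (\<Sum>h\<in>carrier G. \<Sum>i<n. \<Sum>k<n. \<rho> (inv g) $$ (i, k) * (a h * \<rho> h $$ (k, i)))"
    by (rule sum.swap)
  also have "\<dots> = (\<Sum>h\<in>carrier G. a h * mat_trace (\<rho> (inv g \<otimes> h)))"
  proof (rule sum.cong[OF refl])
    fix h assume h: "h \<in> carrier G"
    have "mat_trace (\<rho> (inv g \<otimes> h)) = (\<Sum>i<n. \<Sum>k<n. \<rho> (inv g) $$ (i, k) * \<rho> h $$ (k, i))"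
      using g h rep_carrier[of "inv g \<otimes> h"] by (simp add: mat_trace_def rep_mult_entry)
    then show "(\<Sum>i<n. \<Sum>k<n. \<rho> (inv g) $$ (i, k) * (a h * \<rho> h $$ (k, i)))
        = a h * mat_trace (\<rho> (inv g \<otimes> h))"
      by (simp add: sum_distrib_left mult_ac)
  qed
  finally show ?thesis
    using g by (simp add: conv_def trace_elem_def inv_mult_group sum_distrib_left mult_ac)
qed

lemma trace_elem_central: "trace_elem \<rho> c \<star> a = a \<star> trace_elem \<rho> c"
proof
  fix g
  show "(trace_elem \<rho> c \<star> a) g = (a \<star> trace_elem \<rho> c) g"
  proof (cases "g \<in> carrier G")
    case g: True
    have "(trace_elem \<rho> c \<star> a) g = (\<Sum>h\<in>carrier G. c * mat_trace (\<rho> (inv h)) * a (inv h \<otimes> g))"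
      using g by (simp add: conv_def trace_elem_def)
    also have "\<dots> = (\<Sum>h\<in>carrier G. c * mat_trace (\<rho> h) * a (h \<otimes> g))"
      using sum_invert[of "\<lambda>h. c * mat_trace (\<rho> h) * a (h \<otimes> g)"] by simp
    also have "\<dots> = (\<Sum>h\<in>carrier G. c * mat_trace (\<rho> (h \<otimes> inv g)) * a h)"
      by (rule sum.reindex_bij_witness[where i = "\<lambda>h. h \<otimes> inv g" and j = "\<lambda>h. h \<otimes> g"])
        (use g in \<open>auto simp: m_assoc\<close>)
    also have "\<dots> = (a \<star> trace_elem \<rho> c) g"
      using g by (auto simp: conv_def trace_elem_def inv_mult_group trace_rep_mult_comm[of _ "inv g"]
        intro!: sum.cong)
    finally show ?thesis .
  qed (simp add: conv_def)
qed

text \<open>This replaces the Wedderburn isomorphism. An element that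
  \<open>trace_elem \<rho> c\<close> fixes on the right is determined by its action on \<rho>, so it
  vanishes if it acts as zero.\<close>

lemma conv_trace_elem_cong:
  assumes "rep_ext n \<rho> a = rep_ext n \<rho> b"
  shows "a \<star> trace_elem \<rho> c = b \<star> trace_elem \<rho> c"
proof
  fix g
  show "(a \<star> trace_elem \<rho> c) g = (b \<star> trace_elem \<rho> c) g"
    using conv_trace_elem[of g a c] conv_trace_elem[of g b c] assms
    by (cases "g \<in> carrier G") (simp_all add: conv_def)
qed

end

end

section \<open>Idempotents acting on irreducible representations\<close>

lemma mat_trace_nonzero_idempotent:
  assumes A: "A \<in> carrier_mat n n" and idem: "A * A = A" and "A \<noteq> 0\<^sub>m n n"
  shows "\<exists>k. mat_trace A = of_nat (Suc k)"
proof -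
  obtain i j where ij: "i < n" "j < n" "A $$ (i, j) \<noteq> 0"
  proof (rule ccontr)
    assume "\<not> thesis"
    then have "A = 0\<^sub>m n n" using that A by (intro eq_matI) auto
    then show False using assms by simp
  qed
  have AA: "(\<Sum>k<n. A $$ (r, k) * A $$ (k, s)) = A $$ (r, s)" if "r < n" "s < n" for r s
    using arg_cong[OF idem, of "\<lambda>M. M $$ (r, s)"] A that
    by (simp add: scalar_prod_def atLeast0LessThan)
  \<comment> \<open>A column and a row of \<open>A\<close> that meet in a nonzero entry, with the
    row divided by that entry; idempotence of \<open>A\<close> then makes their product 1.\<close>
  define T where "T = mat n 1 (\<lambda>(r, _). A $$ (r, j))"
  define S where "S = mat 1 n (\<lambda>(_, c). A $$ (i, c) / A $$ (i, j))"
  have "\<exists>k. mat_trace A = of_nat (1 + k)"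
  proof (rule mat_trace_idempotent_ge[OF A])
    show "T \<in> carrier_mat n 1" "S \<in> carrier_mat 1 n" by (simp_all add: T_def S_def)
    show "A * T = T"
      using A ij by (intro eq_matI) (auto simp: T_def scalar_prod_def atLeast0LessThan AA)
    show "S * A = S"
      using A ij by (intro eq_matI)
        (auto simp: S_def scalar_prod_def atLeast0LessThan AA simp flip: sum_divide_distrib)
    show "S * T = 1\<^sub>m 1"
      using A ij by (intro eq_matI)
        (auto simp: S_def T_def scalar_prod_def atLeast0LessThan AA simp flip: sum_divide_distrib)
  qed (rule idem)
  then show ?thesis by simp
qed

lemma eq_matI_mult_vec:
  fixes A B :: "'a :: comm_semiring_1 mat"
  assumes "A \<in> carrier_mat n k" "B \<in> carrier_mat n k"
    and "\<And>v. v \<in> carrier_vec k \<Longrightarrow> A *\<^sub>v v = B *\<^sub>v v"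
  shows "A = B"
proof (rule eq_matI)
  fix i j assume "i < dim_row B" "j < dim_col B"
  then show "A $$ (i, j) = B $$ (i, j)"
    using arg_cong[OF assms(3)[of "unit_vec k j"], of "\<lambda>v. v $ i"] assms(1,2) by auto
qed (use assms in auto)

context finite_group
begin

lemma order_pos: "card (carrier G) > 0"
  using finite_carrier by (auto simp: card_gt_0_iff)

lemma character_idempotent_eq:
  "character_idempotent G n \<rho> = trace_elem \<rho> (of_nat n / of_nat (card (carrier G)))"
  by (auto simp: character_idempotent_def trace_elem_def rep_character_trace)

lemma central_idempotent_cases:
  assumes irr: "irreducible_rep G UNIV n \<rho>" and EE: "trace_elem \<rho> c \<star> trace_elem \<rho> c = trace_elem \<rho> c"
    and e: "e \<star> e = e" "e \<star> trace_elem \<rho> c = e"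
    and central: "\<And>x. x \<in> carrier G \<Longrightarrow> delta x \<star> e = e \<star> delta x"
  shows "e = (\<lambda>g. 0) \<or> e = trace_elem \<rho> c"
proof -
  have rep: "matrix_rep G UNIV n \<rho>" using irr by (simp add: irreducible_rep_def)
  define M where "M = rep_ext n \<rho> e"
  have M: "M \<in> carrier_mat n n" by (simp add: M_def)
  have MM: "M * M = M" using rep_ext_conv[OF rep, of e e] e(1) by (simp add: M_def)
  have comm: "\<rho> x * M = M * \<rho> x" if x: "x \<in> carrier G" for x
    using rep_ext_conv[OF rep, of "delta x" e] rep_ext_conv[OF rep, of e "delta x"] central[OF x]
    by (simp add: M_def rep_ext_delta[OF rep x])
  define U where "U = (\<lambda>v. M *\<^sub>v v) ` carrier_vec n"
  have "invariant_subspace G UNIV n \<rho> U"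
    unfolding invariant_subspace_def
  proof (intro conjI ballI)
    show "U \<subseteq> vec_space_over UNIV n" using M by (auto simp: U_def vec_space_over_def)
    show "0\<^sub>v n \<in> U" using M unfolding U_def by (intro image_eqI[of _ _ "0\<^sub>v n"]) auto
    show "v + w \<in> U" if vw: "v \<in> U" "w \<in> U" for v w
    proof -
      obtain v' w' where "v' \<in> carrier_vec n" "w' \<in> carrier_vec n" "v = M *\<^sub>v v'" "w = M *\<^sub>v w'"
        using vw by (auto simp: U_def)
      then show ?thesis using M unfolding U_def
        by (intro image_eqI[of _ _ "v' + w'"]) (auto simp: mult_add_distrib_mat_vec)
    qed
    show "k \<cdot>\<^sub>v v \<in> U" if vU: "v \<in> U" for k v
    proof -
      obtain v' where "v' \<in> carrier_vec n" "v = M *\<^sub>v v'" using vU by (auto simp: U_def)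
      then show ?thesis using M unfolding U_def
        by (intro image_eqI[of _ _ "k \<cdot>\<^sub>v v'"]) (auto simp: mult_mat_vec)
    qed
    show "\<rho> x *\<^sub>v v \<in> U" if x: "x \<in> carrier G" and vU: "v \<in> U" for x v
    proof -
      obtain v' where v': "v' \<in> carrier_vec n" "v = M *\<^sub>v v'" using vU by (auto simp: U_def)
      note r = rep_carrier[OF rep x]
      have "\<rho> x *\<^sub>v v = M *\<^sub>v (\<rho> x *\<^sub>v v')"
        using assoc_mult_mat_vec[OF r M v'(1)] assoc_mult_mat_vec[OF M r v'(1)] v'(2) comm[OF x] by simp
      then show ?thesis using r v' unfolding U_def by (intro image_eqI[of _ _ "\<rho> x *\<^sub>v v'"]) auto
    qed
  qed
  then have "U = {0\<^sub>v n} \<or> U = carrier_vec n"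
    using irr by (auto simp: irreducible_rep_def vec_space_over_def)
  then have "M = 0\<^sub>m n n \<or> M = 1\<^sub>m n"
  proof
    assume U: "U = {0\<^sub>v n}"
    have "M *\<^sub>v v = 0\<^sub>m n n *\<^sub>v v" if v: "v \<in> carrier_vec n" for v
    proof -
      have "M *\<^sub>v v \<in> U" using v by (simp add: U_def)
      then show ?thesis using U v by (intro eq_vecI) auto
    qed
    then show ?thesis using M by (intro disjI1 eq_matI_mult_vec[of _ n n]) auto
  next
    assume U: "U = carrier_vec n"
    have "M *\<^sub>v v = 1\<^sub>m n *\<^sub>v v" if v: "v \<in> carrier_vec n" for v
    proof -
      obtain w where w: "w \<in> carrier_vec n" "v = M *\<^sub>v w" using v U by (auto simp: U_def)
      then show ?thesis using assoc_mult_mat_vec[OF M M w(1)] MM M by simp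
    qed
    then show ?thesis using M by (intro disjI2 eq_matI_mult_vec[of _ n n]) auto
  qed
  then show ?thesis
  proof
    assume "M = 0\<^sub>m n n"
    then have "e \<star> trace_elem \<rho> c = (\<lambda>g. 0) \<star> trace_elem \<rho> c"
      by (intro conv_trace_elem_cong[OF rep]) (simp add: M_def rep_ext_zero)
    then show ?thesis using e(2) by simp
  next
    assume M1: "M = 1\<^sub>m n"
    have "rep_ext n \<rho> e = rep_ext n \<rho> (trace_elem \<rho> c)"
      using rep_ext_conv[OF rep, of e "trace_elem \<rho> c"] M1 e(2) by (simp add: M_def)
    then have "e \<star> trace_elem \<rho> c = trace_elem \<rho> c \<star> trace_elem \<rho> c"
      by (rule conv_trace_elem_cong[OF rep])
    then show ?thesis using e(2) EE by simp
  qed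
qed

lemma rep_ext_mult_vec:
  assumes rep: "matrix_rep G F n \<rho>" and v: "v \<in> carrier_vec n" and i: "i < n"
  shows "(rep_ext n \<rho> a *\<^sub>v v) $ i = (\<Sum>g\<in>carrier G. a g * (\<rho> g *\<^sub>v v) $ i)"
proof -
  have "(rep_ext n \<rho> a *\<^sub>v v) $ i = (\<Sum>k<n. \<Sum>g\<in>carrier G. a g * \<rho> g $$ (i, k) * v $ k)"
    using v i by (simp add: rep_ext_def scalar_prod_def atLeast0LessThan sum_distrib_right)
  also have "\<dots> = (\<Sum>g\<in>carrier G. \<Sum>k<n. a g * \<rho> g $$ (i, k) * v $ k)"
    by (rule sum.swap)
  also have "\<dots> = (\<Sum>g\<in>carrier G. a g * (\<rho> g *\<^sub>v v) $ i)"
  proof (rule sum.cong[OF refl])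
    fix g assume "g \<in> carrier G"
    then show "(\<Sum>k<n. a g * \<rho> g $$ (i, k) * v $ k) = a g * (\<rho> g *\<^sub>v v) $ i"
      using rep_carrier[OF rep, of g] v i
      by (simp add: scalar_prod_def atLeast0LessThan sum_distrib_left mult.assoc)
  qed
  finally show ?thesis .
qed

text \<open>The number \<open>card (carrier G) * a \<one>\<close> is the trace of the right multiplication by \<open>a\<close>, that is,
  the dimension of the left ideal generated by \<open>a\<close>. That ideal maps onto the irreducible
  representation.\<close>

lemma idempotent_ideal_dimension:
  assumes F: "subfield F complex_ring" and irr: "irreducible_rep G F d \<rho>"
    and a: "a \<in> GA F" "a \<star> a = a" "a \<star> trace_elem \<rho> c = a" "a \<noteq> (\<lambda>g. 0)"
  shows "\<exists>k. of_nat (card (carrier G)) * a \<one> = of_nat (d + k)"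
proof -
  have rep: "matrix_rep G F d \<rho>" using irr by (simp add: irreducible_rep_def)
  let ?R = "rep_ext d \<rho>"
  have R_F: "?R x $$ (i, j) \<in> F" if "x \<in> GA F" "i < d" "j < d" for x i j
    using that unfolding rep_ext_def
    by (auto simp: GA_iff rep_entry[OF rep] intro!: subfield_sum[OF F] subfield_mult[OF F])
  have mult_vec_F: "?R x *\<^sub>v v \<in> vec_space_over F d" if x: "x \<in> GA F" and v: "v \<in> vec_space_over F d" for x v
    using v R_F[OF x] rep_ext_carrier[of d \<rho> x]
    by (auto simp del: rep_ext_carrier(1) simp: vec_space_over_def scalar_prod_def intro!: subfield_sum[OF F] subfield_mult[OF F])
  have "?R a \<noteq> 0\<^sub>m d d"
  proof
    assume "?R a = 0\<^sub>m d d"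
    then have "a \<star> trace_elem \<rho> c = (\<lambda>g. 0) \<star> trace_elem \<rho> c"
      by (intro conv_trace_elem_cong[OF rep]) (simp add: rep_ext_zero)
    then show False using a(3,4) by simp
  qed
  then obtain i j where ij: "i < d" "j < d" "?R a $$ (i, j) \<noteq> 0"
    by (metis eq_matI index_zero_mat rep_ext_carrier(2,3))
  \<comment> \<open>A nonzero column of the matrix of \<open>a\<close>; it is fixed by
    \<open>a\<close> because \<open>a\<close> is idempotent.\<close>
  define v where "v = ?R a *\<^sub>v unit_vec d j"
  have unit: "unit_vec d k \<in> vec_space_over F d" for k
    by (auto simp: vec_space_over_def unit_vec_def subfield_one[OF F] subfield_zero[OF F])
  have v_F: "v \<in> vec_space_over F d" unfolding v_def by (rule mult_vec_F[OF a(1) unit])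
  then have v: "v \<in> carrier_vec d" by (simp add: vec_space_over_def)
  have Rv: "?R a *\<^sub>v v = v"
    using rep_ext_conv[OF rep, of a a] a(2) unfolding v_def
    by (metis assoc_mult_mat_vec rep_ext_carrier(1) unit_vec_carrier)
  have "v $ i \<noteq> 0" using ij by (simp add: v_def)
  then have v0: "v \<noteq> 0\<^sub>v d" using ij(1) by auto
  have Rv_carrier: "?R x *\<^sub>v v \<in> carrier_vec d" for x
    by (rule mult_mat_vec_carrier[OF rep_ext_carrier(1) v])
  \<comment> \<open>The cyclic submodule generated by \<open>v\<close>. It contains
    \<open>v\<close>, so by irreducibility it is the whole space, and every unit vector is reached
    by some \<open>y k\<close> with coefficients in \<open>F\<close>.\<close>
  define U where "U = (\<lambda>x. ?R x *\<^sub>v v) ` GA F"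
  have ext: "?R x *\<^sub>v v = w" if "w \<in> carrier_vec d" "\<And>i. i < d \<Longrightarrow> (\<Sum>g\<in>carrier G. x g * (\<rho> g *\<^sub>v v) $ i) = w $ i" for x w
    using that rep_ext_mult_vec[OF rep v] by (intro eq_vecI) auto
  have "invariant_subspace G F d \<rho> U"
    unfolding invariant_subspace_def
  proof (intro conjI ballI)
    show "U \<subseteq> vec_space_over F d" using mult_vec_F v_F by (auto simp: U_def)
    show "0\<^sub>v d \<in> U" unfolding U_def
      by (rule image_eqI[of _ _ "\<lambda>g. 0"]) (use v in \<open>auto simp: rep_ext_zero GA_iff subfield_zero[OF F]\<close>)
    show "w + w' \<in> U" if "w \<in> U" "w' \<in> U" for w w'
    proof -
      obtain x x' where xx: "x \<in> GA F" "x' \<in> GA F" "w = ?R x *\<^sub>v v" "w' = ?R x' *\<^sub>v v"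
        using \<open>w \<in> U\<close> \<open>w' \<in> U\<close> unfolding U_def by blast
      have "w + w' = ?R (\<lambda>g. x g + x' g) *\<^sub>v v" unfolding xx
        using Rv_carrier[of x] Rv_carrier[of x']
        by (intro ext[symmetric])
          (simp_all del: index_mult_mat_vec add: rep_ext_mult_vec[OF rep v] sum.distrib algebra_simps)
      then show ?thesis unfolding U_def using xx
        by (intro image_eqI[of _ _ "\<lambda>g. x g + x' g"]) (auto simp: GA_iff subfield_add[OF F])
    qed
    show "k \<cdot>\<^sub>v w \<in> U" if kF: "k \<in> F" and "w \<in> U" for k w
    proof -
      obtain x where xx: "x \<in> GA F" "w = ?R x *\<^sub>v v" using \<open>w \<in> U\<close> unfolding U_def by blast
      have "k \<cdot>\<^sub>v w = ?R (\<lambda>g. k * x g) *\<^sub>v v" unfolding xx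
        using Rv_carrier[of x]
        by (intro ext[symmetric])
          (simp_all del: index_mult_mat_vec add: rep_ext_mult_vec[OF rep v] sum_distrib_left mult.assoc)
      then show ?thesis unfolding U_def using xx kF
        by (intro image_eqI[of _ _ "\<lambda>g. k * x g"]) (auto simp: GA_iff subfield_mult[OF F])
    qed
    show "\<rho> y *\<^sub>v w \<in> U" if y: "y \<in> carrier G" and "w \<in> U" for y w
    proof -
      obtain x where xx: "x \<in> GA F" "w = ?R x *\<^sub>v v" using \<open>w \<in> U\<close> unfolding U_def by blast
      have "\<rho> y *\<^sub>v w = ?R (delta y \<star> x) *\<^sub>v v"
        unfolding xx rep_ext_conv[OF rep] rep_ext_delta[OF rep y]
        by (rule assoc_mult_mat_vec[OF rep_carrier[OF rep y] _ v, symmetric]) simp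
      then show ?thesis unfolding U_def using xx conv_closed[OF F delta_closed[OF y F]] by blast
    qed
  qed
  moreover have "v \<in> U" unfolding U_def
    using Rv a(1) by (intro image_eqI[of _ _ a]) auto
  ultimately have U_all: "U = vec_space_over F d"
    using irr v0 by (auto simp: irreducible_rep_def)
  have "\<exists>x. x \<in> GA F \<and> ?R x *\<^sub>v v = unit_vec d k" for k
  proof -
    have "unit_vec d k \<in> U" unfolding U_all by (rule unit)
    then obtain x where "unit_vec d k = ?R x *\<^sub>v v" "x \<in> GA F" unfolding U_def by (rule imageE)
    then show ?thesis by (intro exI[of _ x]) simp
  qed
  then obtain y where y: "\<And>k. y k \<in> GA F" "\<And>k. ?R (y k) *\<^sub>v v = unit_vec d k" by metis
  \<comment> \<open>\<open>P\<close> is the matrix of right multiplication by \<open>a\<close>,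
    \<open>S\<close> sends \<open>x\<close> to its value on \<open>v\<close>, and \<open>T\<close>
    sends the \<open>k\<close>-th basis vector to \<open>y k \<star> a\<close>. Both the
    compatibility of \<open>S\<close> with \<open>P\<close> and \<open>S * T = 1\<close> rest on
    \<open>a\<close> fixing \<open>v\<close>.\<close>
  have "\<exists>k. (\<Sum>g\<in>carrier G. a (inv g \<otimes> g)) = of_nat (d + k)"
  proof (rule trace_idempotent_ge[where P = "\<lambda>g h. a (inv h \<otimes> g)" and T = "\<lambda>g i. (y i \<star> a) g"
        and S = "\<lambda>i g. (\<rho> g *\<^sub>v v) $ i", OF finite_carrier])
    have shift: "(\<Sum>h\<in>carrier G. a (inv h \<otimes> g) * b h) = (b \<star> a) g" if "g \<in> carrier G" for b g
      using that by (simp add: conv_def mult.commute)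
    fix g h assume g: "g \<in> carrier G" and h: "h \<in> carrier G"
    have "(\<Sum>x\<in>carrier G. a (inv x \<otimes> g) * a (inv h \<otimes> x))
        = (\<Sum>x\<in>carrier G. a (inv (h \<otimes> x) \<otimes> g) * a (inv h \<otimes> (h \<otimes> x)))"
      using sum_translate[OF h, of "\<lambda>x. a (inv x \<otimes> g) * a (inv h \<otimes> x)"] by simp
    also have "\<dots> = (\<Sum>x\<in>carrier G. a (inv x \<otimes> (inv h \<otimes> g)) * a x)"
      using g h by (intro sum.cong refl) (simp add: inv_mult_group m_assoc[symmetric])
    also have "\<dots> = (a \<star> a) (inv h \<otimes> g)"
      using g h by (intro shift) auto
    finally show "(\<Sum>x\<in>carrier G. a (inv x \<otimes> g) * a (inv h \<otimes> x)) = a (inv h \<otimes> g)"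
      by (simp add: a(2))
  next
    fix g i assume g: "g \<in> carrier G"
    have "(\<Sum>h\<in>carrier G. a (inv h \<otimes> g) * (y i \<star> a) h) = ((y i \<star> a) \<star> a) g"
      using g by (subst (2) conv_def) (simp add: mult.commute)
    then show "(\<Sum>h\<in>carrier G. a (inv h \<otimes> g) * (y i \<star> a) h) = (y i \<star> a) g"
      by (simp add: conv_assoc a(2))
  next
    fix i h assume i: "i < d" and h: "h \<in> carrier G"
    have "(\<Sum>g\<in>carrier G. (\<rho> g *\<^sub>v v) $ i * a (inv h \<otimes> g)) = (\<Sum>g\<in>carrier G. (delta h \<star> a) g * (\<rho> g *\<^sub>v v) $ i)"
      using h by (intro sum.cong refl) (simp add: conv_delta)
    also have "\<dots> = (?R (delta h \<star> a) *\<^sub>v v) $ i" by (rule rep_ext_mult_vec[OF rep v i, symmetric])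
    also have "?R (delta h \<star> a) *\<^sub>v v = \<rho> h *\<^sub>v (?R a *\<^sub>v v)"
      unfolding rep_ext_conv[OF rep] rep_ext_delta[OF rep h]
      by (rule assoc_mult_mat_vec[OF rep_carrier[OF rep h] _ v]) simp
    finally show "(\<Sum>g\<in>carrier G. (\<rho> g *\<^sub>v v) $ i * a (inv h \<otimes> g)) = (\<rho> h *\<^sub>v v) $ i" by (simp add: Rv)
  next
    fix i k assume i: "i < d" and k: "k < d"
    have "(\<Sum>g\<in>carrier G. (\<rho> g *\<^sub>v v) $ i * (y k \<star> a) g) = (?R (y k \<star> a) *\<^sub>v v) $ i"
      by (subst rep_ext_mult_vec[OF rep v i]) (simp add: mult.commute)
    also have "?R (y k \<star> a) *\<^sub>v v = ?R (y k) *\<^sub>v (?R a *\<^sub>v v)"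
      unfolding rep_ext_conv[OF rep] by (rule assoc_mult_mat_vec[OF rep_ext_carrier(1) rep_ext_carrier(1) v])
    finally show "(\<Sum>g\<in>carrier G. (\<rho> g *\<^sub>v v) $ i * (y k \<star> a) g) = (if i = k then 1 else 0)"
      using i k by (simp add: Rv y)
  qed
  then show ?thesis by simp
qed

text \<open>Connects the trace on the regular representation with the trace on \<rho>, so that
  integrality of the latter can be used.\<close>

lemma conv_trace_elem_at_one:
  assumes rep: "matrix_rep G F n \<rho>" and "a \<star> trace_elem \<rho> c = a"
  shows "a \<one> = c * mat_trace (rep_ext n \<rho> a)"
proof -
  have "1\<^sub>m n * rep_ext n \<rho> a = rep_ext n \<rho> a" by (rule left_mult_one_mat[OF rep_ext_carrier(1)])
  then show ?thesis
    using conv_trace_elem[OF rep one_closed, of a c] assms(2) rep_one[OF rep] by simp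
qed

lemma complete_idempotents_at_one:
  assumes rep: "matrix_rep G F n \<rho>" and c: "c \<noteq> 0"
    and I: "finite I" "card I = n" "trace_elem \<rho> c = (\<lambda>g. \<Sum>i\<in>I. a i g)"
    and a: "\<And>i. i \<in> I \<Longrightarrow> a i \<star> a i = a i" "\<And>i. i \<in> I \<Longrightarrow> a i \<star> trace_elem \<rho> c = a i"
      "\<And>i. i \<in> I \<Longrightarrow> a i \<noteq> (\<lambda>g. 0)"
    and i: "i \<in> I"
  shows "a i \<one> = c"
proof -
  have "\<exists>k. a i \<one> = c * of_nat (Suc k)" if i: "i \<in> I" for i
  proof -
    have "rep_ext n \<rho> (a i) \<noteq> 0\<^sub>m n n"
    proof
      assume "rep_ext n \<rho> (a i) = 0\<^sub>m n n"
      then have "a i \<star> trace_elem \<rho> c = (\<lambda>g. 0) \<star> trace_elem \<rho> c"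
        by (intro conv_trace_elem_cong[OF rep]) (simp add: rep_ext_zero)
      then show False using a(2,3)[OF i] by simp
    qed
    moreover have "rep_ext n \<rho> (a i) * rep_ext n \<rho> (a i) = rep_ext n \<rho> (a i)"
      using rep_ext_conv[OF rep, of "a i" "a i"] a(1)[OF i] by simp
    ultimately obtain k where "mat_trace (rep_ext n \<rho> (a i)) = of_nat (Suc k)"
      using mat_trace_nonzero_idempotent[OF rep_ext_carrier(1)] by blast
    then show ?thesis using conv_trace_elem_at_one[OF rep a(2)[OF i]] by (intro exI[of _ k]) simp
  qed
  then obtain k where k: "\<And>i. i \<in> I \<Longrightarrow> a i \<one> = c * of_nat (Suc (k i))" by metis
  have "c * of_nat n = trace_elem \<rho> c \<one>"
    using rep_one[OF rep] by (simp add: trace_elem_def mat_trace_def)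
  also have "\<dots> = (\<Sum>i\<in>I. c * of_nat (Suc (k i)))" by (simp add: I(3) k)
  also have "\<dots> = c * of_nat (\<Sum>i\<in>I. Suc (k i))"
    by (simp only: of_nat_sum sum_distrib_left)
  finally have "n = (\<Sum>i\<in>I. Suc (k i))" using c by (simp only: mult_cancel_left of_nat_eq_iff simp_thms)
  also have "\<dots> = n + (\<Sum>i\<in>I. k i)" using I(2) by (simp only: Suc_eq_plus1 sum.distrib) simp
  finally have "k i = 0" using I(1) i by simp
  then show ?thesis using k[OF i] by simp
qed

lemma Gal_character_field:
  assumes rep: "matrix_rep G UNIV n \<rho>" and L: "subfield L complex_ring"
    and K: "character_field G \<rho> \<subseteq> L" and \<sigma>: "\<sigma> \<in> Gal L \<rat>" and x: "x \<in> character_field G \<rho>"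
  shows "\<sigma> x \<in> character_field G \<rho>"
proof -
  let ?K = "character_field G \<rho>"
  have sub: "subfield ?K complex_ring"
    unfolding character_field_def by (intro field.generate_field_is_subfield field_from_type_algebra) auto
  have chi: "mat_trace (\<rho> g) \<in> ?K" if "g \<in> carrier G" for g
    unfolding character_field_def using that by (intro generate_field.incl) (auto simp: rep_character_trace)
  \<comment> \<open>Since this set is a subfield, it suffices to treat the generators of the
    character field.\<close>
  have "subfield {x \<in> L. \<sigma> x \<in> ?K} complex_ring"
    by (rule complex_ring_subfieldI)
      (auto simp: subfield_one[OF L] subfield_add[OF L] subfield_uminus[OF L] subfield_mult[OF L]
        subfield_inverse[OF L] Gal_one[OF \<sigma>] Gal_add[OF \<sigma>] Gal_uminus[OF L \<sigma>] Gal_mult[OF \<sigma>]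
        Gal_inverse_elem[OF L \<sigma>] subfield_one[OF sub] subfield_add[OF sub] subfield_uminus[OF sub]
        subfield_mult[OF sub] subfield_inverse[OF sub])
  moreover have "\<rat> \<union> rep_character \<rho> ` carrier G \<subseteq> {x \<in> L. \<sigma> x \<in> ?K}"
  proof (intro subsetI)
    fix x assume "x \<in> \<rat> \<union> rep_character \<rho> ` carrier G"
    then consider "x \<in> \<rat>" | g where "g \<in> carrier G" "x = mat_trace (\<rho> g)"
      by (auto simp: rep_character_trace)
    then show "x \<in> {x \<in> L. \<sigma> x \<in> ?K}"
    proof cases
      case 1
      then show ?thesis using subfield_Rats[OF L] subfield_Rats[OF sub] Gal_fixed[OF \<sigma> 1] by auto
    next
      case 2
      have AN: "\<rho> g ^\<^sub>m card (carrier G) = 1\<^sub>m n"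
        using rep_pow[OF rep 2(1), of "card (carrier G)"] pow_order_eq_1[OF 2(1)] rep_one[OF rep]
        by (simp add: Coset.order_def)
      have "mat_trace (\<rho> g) \<in> L" using chi[OF 2(1)] K by auto
      from Gal_mat_trace_finite_order[OF L \<sigma> rep_carrier[OF rep 2(1)] AN order_pos this]
      obtain j where "\<sigma> (mat_trace (\<rho> g)) = mat_trace (\<rho> g ^\<^sub>m j)" by blast
      then have "\<sigma> x = mat_trace (\<rho> (g [^] j))" using rep_pow[OF rep 2(1)] 2(2) by simp
      then show ?thesis using chi 2 K by auto
    qed
  qed
  ultimately have "?K \<subseteq> {x \<in> L. \<sigma> x \<in> ?K}"
    by (subst (1) character_field_def)
      (intro field.generate_field_min_subfield1[OF field_from_type_algebra], auto)
  then show ?thesis using x by blast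
qed

end

section \<open>Galois conjugates of the central idempotent\<close>

lemma (in finite_group) GA_value: "subfield F complex_ring \<Longrightarrow> a \<in> GA F \<Longrightarrow> a g \<in> F"
  using subfield_zero by (cases "g \<in> carrier G") (auto simp: GA_iff)

lemma (in finite_group) compose_comp:
  "subfield L complex_ring \<Longrightarrow> a \<in> GA L \<Longrightarrow> compose L \<sigma> \<tau> \<circ> a = \<sigma> \<circ> (\<tau> \<circ> a)"
  using GA_value[of L a] by (auto simp: fun_eq_iff compose_eq)

lemma (in finite_group) idempotent_elem_block_iff:
  assumes F: "subfield F complex_ring" and e: "e \<in> GA F" "e \<star> e = e"
  shows "idempotent_elem (block_ring (group_algebra G F) e) a \<longleftrightarrow> a \<in> GA F \<and> a \<star> e = a \<and> a \<star> a = a"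
proof -
  have "a \<in> PIdl\<^bsub>group_algebra G F\<^esub> e \<longleftrightarrow> a \<in> GA F \<and> a \<star> e = a"
  proof
    assume "a \<in> PIdl\<^bsub>group_algebra G F\<^esub> e"
    then obtain r where r: "a = r \<star> e" "r \<in> GA F" by (auto simp only: cgenideal_def group_algebra_mult)
    then show "a \<in> GA F \<and> a \<star> e = a" using conv_closed[OF F r(2) e(1)] by (simp add: conv_assoc e(2))
  next
    assume "a \<in> GA F \<and> a \<star> e = a"
    then show "a \<in> PIdl\<^bsub>group_algebra G F\<^esub> e"
      unfolding cgenideal_def group_algebra_mult by (intro CollectI exI[of _ a]) simp
  qed
  then show ?thesis by (simp add: idempotent_elem_def block_ring_def)
qed

text \<open>With \<open>sum_Gal_fixed\<close> in this tower, sums over \<open>Gal L K\<close> land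
  in \<open>K\<close>; that is why the \<open>k s\<close> have coefficients in
  \<open>K\<close>.\<close>

lemma (in galois_tower) galois_tower_top: "galois_tower K K L"
proof (rule galois_tower.intro)
  fix \<sigma> x assume \<sigma>: "\<sigma> \<in> Gal L K" and "x \<in> K"
  then show "\<sigma> x \<in> K" by (simp add: Gal_fixed[OF \<sigma>])
qed (rule K L KL order_refl finite_Gal_sub fixed_field_sub; assumption)+

text \<open>A rational \<open>c\<close> is fixed by every automorphism, so conjugating
  \<open>E\<close> amounts to conjugating the character; a nonzero \<open>c\<close> allows the
  character to be read back from \<open>E\<close>.\<close>

locale galois_conjugates = finite_group G + galois_tower "\<rat>" "character_field G \<rho>" L
  for G :: "('g, 'b) monoid_scheme" (structure) and \<rho> L +
  fixes n :: nat and c :: complex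
  assumes irr: "irreducible_rep G UNIV n \<rho>" and c_Rats: "c \<in> \<rat>" and c_nonzero: "c \<noteq> 0"
    and idem: "trace_elem \<rho> c \<star> trace_elem \<rho> c = trace_elem \<rho> c"
begin

abbreviation E where "E \<equiv> trace_elem \<rho> c"

lemma rep: "matrix_rep G UNIV n \<rho>"
  using irr by (simp add: irreducible_rep_def)

lemma character_in_K: "g \<in> carrier G \<Longrightarrow> mat_trace (\<rho> g) \<in> character_field G \<rho>"
  unfolding character_field_def by (intro generate_field.incl) (auto simp: rep_character_trace)

lemma E_closed: "E \<in> GA (character_field G \<rho>)"
  using character_in_K c_Rats FK subfield_zero[OF K]
  by (auto simp: GA_iff trace_elem_def intro!: subfield_mult[OF K])

lemma E_closed_L: "E \<in> GA L"
  by (rule GA_mono[OF KL E_closed])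

text \<open>The conjugate of \<open>E\<close> is not presented as a \<open>trace_elem\<close>, since
  \<sigma> does not act on the matrices of \<rho>. Centrality is instead transported from
  \<open>E\<close> by conjugating \<open>a\<close> with the inverse of \<sigma>.\<close>

lemma conj_central:
  assumes \<sigma>: "\<sigma> \<in> Gal L \<rat>" and a: "a \<in> GA L"
  shows "(\<sigma> \<circ> E) \<star> a = a \<star> (\<sigma> \<circ> E)"
proof -
  obtain \<tau> where \<tau>: "\<tau> \<in> Gal L \<rat>" and r: "\<And>x. x \<in> L \<Longrightarrow> \<sigma> (\<tau> x) = x"
    using Gal_inverse[OF L \<sigma> FL] by metis
  have \<tau>a: "\<tau> \<circ> a \<in> GA L" by (rule Gal_comp_closed[OF L \<tau> a])
  have "\<sigma> \<circ> (\<tau> \<circ> a) = a" using r GA_value[OF L a] by (simp add: fun_eq_iff)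
  then show ?thesis
    using Gal_comp_conv[OF L \<sigma> E_closed_L \<tau>a] Gal_comp_conv[OF L \<sigma> \<tau>a E_closed_L]
      trace_elem_central[OF rep, of c "\<tau> \<circ> a"] by simp
qed

lemma conj_cases:
  assumes \<sigma>: "\<sigma> \<in> Gal L \<rat>"
  shows "E \<star> (\<sigma> \<circ> E) = (\<lambda>g. 0) \<or> E \<star> (\<sigma> \<circ> E) = E"
proof (rule central_idempotent_cases[OF irr idem])
  let ?E' = "\<sigma> \<circ> E"
  have E': "?E' \<in> GA L" by (rule Gal_comp_closed[OF L \<sigma> E_closed_L])
  have E'_idem: "?E' \<star> ?E' = ?E'"
    using Gal_comp_conv[OF L \<sigma> E_closed_L E_closed_L] idem by simp
  have central: "E \<star> a = a \<star> E" for a by (rule trace_elem_central[OF rep])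
  show "E \<star> ?E' \<star> E = E \<star> ?E'"
    by (metis central conv_assoc idem)
  then show "E \<star> ?E' \<star> (E \<star> ?E') = E \<star> ?E'"
    by (metis conv_assoc E'_idem)
  fix x assume x: "x \<in> carrier G"
  show "delta x \<star> (E \<star> ?E') = E \<star> ?E' \<star> delta x"
    by (metis central conv_assoc conj_central[OF \<sigma> delta_closed[OF x L]])
qed

text \<open>If the product is nonzero, it equals \<open>E\<close>, so \<open>E\<close> lies below
  its conjugate. The same holds for the inverse of \<sigma>, and applying \<sigma> to that relation
  gives \<open>\<sigma> \<circ> E = E\<close>. Then \<sigma> fixes all character values and with
  them the field they generate.\<close>

lemma conj_orthogonal:
  assumes \<sigma>: "\<sigma> \<in> Gal L \<rat>" and not_K: "\<sigma> \<notin> Gal L (character_field G \<rho>)"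
  shows "E \<star> (\<sigma> \<circ> E) = (\<lambda>g. 0)"
proof (rule ccontr)
  assume nz: "E \<star> (\<sigma> \<circ> E) \<noteq> (\<lambda>g. 0)"
  then have eq1: "E \<star> (\<sigma> \<circ> E) = E" using conj_cases[OF \<sigma>] by simp
  obtain \<tau> where \<tau>: "\<tau> \<in> Gal L \<rat>" and r: "\<And>x. x \<in> L \<Longrightarrow> \<sigma> (\<tau> x) = x"
    using Gal_inverse[OF L \<sigma> FL] by metis
  have \<tau>E: "\<tau> \<circ> E \<in> GA L" by (rule Gal_comp_closed[OF L \<tau> E_closed_L])
  have "\<sigma> \<circ> (\<tau> \<circ> E) = E" using r GA_value[OF L E_closed_L] by (simp add: fun_eq_iff)
  then have sw: "\<sigma> \<circ> (E \<star> (\<tau> \<circ> E)) = E \<star> (\<sigma> \<circ> E)"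
    using Gal_comp_conv[OF L \<sigma> E_closed_L \<tau>E] conj_central[OF \<sigma> E_closed_L] by simp
  have "\<sigma> \<circ> (\<lambda>g :: 'g. 0) = (\<lambda>g. 0)" by (simp add: fun_eq_iff Gal_zero[OF L \<sigma>])
  then have "E \<star> (\<tau> \<circ> E) = E" using conj_cases[OF \<tau>] sw nz by auto
  then have \<sigma>E: "\<sigma> \<circ> E = E" using sw eq1 by simp
  have fix_char: "\<sigma> (mat_trace (\<rho> g)) = mat_trace (\<rho> g)" if g: "g \<in> carrier G" for g
  proof -
    have "\<sigma> (c * mat_trace (\<rho> g)) = c * mat_trace (\<rho> g)"
      using fun_cong[OF \<sigma>E, of "inv g"] g by (simp add: trace_elem_def)
    moreover have "\<sigma> (c * mat_trace (\<rho> g)) = c * \<sigma> (mat_trace (\<rho> g))"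
      using character_in_K[OF g] KL c_Rats FL by (subst Gal_mult[OF \<sigma>]) (auto simp: Gal_fixed[OF \<sigma>])
    ultimately show ?thesis using c_nonzero by simp
  qed
  have "subfield {x \<in> L. \<sigma> x = x} complex_ring"
    by (rule complex_ring_subfieldI)
      (auto simp: subfield_one[OF L] subfield_add[OF L] subfield_uminus[OF L] subfield_mult[OF L]
        subfield_inverse[OF L] Gal_one[OF \<sigma>] Gal_add[OF \<sigma>] Gal_uminus[OF L \<sigma>] Gal_mult[OF \<sigma>]
        Gal_inverse_elem[OF L \<sigma>])
  moreover have "\<rat> \<union> rep_character \<rho> ` carrier G \<subseteq> {x \<in> L. \<sigma> x = x}"
    using FL Gal_fixed[OF \<sigma>] fix_char character_in_K KL by (auto simp: rep_character_trace)
  ultimately have "character_field G \<rho> \<subseteq> {x \<in> L. \<sigma> x = x}"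
    unfolding character_field_def
    by (intro field.generate_field_min_subfield1[OF field_from_type_algebra]) auto
  then have "\<sigma> \<in> Gal L (character_field G \<rho>)" using \<sigma> by (auto simp: Gal_def)
  with not_K show False ..
qed

end

locale galois_orthogonal = galois_conjugates +
  fixes I :: "'i set" and u :: "'i \<Rightarrow> 'a \<Rightarrow> complex"
  assumes u_closed: "s \<in> I \<Longrightarrow> u s \<in> GA L"
    and u_E: "s \<in> I \<Longrightarrow> u s \<star> E = u s"
    and u_conj: "\<And>s t \<tau>. s \<in> I \<Longrightarrow> t \<in> I \<Longrightarrow> \<tau> \<in> Gal L (character_field G \<rho>) \<Longrightarrow>
      u s \<star> (\<tau> \<circ> u t) = (if s = t \<and> \<tau> = (\<lambda>x\<in>L. x) then u s else (\<lambda>g. 0))"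
begin

text \<open>Pulling \<sigma> out leaves the automorphism \<alpha>, the inverse of \<sigma> followed
  after \<sigma>', on the right factor only. If \<alpha> fixes the character field,
  \<open>u_conj\<close> applies; otherwise \<open>E \<star> (\<alpha> \<circ> E)\<close> can be
  inserted between the factors, and it is zero.\<close>

lemma conj_u_mult:
  assumes st: "s \<in> I" "t \<in> I" and \<sigma>: "\<sigma> \<in> Gal L \<rat>" and \<sigma>': "\<sigma>' \<in> Gal L \<rat>"
  shows "(\<sigma> \<circ> u s) \<star> (\<sigma>' \<circ> u t) = (if s = t \<and> \<sigma> = \<sigma>' then \<sigma> \<circ> u s else (\<lambda>g. 0))"
proof -
  obtain \<tau> where \<tau>: "\<tau> \<in> Gal L \<rat>" and l: "\<And>x. x \<in> L \<Longrightarrow> \<tau> (\<sigma> x) = x" and r: "\<And>x. x \<in> L \<Longrightarrow> \<sigma> (\<tau> x) = x"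
    using Gal_inverse[OF L \<sigma> FL] by metis
  define \<alpha> where "\<alpha> = compose L \<tau> \<sigma>'"
  have \<alpha>: "\<alpha> \<in> Gal L \<rat>" unfolding \<alpha>_def by (rule Gal_compose[OF L \<tau> \<sigma>' FL])
  have \<sigma>\<alpha>: "compose L \<sigma> \<alpha> = \<sigma>'"
    by (rule extensionalityI[of _ L]) (simp_all add: Gal_extensional[OF \<sigma>'] compose_eq \<alpha>_def r Gal_closed[OF \<sigma>'])
  have \<alpha>_id: "\<alpha> = (\<lambda>x\<in>L. x) \<longleftrightarrow> \<sigma> = \<sigma>'"
  proof
    assume "\<alpha> = (\<lambda>x\<in>L. x)"
    then have "\<sigma>' = compose L \<sigma> (\<lambda>x\<in>L. x)" using \<sigma>\<alpha> by simp
    also have "\<dots> = \<sigma>" by (rule extensionalityI[of _ L]) (simp_all add: Gal_extensional[OF \<sigma>] compose_eq)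
    finally show "\<sigma> = \<sigma>'" by simp
  next
    assume eq: "\<sigma> = \<sigma>'"
    show "\<alpha> = (\<lambda>x\<in>L. x)"
      by (rule extensionalityI[of _ L]) (simp_all add: \<alpha>_def compose_eq l flip: eq)
  qed
  have \<alpha>u: "\<alpha> \<circ> u t \<in> GA L" by (rule Gal_comp_closed[OF L \<alpha> u_closed[OF st(2)]])
  have prod: "u s \<star> (\<alpha> \<circ> u t) = (if s = t \<and> \<alpha> = (\<lambda>x\<in>L. x) then u s else (\<lambda>g. 0))"
  proof (cases "\<alpha> \<in> Gal L (character_field G \<rho>)")
    case True
    then show ?thesis by (rule u_conj[OF st])
  next
    case False
    have "\<alpha> \<circ> u t = (\<alpha> \<circ> u t) \<star> (\<alpha> \<circ> E)"
      using Gal_comp_conv[OF L \<alpha> u_closed[OF st(2)] E_closed_L] u_E[OF st(2)] by simp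
    also have "\<dots> = (\<alpha> \<circ> E) \<star> (\<alpha> \<circ> u t)" by (rule conj_central[OF \<alpha> \<alpha>u, symmetric])
    finally have "u s \<star> (\<alpha> \<circ> u t) = (u s \<star> E) \<star> ((\<alpha> \<circ> E) \<star> (\<alpha> \<circ> u t))"
      using u_E[OF st(1)] by simp
    also have "\<dots> = u s \<star> (E \<star> (\<alpha> \<circ> E)) \<star> (\<alpha> \<circ> u t)" by (simp only: conv_assoc)
    also have "\<dots> = (\<lambda>g. 0)" by (simp add: conj_orthogonal[OF \<alpha> False])
    finally show ?thesis using False id_in_Gal(2) by auto
  qed
  have zero: "\<sigma> \<circ> (\<lambda>g. 0) = (\<lambda>g. 0)" by (simp add: fun_eq_iff Gal_zero[OF L \<sigma>])
  have "(\<sigma> \<circ> u s) \<star> (\<sigma>' \<circ> u t) = \<sigma> \<circ> (u s \<star> (\<alpha> \<circ> u t))"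
    using Gal_comp_conv[OF L \<sigma> u_closed[OF st(1)] \<alpha>u] compose_comp[OF L u_closed[OF st(2)], of \<sigma> \<alpha>]
    by (simp add: \<sigma>\<alpha>)
  also have "\<dots> = (if s = t \<and> \<sigma> = \<sigma>' then \<sigma> \<circ> u s else (\<lambda>g. 0))"
    by (simp only: prod \<alpha>_id zero if_distrib[of "\<lambda>a. \<sigma> \<circ> a"])
  finally show ?thesis .
qed

text \<open>Orthogonality is visible in this form, as a sum over the whole group
  \<open>Gal L \<rat>\<close>; \<open>f_tower\<close> supplies the form that passes through the
  character field.\<close>

definition f :: "'i \<Rightarrow> 'a \<Rightarrow> complex" where
  "f s = (\<lambda>g. \<Sum>\<sigma>\<in>Gal L \<rat>. \<sigma> (u s g))"

lemma f_closed: "s \<in> I \<Longrightarrow> f s \<in> GA \<rat>"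
  using u_closed[of s] sum_Gal_fixed GA_value[OF L]
  by (auto simp: GA_iff f_def Gal_zero[OF L])

lemma f_conv:
  assumes st: "s \<in> I" "t \<in> I"
  shows "f s \<star> f t = (if s = t then f s else (\<lambda>g. 0))"
proof -
  have f_comp: "f s = (\<lambda>g. \<Sum>\<sigma>\<in>Gal L \<rat>. (\<sigma> \<circ> u s) g)" for s
    by (simp add: f_def)
  have "f s \<star> f t = (\<lambda>g. \<Sum>\<sigma>\<in>Gal L \<rat>. \<Sum>\<sigma>'\<in>Gal L \<rat>. ((\<sigma> \<circ> u s) \<star> (\<sigma>' \<circ> u t)) g)"
    unfolding f_comp conv_sum_left conv_sum_right by simp
  also have "\<dots> = (\<lambda>g. \<Sum>\<sigma>\<in>Gal L \<rat>. \<Sum>\<sigma>'\<in>Gal L \<rat>. if \<sigma>' = \<sigma> then (if s = t then (\<sigma> \<circ> u s) g else 0) else 0)"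
    by (rule ext, intro sum.cong refl) (simp add: conj_u_mult[OF st])
  also have "\<dots> = (if s = t then f s else (\<lambda>g. 0))"
    using finite_Gal by (auto simp: f_def)
  finally show ?thesis .
qed

lemma conj_u_value: "s \<in> I \<Longrightarrow> u s g \<in> L"
  by (rule GA_value[OF L u_closed])

lemma sum_Gal_u_closed: "s \<in> I \<Longrightarrow> (\<Sum>\<tau>\<in>Gal L (character_field G \<rho>). \<tau> (u s g)) \<in> character_field G \<rho>"
  by (rule galois_tower.sum_Gal_fixed[OF galois_tower_top conj_u_value])

lemma f_tower:
  "s \<in> I \<Longrightarrow> f s g = (\<Sum>\<phi>\<in>Gal (character_field G \<rho>) \<rat>. \<phi> (\<Sum>\<tau>\<in>Gal L (character_field G \<rho>). \<tau> (u s g)))"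
  unfolding f_def by (rule sum_Gal_tower[OF conj_u_value sum_Gal_u_closed])

text \<open>The trace from the character field to \<rat> is applied to each coefficient of
  \<open>E\<close>, once written through the character and once as the sum of the elements
  k_s.\<close>

lemma rational_trace_eq_sum:
  assumes fin: "complex_ring.finite_dimension \<rat> L"
    and E_sum: "E = (\<lambda>g. \<Sum>s\<in>I. \<Sum>\<tau>\<in>Gal L (character_field G \<rho>). \<tau> (u s g))"
    and g: "g \<in> carrier G"
  shows "c * field_trace (character_field G \<rho>) \<rat> (mat_trace (\<rho> (inv g))) = (\<Sum>s\<in>I. f s g)"
proof -
  let ?K = "character_field G \<rho>"
  let ?\<chi> = "mat_trace (\<rho> (inv g))"
  have \<chi>: "?\<chi> \<in> ?K" using g by (intro character_in_K) simp
  have "c * field_trace ?K \<rat> ?\<chi> = (\<Sum>\<phi>\<in>Gal ?K \<rat>. c * \<phi> ?\<chi>)"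
    by (simp add: field_trace_eq[OF fin \<chi>] sum_distrib_left)
  also have "\<dots> = (\<Sum>\<phi>\<in>Gal ?K \<rat>. \<Sum>s\<in>I. \<phi> (\<Sum>\<tau>\<in>Gal L ?K. \<tau> (u s g)))"
  proof (rule sum.cong[OF refl])
    fix \<phi> assume \<phi>: "\<phi> \<in> Gal ?K \<rat>"
    have "c * \<phi> ?\<chi> = \<phi> (c * ?\<chi>)"
      using c_Rats FK \<chi> by (subst Gal_mult[OF \<phi>]) (auto simp: Gal_fixed[OF \<phi>])
    also have "c * ?\<chi> = E g" using g by (simp add: trace_elem_def)
    also have "\<dots> = (\<Sum>s\<in>I. \<Sum>\<tau>\<in>Gal L ?K. \<tau> (u s g))" by (simp add: E_sum)
    also have "\<phi> \<dots> = (\<Sum>s\<in>I. \<phi> (\<Sum>\<tau>\<in>Gal L ?K. \<tau> (u s g)))"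
      by (rule Gal_sum[OF K \<phi> sum_Gal_u_closed])
    finally show "c * \<phi> ?\<chi> = (\<Sum>s\<in>I. \<phi> (\<Sum>\<tau>\<in>Gal L ?K. \<tau> (u s g)))" .
  qed
  also have "\<dots> = (\<Sum>s\<in>I. \<Sum>\<phi>\<in>Gal ?K \<rat>. \<phi> (\<Sum>\<tau>\<in>Gal L ?K. \<tau> (u s g)))"
    by (rule sum.swap)
  also have "\<dots> = (\<Sum>s\<in>I. f s g)"
    by (rule sum.cong[OF refl]) (simp add: f_tower)
  finally show ?thesis .
qed

end

section \<open>Dimension count over \<rat> and the character of \<open>W\<close>\<close>

lemma (in finite_group) primitive_idempotent_of_dimension:
  assumes F: "subfield F complex_ring" and irr: "irreducible_rep G F d W"
    and E: "trace_elem W c \<in> GA F" "trace_elem W c \<star> trace_elem W c = trace_elem W c"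
    and e: "e \<in> GA F" "e \<star> trace_elem W c = e" "e \<star> e = e"
    and dim: "of_nat (card (carrier G)) * e \<one> = of_nat d"
  shows "primitive_idempotent (block_ring (group_algebra G F) (trace_elem W c)) e"
proof -
  let ?R = "block_ring (group_algebra G F) (trace_elem W c)"
  note iff = idempotent_elem_block_iff[OF F E]
  have sel: "\<zero>\<^bsub>?R\<^esub> = (\<lambda>g. 0)" "x \<oplus>\<^bsub>?R\<^esub> y = (\<lambda>g. x g + y g)" for x y
    by (simp_all add: block_ring_def)
  have d: "d > 0" using irr by (simp add: irreducible_rep_def)
  have "a = (\<lambda>g. 0) \<or> b = (\<lambda>g. 0)"
    if ab: "idempotent_elem ?R a" "idempotent_elem ?R b" "e = (\<lambda>g. a g + b g)" for a b
  proof (rule ccontr)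
    assume "\<not> ?thesis"
    then have nz: "a \<noteq> (\<lambda>g. 0)" "b \<noteq> (\<lambda>g. 0)" by auto
    obtain k where k: "of_nat (card (carrier G)) * a \<one> = of_nat (d + k)"
      using idempotent_ideal_dimension[OF F irr _ _ _ nz(1), of c] ab(1) unfolding iff by blast
    obtain k' where k': "of_nat (card (carrier G)) * b \<one> = of_nat (d + k')"
      using idempotent_ideal_dimension[OF F irr _ _ _ nz(2), of c] ab(2) unfolding iff by blast
    have "(of_nat d :: complex) = of_nat (card (carrier G)) * a \<one> + of_nat (card (carrier G)) * b \<one>"
      using dim ab(3) by (simp add: algebra_simps)
    also have "\<dots> = of_nat ((d + k) + (d + k'))" unfolding k k' by simp
    finally have "d = (d + k) + (d + k')" by (simp only: of_nat_eq_iff)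
    then show False using d by simp
  qed
  moreover have "e \<noteq> (\<lambda>g. 0)" using dim d by auto
  ultimately show ?thesis
    unfolding primitive_idempotent_def sel using iff[of e] e by blast
qed

text \<open>Equivalence preserves traces. The entries of \<rho> may lie outside \<open>L\<close>,
  but its trace is that of the realization \<rho>' over \<open>L\<close>, so \<sigma> can be applied
  to it. The degree \<open>d\<close> is found by comparing matrix sizes at the identity.\<close>

lemma (in finite_group) associated_rational_rep_trace:
  assumes W: "associated_rational_rep G L n \<rho> d W" and L: "subfield L complex_ring"
  shows "finite (Gal L \<rat>)" "d = n * card (Gal L \<rat>)"
    "\<And>g. g \<in> carrier G \<Longrightarrow> mat_trace (W g) = (\<Sum>\<sigma>\<in>Gal L \<rat>. \<sigma> (mat_trace (\<rho> g)))"
proof -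
  obtain \<rho>' \<sigma>s where rep': "matrix_rep G L n \<rho>'" and eq: "equivalent_reps G UNIV \<rho> \<rho>'"
    and \<sigma>s: "distinct \<sigma>s" "set \<sigma>s = Gal L \<rat>"
    and eqW: "equivalent_reps G L W (\<lambda>g. diag_block_mat (map (\<lambda>\<sigma>. map_mat \<sigma> (\<rho>' g)) \<sigma>s))"
    and irrW: "irreducible_rep G \<rat> d W"
    using W by (auto simp: associated_rational_rep_def)
  have repW: "matrix_rep G \<rat> d W" using irrW by (simp add: irreducible_rep_def)
  obtain P Q where PQ: "\<And>g. g \<in> carrier G \<Longrightarrow> similar_mat_wit (\<rho> g) (\<rho>' g) P Q"
    using eq unfolding equivalent_reps_def by blast
  let ?D = "\<lambda>g. diag_block_mat (map (\<lambda>\<sigma>. map_mat \<sigma> (\<rho>' g)) \<sigma>s)"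
  obtain P' Q' where PQ': "\<And>g. g \<in> carrier G \<Longrightarrow> similar_mat_wit (W g) (?D g) P' Q'"
    using eqW unfolding equivalent_reps_def by blast
  show "finite (Gal L \<rat>)" using \<sigma>s(2) by (metis List.finite_set)
  have "dim_row (?D \<one>) = d"
    by (rule carrier_matD(1)[OF similar_mat_witD2(5)[OF rep_carrier[OF repW one_closed] PQ'[OF one_closed]]])
  moreover have "dim_row (?D \<one>) = n * length \<sigma>s"
    using rep_carrier[OF rep' one_closed]
    by (simp add: dim_diag_block_mat comp_def sum_list_triv)
  ultimately show "d = n * card (Gal L \<rat>)"
    using distinct_card[OF \<sigma>s(1)] \<sigma>s(2) by simp
  fix g assume g: "g \<in> carrier G"
  have r: "\<rho>' g \<in> carrier_mat n n" by (rule rep_carrier[OF rep' g])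
  have "mat_trace (W g) = (\<Sum>\<sigma>\<leftarrow>\<sigma>s. mat_trace (map_mat \<sigma> (\<rho>' g)))"
    using r mat_trace_similar[OF PQ'[OF g]]
    by (subst (asm) mat_trace_diag_block_mat) (auto simp: comp_def)
  also have "\<dots> = (\<Sum>\<sigma>\<in>Gal L \<rat>. mat_trace (map_mat \<sigma> (\<rho>' g)))"
    using \<sigma>s by (simp add: sum_list_distinct_conv_sum_set)
  also have "\<dots> = (\<Sum>\<sigma>\<in>Gal L \<rat>. \<sigma> (mat_trace (\<rho> g)))"
  proof (rule sum.cong[OF refl])
    fix \<sigma> assume \<sigma>: "\<sigma> \<in> Gal L \<rat>"
    have "\<sigma> (mat_trace (\<rho>' g)) = (\<Sum>i<n. \<sigma> (\<rho>' g $$ (i, i)))"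
    proof -
      have "\<sigma> (\<Sum>i<n. \<rho>' g $$ (i, i)) = (\<Sum>i<n. \<sigma> (\<rho>' g $$ (i, i)))"
        by (rule Gal_sum[OF L \<sigma>]) (simp add: rep_entry[OF rep' g])
      then show ?thesis using r by (simp add: mat_trace_def)
    qed
    then show "mat_trace (map_mat \<sigma> (\<rho>' g)) = \<sigma> (mat_trace (\<rho> g))"
      using r mat_trace_similar[OF PQ[OF g]] by (simp add: mat_trace_def)
  qed
  finally show "mat_trace (W g) = (\<Sum>\<sigma>\<in>Gal L \<rat>. \<sigma> (mat_trace (\<rho> g)))" .
qed

theorem corollary3p6:
  fixes G :: "('g, 'b) monoid_scheme"
    and n m d :: nat
    and V W :: "'g \<Rightarrow> complex mat"
    and K L :: "complex set"
    and l u k f :: "nat \<Rightarrow> 'g \<Rightarrow> complex"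
    and jj :: "nat \<Rightarrow> nat"
    and eV eW :: "'g \<Rightarrow> complex"
  assumes "group G" and "finite (carrier G)"
    and "irreducible_rep G UNIV n V"
    and "m = schur_index G n V"
    and "K = character_field G V"
    and "field_of_definition G n V L" and "K \<subseteq> L"
    and "ring.dimension complex_ring m K L"
    and "galois_extension L \<rat>"
    and "eV = character_idempotent G n V"
    and "associated_rational_rep G L n V d W"
    and "eW = rational_idempotent G n V"
    and "primitive_orthogonal_idempotents (block_ring (group_algebra G L) eV) {1..n} l"
    and "eV = (\<Oplus>\<^bsub>group_algebra G L\<^esub>i\<in>{1..n}. l i)"
    and "primitive_orthogonal_idempotents (block_ring (group_algebra G L) eV) {1..n div m} u"
    and "jj \<in> {1..n div m} \<rightarrow> {1..n}"
    and "inj_on (\<lambda>s. PIdl\<^bsub>group_algebra G L\<^esub> (l (jj s))) {1..n div m}"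
    and "\<forall>s\<in>{1..n div m}. u s \<in> PIdl\<^bsub>group_algebra G L\<^esub> (l (jj s))"
    and "\<forall>s\<in>{1..n div m}. \<forall>\<tau>\<in>Gal L K.
           primitive_idempotent (block_ring (group_algebra G L) eV) (\<tau> \<circ> u s) \<and>
           PIdl\<^bsub>group_algebra G L\<^esub> (\<tau> \<circ> u s) = (\<lambda>x. \<tau> \<circ> x) ` (PIdl\<^bsub>group_algebra G L\<^esub> (l (jj s))) \<and>
           (\<lambda>x. \<tau> \<circ> x) ` (PIdl\<^bsub>group_algebra G L\<^esub> (l (jj s))) = PIdl\<^bsub>group_algebra G L\<^esub> (\<tau> \<circ> l (jj s))"
    and "\<forall>s\<in>{1..n div m}. \<forall>t\<in>{1..n div m}. \<forall>\<tau>\<in>Gal L K. \<forall>\<tau>'\<in>Gal L K.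
           (\<tau> \<circ> u s) \<otimes>\<^bsub>group_algebra G L\<^esub> (\<tau>' \<circ> u t) =
             (if (s, \<tau>) = (t, \<tau>') then \<tau> \<circ> u s else \<zero>\<^bsub>group_algebra G L\<^esub>)"
    and "is_direct_sum (group_algebra G L) (PIdl\<^bsub>group_algebra G L\<^esub> eV) ({1..n div m} \<times> Gal L K)
           (\<lambda>(s, \<tau>). PIdl\<^bsub>group_algebra G L\<^esub> (\<tau> \<circ> u s))"
    and "eV = (\<Oplus>\<^bsub>group_algebra G L\<^esub>s\<in>{1..n div m}. \<Oplus>\<^bsub>group_algebra G L\<^esub>\<tau>\<in>Gal L K. \<tau> \<circ> u s)"
    and "k = (\<lambda>s. \<Oplus>\<^bsub>group_algebra G L\<^esub>\<tau>\<in>Gal L K. \<tau> \<circ> u s)"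
    and "f = (\<lambda>s. \<Oplus>\<^bsub>group_algebra G K\<^esub>\<phi>\<in>Gal K \<rat>. \<phi> \<circ> k s)"
  shows "(\<forall>s\<in>{1..n div m}. k s \<in> carrier (group_algebra G K) \<and>
            f s = (\<Oplus>\<^bsub>group_algebra G L\<^esub>\<sigma>\<in>Gal L \<rat>. \<sigma> \<circ> u s)) \<and>
         primitive_orthogonal_idempotents (block_ring (group_algebra G \<rat>) eW) {1..n div m} f \<and>
         eW = (\<Oplus>\<^bsub>group_algebra G \<rat>\<^esub>s\<in>{1..n div m}. f s)"
proof -
  interpret finite_group G using assms(1,2) by (simp add: finite_group_def finite_group_axioms_def)
  let ?I = "{1..n div m}"
  define c :: complex where "c = of_nat n / of_nat (card (carrier G))"
  have irr: "irreducible_rep G UNIV n V" by (rule assms(3))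
  then have rep: "matrix_rep G UNIV n V" and n: "n > 0" by (simp_all add: irreducible_rep_def)
  have c: "c \<in> \<rat>" "c \<noteq> 0" using n order_pos by (simp_all add: c_def)
  have eV: "eV = trace_elem V c" by (simp add: assms(10) character_idempotent_eq c_def)
  have L: "subfield L complex_ring" and fin: "complex_ring.finite_dimension \<rat> L"
    and fixed: "{x \<in> L. \<forall>\<sigma>\<in>Gal L \<rat>. \<sigma> x = x} = \<rat>"
    using assms(9) by (auto simp: galois_extension_def)
  have K: "subfield K complex_ring"
    unfolding assms(5) character_field_def
    by (intro field.generate_field_is_subfield field_from_type_algebra) auto
  note W = associated_rational_rep_trace[OF assms(11) L]
  have irrW: "irreducible_rep G \<rat> d W" using assms(11) by (simp add: associated_rational_rep_def)
  then have repW: "matrix_rep G \<rat> d W" by (simp add: irreducible_rep_def)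

  \<comment> \<open>At this point membership in the block only says \<open>a = r \<star> eV\<close>;
    the form \<open>a \<star> eV = a\<close> has to wait for \<open>idem\<close>.\<close>
  have block: "a \<in> GA L \<and> a \<star> a = a \<and> (\<exists>r. a = r \<star> eV) \<and> a \<noteq> (\<lambda>g. 0)"
    if "eV \<in> GA L" "primitive_idempotent (block_ring (group_algebra G L) eV) a" for a
    using that conv_closed[OF L _ that(1)]
    by (auto simp: primitive_idempotent_def idempotent_elem_def block_ring_def cgenideal_def)
  have tower: "galois_tower \<rat> K L"
  proof (rule galois_tower.intro)
    show "\<sigma> x \<in> K" if "\<sigma> \<in> Gal L \<rat>" "x \<in> K" for \<sigma> x
      using Gal_character_field[OF rep L _ that(1)] that(2) assms(5,7) by simp
  qed (use subfield_Rats_complex K L subfield_Rats[OF K] assms(7) W(1) fixed in auto)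
  interpret T: galois_tower \<rat> K L by (rule tower)
  have chi: "mat_trace (V g) \<in> K" if "g \<in> carrier G" for g
    unfolding assms(5) character_field_def rep_character_trace[symmetric]
    using that by (intro generate_field.incl) auto
  have "c \<in> K" using c(1) subfield_Rats[OF K] by auto
  then have eV_K: "eV \<in> GA K"
    using subfield_zero[OF K] chi by (simp add: GA_iff eV trace_elem_def subfield_mult[OF K])
  then have eV_L: "eV \<in> GA L" by (rule GA_mono[OF assms(7)])
  have l: "l i \<in> GA L" "l i \<star> l i = l i" "\<exists>r. l i = r \<star> eV" "l i \<noteq> (\<lambda>g. 0)" if "i \<in> {1..n}" for i
    using block[OF eV_L, of "l i"] assms(13) that by (auto simp: primitive_orthogonal_idempotents_def)
  have l_orth: "l i \<star> l j = (if i = j then l i else (\<lambda>g. 0))" if "i \<in> {1..n}" "j \<in> {1..n}" for i j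
    using assms(13) that l(2) by (auto simp: primitive_orthogonal_idempotents_def block_ring_def)
  have eV_l: "eV = (\<lambda>g. \<Sum>i\<in>{1..n}. l i g)"
    unfolding assms(14) by (rule group_algebra_finsum[OF L l(1)])
  \<comment> \<open>Obtained from the decomposition into the orthogonal \<open>l i\<close>, in place
    of the orthogonality relations for characters. The idempotence of \<open>eW\<close> is later
    read off from the \<open>f s\<close> in the same way.\<close>
  have idem: "eV \<star> eV = eV"
  proof -
    have "eV \<star> eV = (\<lambda>g. \<Sum>i\<in>{1..n}. \<Sum>j\<in>{1..n}. (l i \<star> l j) g)"
      unfolding eV_l conv_sum_left conv_sum_right by simp
    also have "\<dots> = (\<lambda>g. \<Sum>i\<in>{1..n}. \<Sum>j\<in>{1..n}. if j = i then l i g else 0)"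
      by (rule ext, intro sum.cong refl) (simp add: l_orth)
    also have "\<dots> = eV" by (simp add: eV_l)
    finally show ?thesis .
  qed
  have r_eV: "a \<star> eV = a" if "\<exists>r. a = r \<star> eV" for a
    using that by (auto simp: conv_assoc idem)
  have u: "u s \<in> GA L" "u s \<star> u s = u s" "u s \<star> eV = u s" if "s \<in> ?I" for s
    using block[OF eV_L, of "u s"] assms(15) that r_eV by (auto simp: primitive_orthogonal_idempotents_def)
  have id_u: "(\<lambda>x\<in>L. x) \<circ> u s = u s" if "s \<in> ?I" for s
    using GA_value[OF L u(1)[OF that]] by (auto simp: fun_eq_iff)
  interpret C: galois_conjugates G V L n c
    using tower irr c idem finite_group_axioms
    by (simp add: galois_conjugates_def galois_conjugates_axioms_def assms(5) eV)
  interpret O: galois_orthogonal G V L n c ?I u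
  proof unfold_locales
    fix s t \<tau>
    assume "s \<in> ?I" "t \<in> ?I" and \<tau>: "\<tau> \<in> Gal L (character_field G V)"
    then show "u s \<star> (\<tau> \<circ> u t) = (if s = t \<and> \<tau> = (\<lambda>x\<in>L. x) then u s else (\<lambda>g. 0))"
      using assms(20)[rule_format, of s t "\<lambda>x\<in>L. x" \<tau>] T.id_in_Gal(2) id_u[of s] assms(5) by auto
  qed (use u eV in auto)

  have comp_closed: "\<sigma> \<circ> u s \<in> GA L" if "s \<in> ?I" "\<sigma> \<in> Gal L F" for s \<sigma> F
    by (rule Gal_comp_closed[OF L that(2) u(1)[OF that(1)]])
  have k: "k s = (\<lambda>g. \<Sum>\<tau>\<in>Gal L K. \<tau> (u s g))" if s: "s \<in> ?I" for s
  proof -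
    have "(\<Oplus>\<^bsub>group_algebra G L\<^esub>\<tau>\<in>Gal L K. \<tau> \<circ> u s) = (\<lambda>g. \<Sum>\<tau>\<in>Gal L K. (\<tau> \<circ> u s) g)"
      by (rule group_algebra_finsum[OF L comp_closed[OF s]])
    then show ?thesis by (simp add: assms(23))
  qed
  have k_closed: "k s \<in> GA K" if s: "s \<in> ?I" for s
    using O.sum_Gal_u_closed[OF s] s u(1)[OF s] subfield_zero[OF L] unfolding k[OF s] assms(5)
    by (auto simp: GA_iff Gal_zero[OF L] intro!: sum.neutral)
  have f: "f s = O.f s" if s: "s \<in> ?I" for s
  proof -
    have "(\<Oplus>\<^bsub>group_algebra G K\<^esub>\<phi>\<in>Gal K \<rat>. \<phi> \<circ> k s) = (\<lambda>g. \<Sum>\<phi>\<in>Gal K \<rat>. (\<phi> \<circ> k s) g)"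
      by (rule group_algebra_finsum[OF K Gal_comp_closed[OF K _ k_closed[OF s]]])
    then have "f s = (\<lambda>g. \<Sum>\<phi>\<in>Gal K \<rat>. \<phi> (k s g))" by (simp add: assms(24))
    then show ?thesis using O.f_tower[OF s] by (auto simp: k[OF s] assms(5))
  qed
  have f_L: "f s = (\<Oplus>\<^bsub>group_algebra G L\<^esub>\<sigma>\<in>Gal L \<rat>. \<sigma> \<circ> u s)" if s: "s \<in> ?I" for s
  proof -
    have "(\<Oplus>\<^bsub>group_algebra G L\<^esub>\<sigma>\<in>Gal L \<rat>. \<sigma> \<circ> u s) = (\<lambda>g. \<Sum>\<sigma>\<in>Gal L \<rat>. (\<sigma> \<circ> u s) g)"
      by (rule group_algebra_finsum[OF L comp_closed[OF s]])
    then show ?thesis by (simp add: f[OF s] O.f_def)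
  qed
  have eV_u: "eV = (\<lambda>g. \<Sum>s\<in>?I. \<Sum>\<tau>\<in>Gal L K. \<tau> (u s g))"
  proof -
    have "eV = (\<Oplus>\<^bsub>group_algebra G L\<^esub>s\<in>?I. k s)" using assms(22,23) by simp
    also have "\<dots> = (\<lambda>g. \<Sum>s\<in>?I. k s g)"
      using GA_mono[OF assms(7) k_closed] by (intro group_algebra_finsum[OF L])
    also have "\<dots> = (\<lambda>g. \<Sum>s\<in>?I. \<Sum>\<tau>\<in>Gal L K. \<tau> (u s g))"
      by (rule ext, rule sum.cong[OF refl]) (simp add: k)
    finally show ?thesis .
  qed
  have f_closed: "f s \<in> GA \<rat>" if "s \<in> ?I" for s
    using O.f_closed[OF that] f[OF that] by simp
  have eW_f: "eW = (\<lambda>g. \<Sum>s\<in>?I. f s g)"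
  proof
    fix g
    show "eW g = (\<Sum>s\<in>?I. f s g)"
    proof (cases "g \<in> carrier G")
      case True
      have "c * field_trace K \<rat> (mat_trace (V (inv\<^bsub>G\<^esub> g))) = (\<Sum>s\<in>?I. O.f s g)"
        using O.rational_trace_eq_sum[OF fin _ True] eV_u eV assms(5) by simp
      then show ?thesis
        using True by (simp add: assms(12) rational_idempotent_def rep_character_trace c_def assms(5)[symmetric] f)
    next
      case False
      then show ?thesis using f_closed by (auto simp: assms(12) rational_idempotent_def GA_iff intro!: sum.neutral[symmetric])
    qed
  qed
  have eW_sum: "eW = (\<Oplus>\<^bsub>group_algebra G \<rat>\<^esub>s\<in>?I. f s)"
    unfolding eW_f by (rule group_algebra_finsum[OF subfield_Rats_complex f_closed, symmetric])
  have f_conv: "f s \<star> f t = (if s = t then f s else (\<lambda>g. 0))" if "s \<in> ?I" "t \<in> ?I" for s t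
    using O.f_conv[OF that] f that by simp
  have f_eW: "f s \<star> eW = f s" if s: "s \<in> ?I" for s
  proof -
    have "f s \<star> eW = (\<lambda>g. \<Sum>t\<in>?I. if t = s then f s g else 0)"
      unfolding eW_f conv_sum_right by (rule ext, intro sum.cong refl) (use s in \<open>simp add: f_conv\<close>)
    also have "\<dots> = f s" using s by (simp add: fun_eq_iff)
    finally show ?thesis .
  qed
  have eW_idem: "eW \<star> eW = eW"
  proof -
    have "eW \<star> eW = (\<lambda>g. \<Sum>s\<in>?I. (f s \<star> eW) g)"
      by (subst (1) eW_f) (simp add: conv_sum_left)
    also have "\<dots> = eW" unfolding eW_f[symmetric] by (subst (2) eW_f) (simp add: f_eW)
    finally show ?thesis .
  qed
  have eW_closed: "eW \<in> GA \<rat>"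
    unfolding eW_f using f_closed
    by (auto simp: GA_iff intro!: subfield_sum[OF subfield_Rats_complex] sum.neutral)

  \<comment> \<open>Each character value lies in \<open>K\<close>, so summing its conjugates over
    \<open>Gal L \<rat>\<close> counts every conjugate over \<open>Gal K \<rat>\<close> as many
    times as \<open>Gal L K\<close> has elements; the quotient corrects for this.\<close>
  define c' where "c' = c / of_nat (card (Gal L K))"
  have eW: "eW = trace_elem W c'"
  proof
    fix g
    show "eW g = trace_elem W c' g"
    proof (cases "g \<in> carrier G")
      case g: True
      have \<chi>: "mat_trace (V (inv\<^bsub>G\<^esub> g)) \<in> K" using g by (simp add: chi)
      have triv: "(\<Sum>\<tau>\<in>Gal L K. \<tau> x) = of_nat (card (Gal L K)) * x" if "x \<in> K" for x
        using that by (simp add: Gal_fixed[of _ L K])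
      have "mat_trace (W (inv\<^bsub>G\<^esub> g)) = (\<Sum>\<sigma>\<in>Gal L \<rat>. \<sigma> (mat_trace (V (inv\<^bsub>G\<^esub> g))))"
        using W(3)[of "inv\<^bsub>G\<^esub> g"] g by simp
      also have "\<dots> = (\<Sum>\<phi>\<in>Gal K \<rat>. \<phi> (\<Sum>\<tau>\<in>Gal L K. \<tau> (mat_trace (V (inv\<^bsub>G\<^esub> g)))))"
        using \<chi> assms(7) triv[OF \<chi>] by (intro T.sum_Gal_tower) (auto intro!: subfield_mult[OF K] subfield_of_nat[OF K])
      also have "\<dots> = of_nat (card (Gal L K)) * (\<Sum>\<phi>\<in>Gal K \<rat>. \<phi> (mat_trace (V (inv\<^bsub>G\<^esub> g))))"
        unfolding triv[OF \<chi>] sum_distrib_left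
      proof (rule sum.cong[OF refl])
        fix \<phi> assume \<phi>: "\<phi> \<in> Gal K \<rat>"
        show "\<phi> (of_nat (card (Gal L K)) * mat_trace (V (inv\<^bsub>G\<^esub> g))) = of_nat (card (Gal L K)) * \<phi> (mat_trace (V (inv\<^bsub>G\<^esub> g)))"
          using \<chi> by (subst Gal_mult[OF \<phi>]) (auto simp: Gal_fixed[OF \<phi>] subfield_of_nat[OF K])
      qed
      finally have "mat_trace (W (inv\<^bsub>G\<^esub> g)) = of_nat (card (Gal L K)) * field_trace K \<rat> (mat_trace (V (inv\<^bsub>G\<^esub> g)))"
        by (simp add: T.field_trace_eq[OF fin \<chi>])
      then show ?thesis
        using g T.card_Gal_sub_pos
        by (simp add: assms(12) rational_idempotent_def rep_character_trace assms(5)[symmetric] trace_elem_def c'_def c_def)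
    qed (simp add: assms(12) rational_idempotent_def trace_elem_def)
  qed

  \<comment> \<open>The identity automorphism in condition (1) shows that \<open>u s\<close> and
    \<open>l (jj s)\<close> generate the same left ideal. Each is therefore fixed under right
    multiplication by the other, and \<open>conv_at_one\<close> equates their coefficients at the
    identity.\<close>
  have u_one: "u s \<one>\<^bsub>G\<^esub> = c" if s: "s \<in> ?I" for s
  proof -
    let ?l = "l (jj s)"
    have j: "jj s \<in> {1..n}" using assms(16) s by auto
    have id_image: "(\<lambda>x. (\<lambda>x\<in>L. x) \<circ> x) ` (PIdl\<^bsub>group_algebra G L\<^esub> ?l) = PIdl\<^bsub>group_algebra G L\<^esub> ?l"
    proof -
      have "(\<lambda>x\<in>L. x) \<circ> a = a" if "a \<in> PIdl\<^bsub>group_algebra G L\<^esub> ?l" for a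
      proof -
        have "a \<in> GA L" using that conv_closed[OF L _ l(1)[OF j]] by (auto simp: cgenideal_def)
        then show ?thesis using GA_value[OF L] by (auto simp: fun_eq_iff)
      qed
      then show ?thesis by simp
    qed
    have "PIdl\<^bsub>group_algebra G L\<^esub> (u s) = PIdl\<^bsub>group_algebra G L\<^esub> ?l"
      using assms(19)[rule_format, OF s T.id_in_Gal(2)] id_image id_u[OF s] by simp
    moreover have "a \<in> PIdl\<^bsub>group_algebra G L\<^esub> a" if "a \<in> GA L" "a \<star> a = a" for a
      using that unfolding cgenideal_def by (intro CollectI exI[of _ a]) simp
    ultimately have "u s \<in> PIdl\<^bsub>group_algebra G L\<^esub> ?l" "?l \<in> PIdl\<^bsub>group_algebra G L\<^esub> (u s)"
      using u[OF s] l[OF j] by auto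
    then obtain x y where xy: "u s = x \<star> ?l" "?l = y \<star> u s"
      unfolding cgenideal_def group_algebra_mult by blast
    have "u s \<star> ?l = x \<star> (?l \<star> ?l)" by (subst xy(1)) (rule conv_assoc)
    moreover have "?l \<star> u s = y \<star> (u s \<star> u s)" by (subst xy(2)) (rule conv_assoc)
    ultimately have "u s \<star> ?l = u s" "?l \<star> u s = ?l"
      using l(2)[OF j] u(2)[OF s] by (simp_all flip: xy)
    then have "u s \<one>\<^bsub>G\<^esub> = ?l \<one>\<^bsub>G\<^esub>" using conv_at_one[of "u s" ?l] by simp
    also have "?l \<one>\<^bsub>G\<^esub> = c"
      using complete_idempotents_at_one[OF rep c(2), of "{1..n}" l "jj s"] l r_eV j eV eV_l by simp
    finally show ?thesis .
  qed
  \<comment> \<open>Since \<open>c\<close> is rational, every conjugate of \<open>u s\<close> has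
    the same coefficient \<open>c\<close> at the identity, and \<open>card (carrier G) * c\<close>
    is \<open>n\<close>.\<close>
  have f_one: "of_nat (card (carrier G)) * f s \<one>\<^bsub>G\<^esub> = of_nat d" if s: "s \<in> ?I" for s
  proof -
    have "(\<Sum>\<sigma>\<in>Gal L \<rat>. \<sigma> c) = (\<Sum>\<sigma>\<in>Gal L \<rat>. c)"
      by (rule sum.cong[OF refl]) (rule Gal_fixed[OF _ c(1)])
    then have "f s \<one>\<^bsub>G\<^esub> = of_nat (card (Gal L \<rat>)) * c"
      by (simp add: f[OF s] O.f_def u_one[OF s])
    then show ?thesis using order_pos by (simp add: c_def W(2))
  qed
  have "primitive_idempotent (block_ring (group_algebra G \<rat>) eW) (f s)" if s: "s \<in> ?I" for s
    using primitive_idempotent_of_dimension[OF subfield_Rats_complex irrW, of c' "f s"]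
      f_closed[OF s] f_eW[OF s] f_conv[OF s s] f_one[OF s] eW_closed eW_idem by (simp add: eW)
  moreover have "f s \<otimes>\<^bsub>block_ring (group_algebra G \<rat>) eW\<^esub> f t = \<zero>\<^bsub>block_ring (group_algebra G \<rat>) eW\<^esub>"
    if "s \<in> ?I" "t \<in> ?I" "s \<noteq> t" for s t
    using f_conv[OF that(1,2)] that(3) by (simp add: block_ring_def)
  ultimately show ?thesis
    using k_closed f_L eW_sum by (simp add: primitive_orthogonal_idempotents_def)
qed

end
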